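(* Let $F$ be an almost balanced complete multipartite graph with at least two parts. Then the inducibility problem for $F$ is perfectly stable: there exists a constant $C>0$ such that for every $n$-vertex graph $G$ with $n\ge C$ there is an $n$-vertex complete multipartite graph $H$ satisfying \[ \mathrm{edit}(G,H)\le C\cdot\frac{I(F,n)-I(F,G)}{\binom{n}{v(F)}}\binom{n}{2}. \]
   Context: For graphs $F,G$, $I(F,G)$ is the number of subsets $S\subseteq V(G)$ with $|S|=v(F)$ such that $G[S]\cong F$, and $I(F,n)=\max\{I(F,G):v(G)=n\}$. For two graphs $G,H$ on the same number of vertices, $\mathrm{edit}(G,H)$ is the minimum number of edges one must add to or remove from $G$ to make it isomorphic to $H$. A complete multipartite graph $K_{a_1,\ldots,a_r}$ with part sizes $a_1\ge\cdots\ge a_r\ge 1$ is almost balanced if it is not a complete graph and $\binom{a_1-a_r}{2}<a_r$. *)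

theory Defs
  imports Complex_Main
begin

definition graph_on :: "nat \<Rightarrow> nat set set \<Rightarrow> bool" where
  "graph_on n E \<longleftrightarrow> (\<forall>e\<in>E. e \<subseteq> {0..<n} \<and> card e = 2)"

definition induces :: "nat set set \<Rightarrow> nat \<Rightarrow> nat set set \<Rightarrow> nat set \<Rightarrow> bool" where
  "induces F k G S \<longleftrightarrow>
     (\<exists>f. bij_betw f {0..<k} S \<and>
          (\<forall>u<k. \<forall>v<k. u \<noteq> v \<longrightarrow> ({u, v} \<in> F \<longleftrightarrow> {f u, f v} \<in> G)))"

definition ind_count :: "nat set set \<Rightarrow> nat \<Rightarrow> nat set set \<Rightarrow> nat \<Rightarrow> nat" where
  "ind_count F k G n = card {S. S \<subseteq> {0..<n} \<and> card S = k \<and> induces F k G S}"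

definition inducibility :: "nat set set \<Rightarrow> nat \<Rightarrow> nat \<Rightarrow> nat" where
  "inducibility F k n = Max {ind_count F k G n | G. graph_on n G}"

definition edit_dist :: "nat \<Rightarrow> nat set set \<Rightarrow> nat set set \<Rightarrow> nat" where
  "edit_dist n G H = Inf {card ((G - ((`) \<pi>) ` H) \<union> (((`) \<pi>) ` H - G)) | \<pi>.
                           bij_betw \<pi> {0..<n} {0..<n}}"

definition cmp_graph :: "nat \<Rightarrow> (nat \<Rightarrow> nat) \<Rightarrow> nat set set" where
  "cmp_graph n c = {{u, v} | u v. u < n \<and> v < n \<and> c u \<noteq> c v}"

definition complete_multipartite :: "nat \<Rightarrow> nat set set \<Rightarrow> bool" where
  "complete_multipartite n H \<longleftrightarrow> (\<exists>c. H = cmp_graph n c)"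

definition part_size :: "nat \<Rightarrow> (nat \<Rightarrow> nat) \<Rightarrow> nat \<Rightarrow> nat" where
  "part_size k p i = card {v. v < k \<and> p v = i}"

text \<open>K_{a_1,...,a_r} on {0..<k} with parts p^{-1}(i), i<r (p maps {0..<k} onto {0..<r}),
  is almost balanced: not complete (largest part has size \<ge> 2) and
  (a_1 - a_r choose 2) < a_r.\<close>
definition almost_balanced :: "nat \<Rightarrow> (nat \<Rightarrow> nat) \<Rightarrow> nat \<Rightarrow> bool" where
  "almost_balanced k p r \<longleftrightarrow>
     (let a1 = Max (part_size k p ` {0..<r}); ar = Min (part_size k p ` {0..<r})
      in a1 \<ge> 2 \<and> (a1 - ar) choose 2 < ar)"

end

theory Submission
  imports Defs "HOL-Library.Disjoint_Sets" "HOL-Combinatorics.Transposition"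
begin

text \<open>
  Let \<open>G\<close> maximise the number of copies of \<open>F\<close> plus a small multiple, of order \<open>n ^ (k - 2)\<close>, of the
  truncated edit distance to the complete multipartite graphs; it suffices to show that \<open>G\<close> is complete
  multipartite. Zykov symmetrisation, one vertex at a time, changes the distance by at most \<open>n\<close> and so
  provides a maximiser near some complete multipartite \<open>H\<close>. By maximality all vertices of \<open>G\<close> lie in
  almost the same number of copies, and no edit gains more than a small multiple of \<open>n ^ (k - 2)\<close> copies.

  Merging a vertex \<open>v\<close> with the non-neighbours it has in one class gains all copies that
  distinguish \<open>v\<close> from that class. Hence every vertex is attached to \<open>H\<close> almost like a member of a
  large class, unless it is adjacent to almost everything. The latter is impossible: if all parts of
  \<open>F\<close> have at least two vertices, such a vertex lies in few copies. Otherwise almost balancedness forces all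
  parts of \<open>F\<close> to have one or two vertices; then, for two classes of sizes \<open>x\<close> and \<open>y\<close> with \<open>x + y\<close> fixed, the
  number of copies is a convex quadratic in \<open>x y\<close>, and one could split the largest class at almost no cost and
  then merge all classes into one, where no copies are left.

  Applying the same merging argument to a vertex with a small star of flipped pairs shows that
  every remaining wrong pair, once flipped, gains copies of order \<open>n ^ (k - 2)\<close>, a contradiction.
\<close>

section \<open>Copies of a complete multipartite pattern\<close>

text \<open>The reduction to one extremal graph works because a complete multipartite maximiser has
  penalty zero: then count plus penalty of every graph is at most I(F,n), which is the claimed
  inequality up to the truncation. No class sizes of an optimum are ever computed. Each unwanted
  configuration is refuted by a merge that would gain order n ^ k copies, more than near-maximality
  allows. What limits this is resolution: degrees are known only up to a small multiple of n ^ (k -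
  1), whereas one wrong pair is worth only n ^ (k - 2). A star of \<tau> n flipped pairs lifts the
  effect to the visible order. The gain of the merge is linear in the star, about c3 \<tau>, while
  the error of treating the flips as independent is of order \<tau> ^ 2, so \<tau> is a small
  multiple of c3. Inside a class this linearity relies on a pattern part with one vertex; if there
  is none, an inner edge lies in no copy and its cost is seen directly.\<close>

locale multipartite_pattern =
  fixes k r :: nat and p :: "nat \<Rightarrow> nat"
  assumes r2: "r \<ge> 2" and onto: "p ` {0..<k} = {0..<r}"
    and part2: "\<exists>i<r. part_size k p i \<ge> 2"
begin

definition a :: "nat \<Rightarrow> nat" where "a i = part_size k p i"

text \<open>A labelling by the parts of the pattern replaces the bijection of
  \<open>induces\<close>. Only sizes and adjacencies matter, so copies can be glued from pieces and
  transported without enumerating vertices.\<close>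

definition copy :: "nat set set \<Rightarrow> nat set \<Rightarrow> bool" where
  "copy G S \<longleftrightarrow> finite S \<and> (\<exists>q. (\<forall>x\<in>S. q x < r) \<and> (\<forall>i<r. card {x\<in>S. q x = i} = a i) \<and>
     (\<forall>x\<in>S. \<forall>y\<in>S. x \<noteq> y \<longrightarrow> ({x, y} \<in> G \<longleftrightarrow> q x \<noteq> q y)))"

definition copies :: "nat \<Rightarrow> nat set set \<Rightarrow> nat set set" where
  "copies n G = {S. S \<subseteq> {0..<n} \<and> copy G S}"

definition ind :: "nat \<Rightarrow> nat set set \<Rightarrow> real" where
  "ind n G = real (card (copies n G))"

definition deg :: "nat \<Rightarrow> nat set set \<Rightarrow> nat \<Rightarrow> real" where
  "deg n G v = real (card {S \<in> copies n G. v \<in> S})"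

lemma p_less: "v < k \<Longrightarrow> p v < r"
  using onto by force

lemma a_pos: "i < r \<Longrightarrow> a i \<ge> 1"
proof -
  assume "i < r"
  then obtain v where "v < k" "p v = i" using onto by (metis atLeast0LessThan imageE lessThan_iff)
  then have "{v. v < k \<and> p v = i} \<noteq> {}" by auto
  then show ?thesis unfolding a_def part_size_def
    by (simp add: card_gt_0_iff Suc_le_eq)
qed

lemma card_classes:
  assumes "finite S" "\<forall>x\<in>S. q x < r" "\<forall>i<r. card {x\<in>S. q x = i} = a i"
  shows "card S = (\<Sum>i<r. a i)"
proof -
  have "card S = (\<Sum>i\<in>{..<r}. card {x\<in>S. q x = i})"
    using assms(1,2) by (subst card_eq_sum, subst sum.group[symmetric, of S "{..<r}" q])
      auto
  then show ?thesis using assms(3) by simp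
qed

lemma sum_a: "(\<Sum>i<r. a i) = k"
  using card_classes[of "{0..<k}" p] p_less by (auto simp: a_def part_size_def atLeast0LessThan)

lemma copy_card: "copy G S \<Longrightarrow> card S = k"
  unfolding copy_def using card_classes sum_a by metis

lemma copy_finite: "copy G S \<Longrightarrow> finite S"
  unfolding copy_def by simp

lemma k_ge_3: "k \<ge> 3"
proof -
  obtain i where i: "i < r" "a i \<ge> 2" using part2 a_def by auto
  obtain j where j: "j < r" "j \<noteq> i" using r2 
    by (metis One_nat_def Suc_1 Suc_leI less_le_trans nat_neq_iff not_less_eq zero_less_Suc)
  have "a i + a j = (\<Sum>l\<in>{i,j}. a l)" using j by simp
  also have "\<dots> \<le> (\<Sum>l<r. a l)" using i j by (intro sum_mono2) auto
  finally show ?thesis using sum_a i a_pos[of j] j by linarith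
qed

text \<open>Adjacency depends on the parts alone, so arbitrary bijections between parts of equal
  size glue to an embedding.\<close>

lemma induces_iff_copy:
  assumes "finite S"
  shows "induces (cmp_graph k p) k G S \<longleftrightarrow> copy G S"
proof
  assume "induces (cmp_graph k p) k G S"
  then obtain f where f: "bij_betw f {0..<k} S"
    and adj: "\<forall>u<k. \<forall>v<k. u \<noteq> v \<longrightarrow> ({u, v} \<in> cmp_graph k p \<longleftrightarrow> {f u, f v} \<in> G)"
    unfolding induces_def by blast
  define g where "g = the_inv_into {0..<k} f"
  have g: "\<And>x. x \<in> S \<Longrightarrow> g x < k \<and> f (g x) = x"
    unfolding g_def using f
    by (metis atLeastLessThan_iff bij_betw_def f_the_inv_into_f_bij_betw the_inv_into_into order_refl)
  have gf: "\<And>u. u < k \<Longrightarrow> g (f u) = u"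
    unfolding g_def using f by (simp add: bij_betw_def the_inv_into_f_f)
  have inS: "\<And>u. u < k \<Longrightarrow> f u \<in> S" using f by (auto simp: bij_betw_def)
  have cm: "\<And>u v. u < k \<Longrightarrow> v < k \<Longrightarrow> {u,v} \<in> cmp_graph k p \<longleftrightarrow> p u \<noteq> p v"
    unfolding cmp_graph_def by (auto simp: doubleton_eq_iff)
  show "copy G S" unfolding copy_def
  proof (intro conjI exI[of _ "p \<circ> g"] ballI allI impI)
    fix i assume "i < r"
    have "bij_betw f {v. v < k \<and> p v = i} {x\<in>S. (p \<circ> g) x = i}"
      using g gf inS by (intro bij_betwI[of _ _ _ g]) auto
    then show "card {x\<in>S. (p \<circ> g) x = i} = a i"
      unfolding a_def part_size_def using bij_betw_same_card[OF \<open>bij_betw f _ {x\<in>S. (p \<circ> g) x = i}\<close>] by simp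
  next
    fix x y assume xy: "x \<in> S" "y \<in> S" "x \<noteq> y"
    then have "g x \<noteq> g y" using g by metis
    then show "({x, y} \<in> G) = ((p \<circ> g) x \<noteq> (p \<circ> g) y)"
      using adj g xy cm by (metis comp_apply)
  qed (use assms g p_less in auto)
next
  assume "copy G S"
  then obtain q where q: "\<forall>x\<in>S. q x < r" "\<forall>i<r. card {x\<in>S. q x = i} = a i"
    and adj: "\<forall>x\<in>S. \<forall>y\<in>S. x \<noteq> y \<longrightarrow> ({x, y} \<in> G \<longleftrightarrow> q x \<noteq> q y)"
    unfolding copy_def by blast
  have "\<forall>i<r. \<exists>h. bij_betw h {v. v < k \<and> p v = i} {x\<in>S. q x = i}"
    using q(2) assms by (auto intro!: finite_same_card_bij simp: a_def part_size_def)
  then obtain h where h: "\<And>i. i < r \<Longrightarrow> bij_betw (h i) {v. v < k \<and> p v = i} {x\<in>S. q x = i}"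
    by metis
  define f where "f v = h (p v) v" for v
  have f1: "f v \<in> S \<and> q (f v) = p v" if "v < k" for v
    using h[OF p_less[OF that]] that unfolding f_def bij_betw_def by blast
  have inj: "inj_on f {0..<k}"
  proof (rule inj_onI)
    fix u v assume uv: "u \<in> {0..<k}" "v \<in> {0..<k}" "f u = f v"
    have uk: "u < k" "v < k" using uv by auto
    have "p u = q (f u)" using f1[OF uk(1)] by simp
    then have e: "p u = p v" using f1[OF uk(2)] uv(3) by simp
    have "inj_on (h (p u)) {v. v < k \<and> p v = p u}"
      using h[OF p_less[OF uk(1)]] by (simp add: bij_betw_def)
    moreover have "h (p u) u = h (p u) v" using uv(3) e unfolding f_def by simp
    moreover have "u \<in> {v. v < k \<and> p v = p u}" "v \<in> {v. v < k \<and> p v = p u}"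
      using uk e by simp_all
    ultimately show "u = v" by (rule inj_onD)
  qed
  have "f ` {0..<k} = S"
  proof (rule card_subset_eq)
    show "card (f ` {0..<k}) = card S" using inj copy_card[OF \<open>copy G S\<close>] by (simp add: card_image)
  qed (use assms f1 in auto)
  moreover have "{u, v} \<in> cmp_graph k p \<longleftrightarrow> {f u, f v} \<in> G" if "u < k" "v < k" "u \<noteq> v" for u v
  proof -
    have "f u \<noteq> f v" using inj_onD[OF inj, of u v] that by auto
    then have "{f u, f v} \<in> G \<longleftrightarrow> q (f u) \<noteq> q (f v)" using adj f1 that(1,2) by blast
    then have "{f u, f v} \<in> G \<longleftrightarrow> p u \<noteq> p v" using f1 that(1,2) by simp
    moreover have "{u,v} \<in> cmp_graph k p \<longleftrightarrow> p u \<noteq> p v"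
      unfolding cmp_graph_def using that by (auto simp: doubleton_eq_iff)
    ultimately show ?thesis by simp
  qed
  ultimately show "induces (cmp_graph k p) k G S"
    unfolding induces_def bij_betw_def using inj by blast
qed

lemma ind_count_eq: "real (ind_count (cmp_graph k p) k G n) = ind n G"
proof -
  have "{S. S \<subseteq> {0..<n} \<and> card S = k \<and> induces (cmp_graph k p) k G S} = copies n G"
    unfolding copies_def using induces_iff_copy copy_card
    by (metis finite_atLeastLessThan finite_subset)
  then show ?thesis unfolding ind_count_def ind_def by simp
qed

lemma finite_copies [simp]: "finite (copies n G)"
  unfolding copies_def by (rule finite_subset[of _ "Pow {0..<n}"]) auto

lemma copiesD: "S \<in> copies n G \<Longrightarrow> S \<subseteq> {0..<n} \<and> card S = k \<and> finite S \<and> copy G S"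
  unfolding copies_def using copy_card copy_finite by blast

text \<open>Phrased with division because for patterns of three vertices and \<open>card B = 4\<close> the
  exponent \<open>k - card B\<close> would be truncated.\<close>

lemma card_supersets_le:
  assumes "\<And>S. S \<in> \<S> \<Longrightarrow> S \<subseteq> {0..<n} \<and> card S = k \<and> B \<subseteq> S" "finite B" "n > 0"
  shows "real (card \<S>) \<le> real n ^ k / real n ^ card B"
proof (cases "\<S> = {}")
  case False
  then obtain S0 where "S0 \<in> \<S>" by blast
  then have "card B \<le> k" using assms(1)[of S0] card_mono[of S0 B] finite_subset by fastforce
  have "inj_on (\<lambda>S. S - B) \<S>"
    using assms(1) by (intro inj_onI) blast
  moreover have "(\<lambda>S. S - B) ` \<S> \<subseteq> {T. T \<subseteq> {0..<n} \<and> card T = k - card B}"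
    using assms by (auto simp: card_Diff_subset subset_iff)
  ultimately have "card \<S> \<le> card {T. T \<subseteq> {0..<n} \<and> card T = k - card B}"
    by (intro card_inj_on_le[of "\<lambda>S. S - B"]) auto
  also have "\<dots> = n choose (k - card B)" by (simp add: n_subsets)
  also have "\<dots> \<le> n ^ (k - card B)"
    by (cases "k - card B \<le> n") (auto intro: binomial_le_pow simp: binomial_eq_0)
  finally have "real (card \<S>) \<le> real n ^ (k - card B)" by (metis of_nat_mono of_nat_power)
  then show ?thesis using \<open>card B \<le> k\<close> assms(3) by (simp add: power_diff)
qed simp

lemma deg_le:
  assumes "n > 0" shows "deg n G v \<le> real n ^ k / real n"
  unfolding deg_def using card_supersets_le[of "{S \<in> copies n G. v \<in> S}" n "{v}"] copiesD assms
  by fastforce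

lemma sum_deg: "(\<Sum>v<n. deg n G v) = real k * ind n G"
proof -
  have "(\<Sum>v<n. card {S \<in> copies n G. v \<in> S}) = (\<Sum>S\<in>copies n G. card {v\<in>{..<n}. v \<in> S})"
    by (rule sum_multicount_gen) auto
  also have "\<dots> = (\<Sum>S\<in>copies n G. k)"
  proof (rule sum.cong[OF refl])
    fix S assume "S \<in> copies n G"
    then have "{v\<in>{..<n}. v \<in> S} = S" "card S = k" using copiesD by force+
    then show "card {v\<in>{..<n}. v \<in> S} = k" by simp
  qed
  finally have "(\<Sum>v<n. card {S \<in> copies n G. v \<in> S}) = k * card (copies n G)" by simp
  then show ?thesis unfolding deg_def ind_def
    by (metis of_nat_mult of_nat_sum)
qed

lemma copy_cong:
  assumes "\<And>x y. x \<in> S \<Longrightarrow> y \<in> S \<Longrightarrow> x \<noteq> y \<Longrightarrow> {x,y} \<in> G \<longleftrightarrow> {x,y} \<in> G'"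
  shows "copy G S \<longleftrightarrow> copy G' S"
proof -
  have "(\<forall>x\<in>S. \<forall>y\<in>S. x \<noteq> y \<longrightarrow> ({x, y} \<in> G \<longleftrightarrow> q x \<noteq> q y)) \<longleftrightarrow>
      (\<forall>x\<in>S. \<forall>y\<in>S. x \<noteq> y \<longrightarrow> ({x, y} \<in> G' \<longleftrightarrow> q x \<noteq> q y))" for q :: "nat \<Rightarrow> nat"
    using assms by blast
  then show ?thesis unfolding copy_def by simp
qed

lemma copy_iso:
  assumes "copy G S" "bij_betw f S S'"
    "\<And>x y. x \<in> S \<Longrightarrow> y \<in> S \<Longrightarrow> x \<noteq> y \<Longrightarrow> {x,y} \<in> G \<longleftrightarrow> {f x,f y} \<in> G'"
  shows "copy G' S'"
proof -
  obtain q where q: "finite S" "\<forall>x\<in>S. q x < r" "\<forall>i<r. card {x\<in>S. q x = i} = a i"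
    and adj: "\<forall>x\<in>S. \<forall>y\<in>S. x \<noteq> y \<longrightarrow> ({x, y} \<in> G \<longleftrightarrow> q x \<noteq> q y)"
    using assms(1) unfolding copy_def by blast
  define g where "g = the_inv_into S f"
  have g: "\<And>x. x \<in> S' \<Longrightarrow> g x \<in> S \<and> f (g x) = x"
    unfolding g_def using assms(2)
    by (metis bij_betw_def f_the_inv_into_f_bij_betw the_inv_into_into order_refl)
  have gf: "\<And>u. u \<in> S \<Longrightarrow> g (f u) = u"
    unfolding g_def using assms(2) by (simp add: bij_betw_def the_inv_into_f_f)
  have inS: "\<And>u. u \<in> S \<Longrightarrow> f u \<in> S'" using assms(2) by (auto simp: bij_betw_def)
  show ?thesis unfolding copy_def
  proof (intro conjI exI[of _ "q \<circ> g"] ballI allI impI)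
    show "finite S'" using q(1) assms(2) bij_betw_finite by blast
    fix i assume "i < r"
    have "bij_betw f {x\<in>S. q x = i} {x\<in>S'. (q \<circ> g) x = i}"
      using g gf inS by (intro bij_betwI[of _ _ _ g]) auto
    then show "card {x\<in>S'. (q \<circ> g) x = i} = a i"
      using q(3) \<open>i < r\<close> bij_betw_same_card[OF \<open>bij_betw f {x\<in>S. q x = i} _\<close>] by simp
  next
    fix x y assume xy: "x \<in> S'" "y \<in> S'" "x \<noteq> y"
    then have "g x \<noteq> g y" using g by metis
    then show "({x, y} \<in> G') = ((q \<circ> g) x \<noteq> (q \<circ> g) y)"
      using adj g xy assms(3) by (metis comp_apply)
  qed (use q g in auto)
qed

text \<open>Non-adjacent vertices of a copy lie in one part. This is how the multipartite structure
  of the pattern enters the merging argument.\<close>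

lemma copy_twins:
  assumes "copy G S" "x \<in> S" "y \<in> S" "z \<in> S" "x \<noteq> z" "y \<noteq> z" "{x,y} \<notin> G" "x \<noteq> y"
  shows "{x,z} \<in> G \<longleftrightarrow> {y,z} \<in> G"
  using assms unfolding copy_def by metis

text \<open>Rests on the part of size at least two; it later shows that many copies force a large
  class.\<close>

lemma copy_nonadj:
  assumes "copy G S"
  obtains x y where "x \<in> S" "y \<in> S" "x \<noteq> y" "{x,y} \<notin> G"
proof -
  obtain q where q: "\<forall>i<r. card {x\<in>S. q x = i} = a i"
    and adj: "\<forall>x\<in>S. \<forall>y\<in>S. x \<noteq> y \<longrightarrow> ({x, y} \<in> G \<longleftrightarrow> q x \<noteq> q y)"
    using assms unfolding copy_def by blast
  obtain i where "i < r" "a i \<ge> 2" using part2 a_def by auto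
  then have "card {x\<in>S. q x = i} \<ge> 2" using q by simp
  then obtain Q where Q: "Q \<subseteq> {x\<in>S. q x = i}" "card Q = 2"
    by (meson obtain_subset_with_card_n)
  from Q(2) obtain x y where "Q = {x,y}" "x \<noteq> y" by (meson card_2_iff)
  with Q(1) show ?thesis using that adj by auto
qed

end

section \<open>Editing edges and cloning vertices\<close>

definition ediff :: "'a set \<Rightarrow> 'a set \<Rightarrow> 'a set" where
  "ediff A B = (A - B) \<union> (B - A)"

lemma ediff_commute: "ediff A B = ediff B A"
  unfolding ediff_def by blast

lemma card_ediff_triangle:
  assumes "finite A" "finite B" "finite C"
  shows "card (ediff A C) \<le> card (ediff A B) + card (ediff B C)"
proof -
  have "card (ediff A C) \<le> card (ediff A B \<union> ediff B C)"
    using assms by (intro card_mono) (auto simp: ediff_def)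
  then show ?thesis using card_Un_le le_trans by blast
qed

lemma graph_on_finite: "graph_on n G \<Longrightarrow> finite G"
  by (rule finite_subset[of _ "Pow {0..<n}"]) (auto simp: graph_on_def)

lemma graph_on_pair: "graph_on n G \<Longrightarrow> {x, y} \<in> G \<Longrightarrow> x < n \<and> y < n \<and> x \<noteq> y"
proof -
  assume "graph_on n G" "{x, y} \<in> G"
  then have "{x, y} \<subseteq> {0..<n}" "card {x, y} = 2" unfolding graph_on_def by blast+
  then show ?thesis by (cases "x = y") auto
qed

lemma cmp_graph_pair: "{x, y} \<in> cmp_graph n c \<longleftrightarrow> x < n \<and> y < n \<and> c x \<noteq> c y"
  unfolding cmp_graph_def by (auto simp: doubleton_eq_iff)

lemma graph_on_cmp_graph: "graph_on n (cmp_graph n c)"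
  unfolding graph_on_def cmp_graph_def by (auto simp: card_insert_if)

text \<open>Adjacency is pulled back along the map sending \<open>U\<close> to \<open>v\<close>. In
  a loopless graph \<open>insert v U\<close> thereby becomes an independent set of twins, and pairs
  avoiding \<open>U\<close> are untouched.\<close>

definition clone :: "nat \<Rightarrow> nat set set \<Rightarrow> nat set \<Rightarrow> nat \<Rightarrow> nat set set" where
  "clone n G U v = {{x, y} | x y. x < n \<and> y < n \<and> x \<noteq> y \<and>
     {if x \<in> U then v else x, if y \<in> U then v else y} \<in> G}"

lemma clone_pair:
  "{x, y} \<in> clone n G U v \<longleftrightarrow> x < n \<and> y < n \<and> x \<noteq> y \<and>
     {if x \<in> U then v else x, if y \<in> U then v else y} \<in> G"
proof
  assume "{x, y} \<in> clone n G U v"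
  then obtain x' y' where e: "{x, y} = {x', y'}" "x' < n" "y' < n" "x' \<noteq> y'"
    "{if x' \<in> U then v else x', if y' \<in> U then v else y'} \<in> G"
    unfolding clone_def by blast
  from e(1) have "x = x' \<and> y = y' \<or> x = y' \<and> y = x'" by (simp add: doubleton_eq_iff)
  then show "x < n \<and> y < n \<and> x \<noteq> y \<and> {if x \<in> U then v else x, if y \<in> U then v else y} \<in> G"
    using e(2-5) by (metis insert_commute)
qed (auto simp only: clone_def)

lemma graph_on_clone: "graph_on n (clone n G U v)"
  unfolding graph_on_def clone_def by (auto simp: card_insert_if)

lemma card_edges_at_le:
  assumes "\<And>e. e \<in> D \<Longrightarrow> u \<in> e \<and> card e = 2 \<and> e \<subseteq> {0..<n}"
  shows "card D \<le> n"
proof -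
  have "D \<subseteq> (\<lambda>w. {u, w}) ` {0..<n}"
  proof
    fix e assume "e \<in> D"
    then have e: "u \<in> e" "card e = 2" "e \<subseteq> {0..<n}" using assms by auto
    then obtain x y where "e = {x, y}" by (meson card_2_iff)
    then have "e = {u, x} \<or> e = {u, y}" using e(1) by auto
    then show "e \<in> (\<lambda>w. {u, w}) ` {0..<n}" using e(3) by blast
  qed
  then have "card D \<le> card {0..<n}" by (intro surj_card_le) auto
  then show ?thesis by simp
qed

text \<open>Only pairs at \<open>u\<close> can change.\<close>

lemma card_clone_diff_le:
  assumes "graph_on n G"
  shows "card (ediff G (clone n G {u} v)) \<le> n"
proof (rule card_edges_at_le[where u = u])
  fix e assume e: "e \<in> ediff G (clone n G {u} v)"
  have sub: "card e = 2 \<and> e \<subseteq> {0..<n}"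
    using e assms graph_on_clone[of n G "{u}" v] unfolding ediff_def graph_on_def by blast
  then obtain x y where xy: "e = {x, y}" "x \<noteq> y" by (meson card_2_iff)
  moreover have "u \<in> e"
  proof (rule ccontr)
    assume "u \<notin> e"
    then have "e \<in> G \<longleftrightarrow> e \<in> clone n G {u} v"
      using xy clone_pair[of x y n G "{u}" v] sub by auto
    then show False using e unfolding ediff_def by blast
  qed
  ultimately show "u \<in> e \<and> card e = 2 \<and> e \<subseteq> {0..<n}" using sub by blast
qed

text \<open>Fibres the count over the trace outside \<open>X\<close>, so that an inequality between
  counts can be checked one trace \<open>T\<close> at a time.\<close>

lemma card_sets_split:
  assumes "finite V" "X \<subseteq> V"
  shows "card {S. S \<subseteq> V \<and> R S} = (\<Sum>T\<in>Pow (V - X). card {Q. Q \<subseteq> X \<and> R (T \<union> Q)})"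
proof -
  have fin: "finite X" "finite (Pow (V - X))" using assms finite_subset by auto
  have "card {S. S \<subseteq> V \<and> R S} = card (SIGMA T:Pow (V - X). {Q. Q \<subseteq> X \<and> R (T \<union> Q)})"
  proof (rule bij_betw_same_card, rule bij_betwI[of _ _ _ "\<lambda>(T,Q). T \<union> Q"])
    show "(\<lambda>S. (S - X, S \<inter> X)) \<in> {S. S \<subseteq> V \<and> R S} \<rightarrow> (SIGMA T:Pow (V - X). {Q. Q \<subseteq> X \<and> R (T \<union> Q)})"
      by (auto simp: Un_Diff_Int)
    show "(\<lambda>(T,Q). T \<union> Q) \<in> (SIGMA T:Pow (V - X). {Q. Q \<subseteq> X \<and> R (T \<union> Q)}) \<rightarrow> {S. S \<subseteq> V \<and> R S}"
      using assms by auto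
    show "(case (S - X, S \<inter> X) of (T, Q) \<Rightarrow> T \<union> Q) = S" for S by auto
    show "((case y of (T, Q) \<Rightarrow> T \<union> Q) - X, (case y of (T, Q) \<Rightarrow> T \<union> Q) \<inter> X) = y"
      if "y \<in> (SIGMA T:Pow (V - X). {Q. Q \<subseteq> X \<and> R (T \<union> Q)})" for y
      using that by auto
  qed
  also have "\<dots> = (\<Sum>T\<in>Pow (V - X). card {Q. Q \<subseteq> X \<and> R (T \<union> Q)})"
    using fin by (intro card_SigmaI) auto
  finally show ?thesis .
qed

lemma card_pieces:
  assumes "finite J" "disjoint_family_on A J" "\<And>j. j \<in> J \<Longrightarrow> finite (A j)"
  shows "card {S. S \<subseteq> (\<Union>j\<in>J. A j) \<and> (\<forall>j\<in>J. card (S \<inter> A j) = b j)} =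
         (\<Prod>j\<in>J. card (A j) choose b j)"
  using assms
proof (induction J rule: finite_induct)
  case empty
  have "{S. S \<subseteq> (\<Union>j\<in>{}. A j) \<and> (\<forall>j\<in>{}. card (S \<inter> A j) = b j)} = {{}}" by auto
  then show ?case by simp
next
  case (insert i J)
  have dis: "A i \<inter> A j = {}" if "j \<in> J" for j
    using insert.prems(1) insert.hyps(2) that unfolding disjoint_family_on_def by auto
  have dJ: "disjoint_family_on A J" using insert.prems(1) unfolding disjoint_family_on_def by auto
  let ?V = "\<Union>j\<in>insert i J. A j"
  let ?R = "\<lambda>S. \<forall>j\<in>insert i J. card (S \<inter> A j) = b j"
  have V: "?V - A i = (\<Union>j\<in>J. A j)" using dis by auto
  have "card {S. S \<subseteq> ?V \<and> ?R S} = (\<Sum>T\<in>Pow (?V - A i). card {Q. Q \<subseteq> A i \<and> ?R (T \<union> Q)})"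
    using insert by (intro card_sets_split) auto
  also have "\<dots> = (\<Sum>T\<in>Pow (\<Union>j\<in>J. A j).
      if \<forall>j\<in>J. card (T \<inter> A j) = b j then card (A i) choose b i else 0)"
    unfolding V
  proof (rule sum.cong[OF refl])
    fix T assume T: "T \<in> Pow (\<Union>j\<in>J. A j)"
    have 1: "(T \<union> Q) \<inter> A i = Q" if "Q \<subseteq> A i" for Q using T that dis by blast
    have 2: "(T \<union> Q) \<inter> A j = T \<inter> A j" if "Q \<subseteq> A i" "j \<in> J" for Q j using that dis by blast
    have "{Q. Q \<subseteq> A i \<and> ?R (T \<union> Q)} =
       (if \<forall>j\<in>J. card (T \<inter> A j) = b j then {Q. Q \<subseteq> A i \<and> card Q = b i} else {})"
      using 1 2 by auto
    then show "card {Q. Q \<subseteq> A i \<and> ?R (T \<union> Q)} =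
       (if \<forall>j\<in>J. card (T \<inter> A j) = b j then card (A i) choose b i else 0)"
      using insert.prems(2)[of i] by (simp add: n_subsets)
  qed
  also have "\<dots> = card {T \<in> Pow (\<Union>j\<in>J. A j). \<forall>j\<in>J. card (T \<inter> A j) = b j} * (card (A i) choose b i)"
    using insert by (subst sum.inter_filter[symmetric]) auto
  also have "{T \<in> Pow (\<Union>j\<in>J. A j). \<forall>j\<in>J. card (T \<inter> A j) = b j} =
     {S. S \<subseteq> (\<Union>j\<in>J. A j) \<and> (\<forall>j\<in>J. card (S \<inter> A j) = b j)}" by auto
  finally show ?case using insert.IH[OF dJ] insert.prems(2) insert.hyps by simp
qed

section \<open>Effect of edits on counts, degrees and pair counts\<close>

context multipartite_pattern
begin

lemma card_edge_ediff:
  "graph_on n G \<Longrightarrow> graph_on n G' \<Longrightarrow> e \<in> ediff G G' \<Longrightarrow> card e = 2 \<and> finite e \<and> e \<subseteq> {0..<n}"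
proof -
  assume "graph_on n G" "graph_on n G'" "e \<in> ediff G G'"
  then have "e \<subseteq> {0..<n} \<and> card e = 2" unfolding ediff_def graph_on_def by blast
  then show ?thesis using finite_subset[of e "{0..<n}"] by blast
qed

text \<open>A copy in \<open>G\<close> but not in \<open>G'\<close> contains a pair on which they
  differ, and a union bound over these pairs suffices. Keeping \<open>card (B \<union> e)\<close>
  records that pairs meeting \<open>B\<close> are dearer; the three bounds below separate these
  cases.\<close>

lemma card_restricted_diff:
  assumes "graph_on n G" "graph_on n G'" "finite B" "n > 0"
  shows "real (card {S \<in> copies n G. B \<subseteq> S}) \<le> real (card {S \<in> copies n G'. B \<subseteq> S})
     + (\<Sum>e\<in>ediff G G'. real n ^ k / real n ^ card (B \<union> e))"
proof -
  let ?D = "ediff G G'"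
  let ?F = "\<lambda>e. {S. S \<subseteq> {0..<n} \<and> card S = k \<and> B \<union> e \<subseteq> S}"
  have finD: "finite ?D" using assms(1,2) graph_on_finite unfolding ediff_def by blast
  have finF: "finite (?F e)" for e by (rule finite_subset[of _ "Pow {0..<n}"]) auto
  have "{S \<in> copies n G. B \<subseteq> S} \<subseteq> {S \<in> copies n G'. B \<subseteq> S} \<union> (\<Union>e\<in>?D. ?F e)"
  proof
    fix S assume S: "S \<in> {S \<in> copies n G. B \<subseteq> S}"
    show "S \<in> {S \<in> copies n G'. B \<subseteq> S} \<union> (\<Union>e\<in>?D. ?F e)"
    proof (cases "copy G' S")
      case True then show ?thesis using S by (auto simp: copies_def)
    next
      case False
      then obtain x y where "x \<in> S" "y \<in> S" "{x,y} \<in> G \<longleftrightarrow> {x,y} \<notin> G'"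
        using S copiesD[of S n G] copy_cong[of S G G'] by blast
      then have "{x,y} \<in> ?D" "S \<in> ?F {x,y}" using S copiesD[of S n G] by (auto simp: ediff_def)
      then show ?thesis by blast
    qed
  qed
  then have "card {S \<in> copies n G. B \<subseteq> S} \<le> card ({S \<in> copies n G'. B \<subseteq> S} \<union> (\<Union>e\<in>?D. ?F e))"
    using finD finF by (intro card_mono) auto
  also have "\<dots> \<le> card {S \<in> copies n G'. B \<subseteq> S} + (\<Sum>e\<in>?D. card (?F e))"
    using card_UN_le[OF finD, of ?F] card_Un_le[of "{S \<in> copies n G'. B \<subseteq> S}" "\<Union>e\<in>?D. ?F e"]
    by linarith
  finally have "real (card {S \<in> copies n G. B \<subseteq> S}) \<le> real (card {S \<in> copies n G'. B \<subseteq> S})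
     + (\<Sum>e\<in>?D. real (card (?F e)))"
    by (simp only: of_nat_sum[symmetric] of_nat_add[symmetric] of_nat_le_iff)
  also have "(\<Sum>e\<in>?D. real (card (?F e))) \<le> (\<Sum>e\<in>?D. real n ^ k / real n ^ card (B \<union> e))"
  proof (rule sum_mono)
    fix e assume "e \<in> ?D"
    then have "finite e" using card_edge_ediff[OF assms(1,2)] by simp
    then show "real (card (?F e)) \<le> real n ^ k / real n ^ card (B \<union> e)"
      using assms(3,4) by (intro card_supersets_le) auto
  qed
  finally show ?thesis by simp
qed

lemma ind_edit:
  assumes "graph_on n G" "graph_on n G'" "n > 0"
  shows "ind n G \<le> ind n G' + card (ediff G G') * (real n ^ k / real n ^ 2)"
proof -
  have "(\<Sum>e\<in>ediff G G'. real n ^ k / real n ^ card ({} \<union> e)) =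
    (\<Sum>e\<in>ediff G G'. real n ^ k / real n ^ 2)"
    using card_edge_ediff[OF assms(1,2)] by (intro sum.cong) auto
  then show ?thesis using card_restricted_diff[OF assms(1,2) _ assms(3), of "{}"]
    unfolding ind_def by simp
qed

lemma power_div_mono:
  assumes "n > 0" "i \<le> j" shows "real n ^ k / real n ^ j \<le> real n ^ k / real n ^ i"
  using assms by (intro divide_left_mono power_increasing) auto

lemma deg_edit:
  assumes "graph_on n G" "graph_on n G'" "n > 0"
  shows "deg n G v \<le> deg n G' v + card {e \<in> ediff G G'. v \<in> e} * (real n ^ k / real n ^ 2)
     + card (ediff G G') * (real n ^ k / real n ^ 3)"
proof -
  let ?D = "ediff G G'"
  have fin: "finite ?D" using assms(1,2) graph_on_finite unfolding ediff_def by blast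
  have "(\<Sum>e\<in>?D. real n ^ k / real n ^ card ({v} \<union> e)) \<le>
    (\<Sum>e\<in>?D. (if v \<in> e then real n ^ k / real n ^ 2 else 0) + real n ^ k / real n ^ 3)"
    using card_edge_ediff[OF assms(1,2)] by (intro sum_mono) (auto simp: insert_absorb)
  also have "\<dots> = card {e \<in> ?D. v \<in> e} * (real n ^ k / real n ^ 2) + card ?D * (real n ^ k / real n ^ 3)"
    using fin by (simp add: sum.distrib sum.inter_filter[symmetric])
  finally show ?thesis using card_restricted_diff[OF assms(1,2) _ assms(3), of "{v}"]
    unfolding deg_def by simp
qed

text \<open>The two graphs have to agree at \<open>{u, w}\<close> itself: a difference there would
  cost n ^ (k - 2), the very order that is to be resolved.\<close>

lemma pair_edit:
  assumes "graph_on n G" "graph_on n G'" "n > 0" "u \<noteq> w" "{u, w} \<notin> ediff G G'"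
  shows "real (card {S \<in> copies n G. {u, w} \<subseteq> S}) \<le> real (card {S \<in> copies n G'. {u, w} \<subseteq> S})
     + (real (card {e \<in> ediff G G'. u \<in> e}) + real (card {e \<in> ediff G G'. w \<in> e})) * (real n ^ k / real n ^ 3)
     + card (ediff G G') * (real n ^ k / real n ^ 4)"
proof -
  let ?D = "ediff G G'"
  let ?N3 = "real n ^ k / real n ^ 3" and ?N4 = "real n ^ k / real n ^ 4"
  have fin: "finite ?D" using assms(1,2) graph_on_finite unfolding ediff_def by blast
  have "(\<Sum>e\<in>?D. real n ^ k / real n ^ card ({u,w} \<union> e)) \<le>
    (\<Sum>e\<in>?D. (if u \<in> e then ?N3 else 0) + (if w \<in> e then ?N3 else 0) + ?N4)"
  proof (rule sum_mono)
    fix e assume e: "e \<in> ?D"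
    have c: "card e = 2" "finite e" using card_edge_ediff[OF assms(1,2) e] by auto
    have ne: "e \<noteq> {u,w}" using e assms(5) by auto
    show "real n ^ k / real n ^ card ({u,w} \<union> e) \<le> (if u \<in> e then ?N3 else 0) + (if w \<in> e then ?N3 else 0) + ?N4"
    proof (cases "u \<in> e \<or> w \<in> e")
      case True
      have "card ({u,w} \<union> e) \<ge> 3"
      proof (rule ccontr)
        assume "\<not> card ({u,w} \<union> e) \<ge> 3"
        then have "card ({u,w} \<union> e) \<le> 2" by simp
        then have "e = {u,w} \<union> e" using c by (intro card_seteq) auto
        then have "{u,w} \<subseteq> e" by blast
        then have "{u,w} = e" using c assms(4) by (intro card_seteq) auto
        then show False using ne by simp
      qed
      then have "real n ^ k / real n ^ card ({u,w} \<union> e) \<le> ?N3" using assms(3) power_div_mono by blast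
      moreover have "x \<le> (if P then x else 0) + (if Q then x else 0) + y"
        if "P \<or> Q" "0 \<le> x" "0 \<le> y" for x y :: real and P Q using that by auto
      from this[OF True, of ?N3 ?N4]
      have "?N3 \<le> (if u \<in> e then ?N3 else 0) + (if w \<in> e then ?N3 else 0) + ?N4" by simp
      ultimately show ?thesis by (rule order_trans)
    next
      case False
      then have "card ({u,w} \<union> e) = 4" using c assms(4) by (subst card_Un_disjoint) auto
      then show ?thesis using False by simp
    qed
  qed
  also have "\<dots> = (card {e \<in> ?D. u \<in> e} + card {e \<in> ?D. w \<in> e}) * ?N3 + card ?D * ?N4"
    using fin by (simp add: sum.distrib sum.inter_filter[symmetric] algebra_simps add_divide_distrib)
  finally show ?thesis using card_restricted_diff[OF assms(1,2) _ assms(3), of "{u,w}"] by simp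
qed

text \<open>Several pieces may serve the same part, which allows one to prescribe how a copy meets a
  distinguished subset of a class.\<close>

lemma pieces_copy:
  assumes "finite J" "disjoint_family_on A J" "\<And>j. j \<in> J \<Longrightarrow> finite (A j)"
    "\<And>j. j \<in> J \<Longrightarrow> c j < r" "\<And>i. i < r \<Longrightarrow> (\<Sum>j\<in>{j\<in>J. c j = i}. b j) = a i"
    "\<And>j l x y. j \<in> J \<Longrightarrow> l \<in> J \<Longrightarrow> x \<in> A j \<Longrightarrow> y \<in> A l \<Longrightarrow> x \<noteq> y \<Longrightarrow> {x, y} \<in> G \<longleftrightarrow> c j \<noteq> c l"
    "S \<subseteq> (\<Union>j\<in>J. A j)" "\<And>j. j \<in> J \<Longrightarrow> card (S \<inter> A j) = b j"
  shows "copy G S"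
proof -
  define ix where "ix x = (THE j. j \<in> J \<and> x \<in> A j)" for x
  have ix: "ix x = j" if "j \<in> J" "x \<in> A j" for x j
    unfolding ix_def using that assms(2) by (intro the_equality) (auto simp: disjoint_family_on_def)
  have fin: "finite S" using assms(1,3,7) finite_subset by blast
  show ?thesis unfolding copy_def
  proof (intro conjI exI[of _ "\<lambda>x. c (ix x)"] ballI allI impI)
    fix i assume i: "i < r"
    have "\<exists>j\<in>J. x \<in> A j \<and> ix x = j" if "x \<in> S" for x using ix assms(7) that by blast
    then have "x \<in> S \<and> c (ix x) = i \<longleftrightarrow> (\<exists>j\<in>J. c j = i \<and> x \<in> S \<and> x \<in> A j)" for x
      using ix[of _ x] by metis
    then have "{x \<in> S. c (ix x) = i} = (\<Union>j\<in>{j\<in>J. c j = i}. S \<inter> A j)" by blast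
    also have "card \<dots> = (\<Sum>j\<in>{j\<in>J. c j = i}. card (S \<inter> A j))"
      using assms(1,2) fin by (intro card_UN_disjoint) (auto simp: disjoint_family_on_def)
    also have "\<dots> = a i" using assms(5)[OF i] assms(8) by simp
    finally show "card {x \<in> S. c (ix x) = i} = a i" .
  next
    fix x y assume xy: "x \<in> S" "y \<in> S" "x \<noteq> y"
    then obtain j l where "j \<in> J" "x \<in> A j" "l \<in> J" "y \<in> A l" using assms(7) by blast
    then show "({x, y} \<in> G) = (c (ix x) \<noteq> c (ix y))" using assms(6) ix xy by simp
  qed (use fin assms(4,7) ix in auto)
qed

text \<open>After cloning, \<open>insert v U\<close> consists of twins, so only the number of
  vertices taken from it matters.\<close>

lemma clone_cong_card:
  assumes "T \<inter> insert v U = {}" "Q \<subseteq> insert v U" "Q' \<subseteq> insert v U" "finite Q" "finite Q'"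
    "card Q = card Q'" "T \<union> insert v U \<subseteq> {0..<n}" "graph_on n G" "copy (clone n G U v) (T \<union> Q)"
  shows "copy (clone n G U v) (T \<union> Q')"
proof -
  obtain h where h: "bij_betw h Q Q'" using assms finite_same_card_bij by blast
  define f where "f x = (if x \<in> Q then h x else x)" for x
  have Q: "f x \<in> Q'" if "x \<in> Q" for x using h that unfolding f_def bij_betw_def by auto
  have T: "f x = x" if "x \<in> T" for x using assms(1,2) that unfolding f_def by auto
  have bij: "bij_betw f (T \<union> Q) (T \<union> Q')"
  proof (rule bij_betw_combine)
    show "bij_betw f T T" using T by (simp add: bij_betw_def inj_on_def)
    show "bij_betw f Q Q'" using h unfolding f_def by (subst bij_betw_cong[of Q _ h]) auto
    show "T \<inter> Q' = {}" using assms by blast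
  qed
  have loop: "{v} \<notin> G" using assms(8) graph_on_pair[of n G v v] by auto
  show ?thesis
  proof (rule copy_iso[OF assms(9) bij])
    fix x y assume xy: "x \<in> T \<union> Q" "y \<in> T \<union> Q" "x \<noteq> y"
    then have ne: "f x \<noteq> f y" using bij by (auto simp: bij_betw_def inj_on_def)
    have rho: "(if f z \<in> U then v else f z) = (if z \<in> U then v else z)" if z: "z \<in> T \<union> Q" for z
    proof (cases "z \<in> Q")
      case True
      then show ?thesis using Q[OF True] assms(2,3) by auto
    next
      case False
      then show ?thesis using T z by auto
    qed
    have lt: "f z < n \<and> z < n" if z: "z \<in> T \<union> Q" for z
    proof (cases "z \<in> Q")
      case True
      then show ?thesis using Q[OF True] assms(2,3,7) by fastforce
    next
      case False
      then show ?thesis using T z assms(7) by fastforce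
    qed
    from lt[OF xy(1)] lt[OF xy(2)]
    show "({x, y} \<in> clone n G U v) = ({f x, f y} \<in> clone n G U v)"
      unfolding clone_pair using xy(3) ne rho[OF xy(1)] rho[OF xy(2)] by simp
  qed
qed

end

section \<open>Merging twins\<close>

context multipartite_pattern
begin

text \<open>The witness \<open>x\<close> has to lie in \<open>S\<close>, but \<open>u\<close> does
  not: in the applications \<open>U\<close> consists of twins, and any \<open>u\<close> represents
  it.\<close>

definition split_pair :: "nat set set \<Rightarrow> nat set \<Rightarrow> nat \<Rightarrow> nat set \<Rightarrow> bool" where
  "split_pair G U v S \<longleftrightarrow> (\<exists>x\<in>S - insert v U. \<exists>u\<in>U. ({u, x} \<in> G) \<noteq> ({v, x} \<in> G))"

text \<open>With the outside trace \<open>T\<close> fixed, all fillings \<open>Q\<close> have the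
  same size. If \<open>T\<close> does not tell \<open>v\<close> from \<open>U\<close>, merging
  changes nothing and the degree terms cancel. Otherwise a filling is \<open>{v}\<close> or lies in
  \<open>U\<close>. A nonempty \<open>Q\<close> in \<open>U\<close> contributes 1 - |Q|, plus 1 if
  |Q| is at least 2, hence at most 0; the filling \<open>{v}\<close> contributes 1 + |U|, which the
  singletons repay after the merge.\<close>

lemma merge_gain_aux:
  assumes G: "graph_on n G" and v: "v < n" and U: "U \<subseteq> {0..<n}" and vU: "v \<notin> U"
    and indep: "\<And>x y. x \<in> insert v U \<Longrightarrow> y \<in> insert v U \<Longrightarrow> {x, y} \<notin> G"
    and twins: "\<And>u u' x. u \<in> U \<Longrightarrow> u' \<in> U \<Longrightarrow> x \<notin> insert v U \<Longrightarrow> {u, x} \<in> G \<longleftrightarrow> {u', x} \<in> G"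
    and T: "T \<subseteq> {0..<n} - insert v U"
  shows "real (card {Q. Q \<subseteq> insert v U \<and> copy G (T \<union> Q)})
      + (\<Sum>u\<in>U. real (card {Q. Q \<subseteq> insert v U \<and> copy G (T \<union> Q) \<and> v \<in> T \<union> Q})
              - real (card {Q. Q \<subseteq> insert v U \<and> copy G (T \<union> Q) \<and> u \<in> T \<union> Q}))
      + real (card {Q. Q \<subseteq> insert v U \<and> copy G (T \<union> Q) \<and>
           card ((T \<union> Q) \<inter> insert v U) \<ge> 2 \<and> split_pair G U v (T \<union> Q)})
      + real (card {Q. Q \<subseteq> insert v U \<and> copy (clone n G U v) (T \<union> Q) \<and>
           card ((T \<union> Q) \<inter> insert v U) \<ge> 2 \<and> split_pair G U v (T \<union> Q)})
      \<le> real (card {Q. Q \<subseteq> insert v U \<and> copy (clone n G U v) (T \<union> Q)})"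
proof -
  define X where "X = insert v U"
  define G1 where "G1 = clone n G U v"
  define C0 where "C0 = {Q. Q \<subseteq> X \<and> copy G (T \<union> Q)}"
  define C1 where "C1 = {Q. Q \<subseteq> X \<and> copy G1 (T \<union> Q)}"
  define nt where "nt \<longleftrightarrow> (\<exists>x\<in>T. \<exists>u\<in>U. ({u, x} \<in> G) \<noteq> ({v, x} \<in> G))"
  have finU: "finite U" using U finite_subset by blast
  have finX: "finite X" unfolding X_def using finU by simp
  have fin0: "finite C0" "finite C1" unfolding C0_def C1_def
    using finX by (auto intro: finite_subset[of _ "Pow X"])
  have TX: "T \<inter> X = {}" "T \<subseteq> {0..<n}" using T unfolding X_def by auto
  have finQ: "finite Q" if "Q \<in> C0 \<or> Q \<in> C1" for Q
    using that finX finite_subset unfolding C0_def C1_def by blast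
  have cardQ: "card Q = card Q'" if "Q \<in> C0 \<union> C1" "Q' \<in> C0 \<union> C1" for Q Q'
  proof -
    have "card (T \<union> Q) = card T + card Q" if "Q \<in> C0 \<union> C1" for Q
    proof (rule card_Un_disjoint)
      show "finite T" using TX(2) finite_subset by blast
      show "finite Q" using that finQ by blast
      show "T \<inter> Q = {}" using that TX(1) unfolding C0_def C1_def by blast
    qed
    moreover have "card (T \<union> Q) = k" if "Q \<in> C0 \<union> C1" for Q
      using that copy_card unfolding C0_def C1_def by blast
    ultimately have "card T + card Q = card T + card Q'" using that by metis
    then show ?thesis by simp
  qed
  have C1_all: "Q' \<in> C1" if "Q \<in> C1" "Q' \<subseteq> X" "card Q' = card Q" for Q Q'
  proof -
    have "copy G1 (T \<union> Q')" unfolding G1_def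
      using clone_cong_card[of T v U Q Q' n G] that TX v U G finX finite_subset[of _ X]
      unfolding X_def C1_def G1_def by auto
    then show ?thesis using that unfolding C1_def by simp
  qed
  have adjT: "{x, y} \<in> G1 \<longleftrightarrow> {x, y} \<in> G" if "x \<in> T \<union> {v}" "y \<in> T \<union> {v}" "x \<noteq> y" for x y
  proof -
    have "x < n" "y < n" "x \<notin> U" "y \<notin> U" using that T v vU by auto
    then show ?thesis unfolding G1_def clone_pair using that by simp
  qed
  have sub_v: "Q \<in> C0 \<longleftrightarrow> Q \<in> C1" if "Q \<subseteq> {v}" for Q
  proof -
    have "copy G (T \<union> Q) \<longleftrightarrow> copy G1 (T \<union> Q)"
      using that adjT by (intro copy_cong) blast
    then show ?thesis unfolding C0_def C1_def by blast
  qed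
  have simp1: "w \<in> T \<union> Q \<longleftrightarrow> w \<in> Q" if "w \<in> X" for w Q using that TX by blast
  have simp2: "(T \<union> Q) \<inter> X = Q" if "Q \<subseteq> X" for Q using that TX by blast
  have simp3: "split_pair G U v (T \<union> Q) \<longleftrightarrow> nt" if "Q \<subseteq> X" for Q
  proof -
    have "T \<union> Q - insert v U = T" using that TX unfolding X_def by blast
    then show ?thesis unfolding split_pair_def nt_def by simp
  qed
  have e1: "{Q. Q \<subseteq> insert v U \<and> copy G (T \<union> Q) \<and> w \<in> T \<union> Q} = {Q \<in> C0. w \<in> Q}" if "w \<in> X" for w
    using simp1[OF that] unfolding C0_def X_def by blast
  have e2: "{Q. Q \<subseteq> insert v U \<and> copy G (T \<union> Q) \<and>
      card ((T \<union> Q) \<inter> insert v U) \<ge> 2 \<and> split_pair G U v (T \<union> Q)} = {Q \<in> C0. card Q \<ge> 2 \<and> nt}"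
    using simp2 simp3 unfolding C0_def X_def by auto
  have e3: "{Q. Q \<subseteq> insert v U \<and> copy (clone n G U v) (T \<union> Q) \<and>
      card ((T \<union> Q) \<inter> insert v U) \<ge> 2 \<and> split_pair G U v (T \<union> Q)} = {Q \<in> C1. card Q \<ge> 2 \<and> nt}"
    using simp2 simp3 unfolding C1_def X_def G1_def by auto
  have e4: "(\<Sum>u\<in>U. real (card {Q \<in> C0. v \<in> Q}) - real (card {Q \<in> C0. u \<in> Q})) =
      card U * real (card {Q \<in> C0. v \<in> Q}) - (\<Sum>Q\<in>C0. real (card (Q \<inter> U)))"
  proof -
    have "(\<Sum>u\<in>U. card {Q \<in> C0. u \<in> Q}) = (\<Sum>Q\<in>C0. card {u\<in>U. u \<in> Q})"
      by (rule sum_multicount_gen) (use finU fin0 in auto)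
    also have "\<dots> = (\<Sum>Q\<in>C0. card (Q \<inter> U))"
      by (intro sum.cong refl arg_cong[of _ _ card]) blast
    finally have "(\<Sum>u\<in>U. real (card {Q \<in> C0. u \<in> Q})) = (\<Sum>Q\<in>C0. real (card (Q \<inter> U)))"
      by (simp only: of_nat_sum[symmetric])
    then show ?thesis by (simp add: sum_subtractf)
  qed
  have main: "real (card C0) + (card U * real (card {Q \<in> C0. v \<in> Q}) - (\<Sum>Q\<in>C0. real (card (Q \<inter> U))))
     + real (card {Q \<in> C0. card Q \<ge> 2 \<and> nt}) + real (card {Q \<in> C1. card Q \<ge> 2 \<and> nt}) \<le> real (card C1)"
  proof (cases nt)
    case False
    have "{x, y} \<in> G \<longleftrightarrow> {x, y} \<in> G1" if xy: "x \<in> T \<union> X" "y \<in> T \<union> X" "x \<noteq> y" for x y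
    proof -
      have lt: "x < n" "y < n" using xy TX(2) U v unfolding X_def by auto
      have T_iff: "z \<in> T \<Longrightarrow> z \<notin> U \<and> z \<noteq> v" for z using T by auto
      have vv: "{v} \<notin> G" using graph_on_pair[OF G, of v v] by auto
      have UT: "{v, z} \<in> G \<longleftrightarrow> {u, z} \<in> G" if "u \<in> U" "z \<in> T" for u z
        using False that unfolding nt_def by blast
      consider "x \<in> T" "y \<in> T" | "x \<in> T" "y \<in> X" | "x \<in> X" "y \<in> T" | "x \<in> X" "y \<in> X" using xy by blast
      then show ?thesis
      proof cases
        case 1 then show ?thesis using adjT xy(3) by simp
      next
        case 2
        then show ?thesis unfolding G1_def clone_pair using lt xy(3) T_iff[OF 2(1)] UT[of y x]
          unfolding X_def by (auto simp: insert_commute)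
      next
        case 3
        then show ?thesis unfolding G1_def clone_pair using lt xy(3) T_iff[OF 3(2)] UT[of x y]
          unfolding X_def by auto
      next
        case 4
        then have "{x, y} \<notin> G" using indep unfolding X_def by blast
        moreover have "{x, y} \<notin> G1" using 4 vv vU unfolding G1_def clone_pair X_def by auto
        ultimately show ?thesis by simp
      qed
    qed
    then have "copy G (T \<union> Q) \<longleftrightarrow> copy G1 (T \<union> Q)" if "Q \<subseteq> X" for Q
      using that by (intro copy_cong) blast
    then have C: "C0 = C1" unfolding C0_def C1_def by blast
    \<comment> \<open>The graph already equals its clone on \<open>T \<union> X\<close>, so swapping
      \<open>u\<close> and \<open>v\<close> preserves fillings.\<close>
    have "card {Q \<in> C0. u \<in> Q} = card {Q \<in> C0. v \<in> Q}" if u: "u \<in> U" for u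
    proof (rule bij_betw_same_card)
      let ?t = "Transposition.transpose u v"
      have tX: "?t ` Q \<subseteq> X" if "Q \<subseteq> X" for Q
        using that u unfolding X_def Transposition.transpose_def by auto
      have mem: "?t ` Q \<in> C0" if "Q \<in> C0" for Q
      proof -
        have "card (?t ` Q) = card Q" by (intro card_image inj_onI) (metis transpose_involutory)
        then show ?thesis using C1_all[of Q "?t ` Q"] tX[of Q] that unfolding C using C1_def by blast
      qed
      have inv: "?t ` ?t ` Q = Q" for Q by (simp add: image_image)
      have uv: "v \<in> ?t ` Q" if "u \<in> Q" for Q using that by (metis image_eqI transpose_apply_first)
      have vu: "u \<in> ?t ` Q" if "v \<in> Q" for Q using that by (metis image_eqI transpose_apply_second)
      show "bij_betw (\<lambda>Q. ?t ` Q) {Q \<in> C0. u \<in> Q} {Q \<in> C0. v \<in> Q}"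
        using mem inv uv vu by (intro bij_betwI[of _ _ _ "\<lambda>Q. ?t ` Q"]) auto
    qed
    then have "(\<Sum>u\<in>U. real (card {Q \<in> C0. v \<in> Q}) - real (card {Q \<in> C0. u \<in> Q})) = 0" by simp
    then show ?thesis using e4 False C by simp
  next
    case True
    then obtain x u0 where xu: "x \<in> T" "u0 \<in> U" "({u0, x} \<in> G) \<noteq> ({v, x} \<in> G)" unfolding nt_def by blast
    \<comment> \<open>A filling with both types would contain two non-adjacent vertices that
      \<open>x\<close> separates.\<close>
    have mixed: "Q = {v} \<or> Q \<subseteq> U" if Q: "Q \<in> C0" for Q
    proof (rule ccontr)
      assume neg: "\<not> (Q = {v} \<or> Q \<subseteq> U)"
      then have "v \<in> Q" using Q unfolding C0_def X_def by auto
      moreover obtain u where u: "u \<in> Q" "u \<in> U"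
        using neg \<open>v \<in> Q\<close> Q unfolding C0_def X_def by auto
      moreover have "{u, v} \<notin> G" using indep u by blast
      moreover have "x \<noteq> u" "x \<noteq> v" "u \<noteq> v" using xu(1) u T vU by auto
      ultimately have "{u, x} \<in> G \<longleftrightarrow> {v, x} \<in> G"
        using copy_twins[of G "T \<union> Q" u v x] Q xu(1) unfolding C0_def by blast
      moreover have "{u, x} \<in> G \<longleftrightarrow> {u0, x} \<in> G" using twins[OF u(2) xu(2)] xu(1) T by blast
      ultimately show False using xu(3) by simp
    qed
    define CU where "CU = {Q \<in> C0. Q \<subseteq> U}"
    define g :: nat where "g = (if {v} \<in> C0 then 1 else 0)"
    have finCU: "finite CU" unfolding CU_def using fin0 by simp
    have C0_eq: "C0 = CU \<union> (if {v} \<in> C0 then {{v}} else {})" using mixed unfolding CU_def by auto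
    have disj: "CU \<inter> (if {v} \<in> C0 then {{v}} else {}) = {}" using vU unfolding CU_def by auto
    have s_split: "(\<Sum>Q\<in>C0. f Q) = (\<Sum>Q\<in>CU. f Q) + real g * f {v}" for f :: "nat set \<Rightarrow> real"
      by (subst C0_eq, subst sum.union_disjoint) (use finCU disj in \<open>auto simp: g_def\<close>)
    have "{Q \<in> C0. v \<in> Q} = (if {v} \<in> C0 then {{v}} else {})" using mixed vU by auto
    then have cv: "card {Q \<in> C0. v \<in> Q} = g" by (simp add: g_def)
    have c0: "real (card C0) = (\<Sum>Q\<in>C0. 1)" by simp
    have c02: "real (card {Q \<in> C0. card Q \<ge> 2 \<and> nt}) = (\<Sum>Q\<in>C0. if card Q \<ge> 2 then 1 else 0)"
      using True fin0 by (simp add: sum.inter_filter[symmetric])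
    have c12: "real (card C1) = card {Q \<in> C1. card Q \<ge> 2 \<and> nt} + card {Q \<in> C1. card Q \<le> 1}"
    proof -
      have "C1 = {Q \<in> C1. card Q \<ge> 2 \<and> nt} \<union> {Q \<in> C1. card Q \<le> 1}" using True by auto
      then have "card C1 = card {Q \<in> C1. card Q \<ge> 2 \<and> nt} + card {Q \<in> C1. card Q \<le> 1}"
        using fin0 by (metis (no_types, lifting) card_Un_disjoint disjoint_iff finite_Un mem_Collect_eq
            not_less_eq_eq numeral_2_eq_2 One_nat_def)
      then show ?thesis by simp
    qed
    \<comment> \<open>What remains after the fillings of size at least two have been cancelled on
      the right by the \<open>extra\<close> term of the clone.\<close>
    have key: "(\<Sum>Q\<in>CU. 1 - real (card (Q \<inter> U)) + (if card Q \<ge> 2 then 1 else 0)) + real g * (1 + card U)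
        \<le> card {Q \<in> C1. card Q \<le> 1}"
    proof (cases "{v} \<in> C0")
      case True
      have "1 - real (card (Q \<inter> U)) + (if card Q \<ge> 2 then 1 else 0) \<le> 0" if "Q \<in> CU" for Q
      proof -
        have "Q \<inter> U = Q" "card Q = 1" using that True cardQ[of Q "{v}"] unfolding CU_def by auto
        then show ?thesis by simp
      qed
      then have "(\<Sum>Q\<in>CU. 1 - real (card (Q \<inter> U)) + (if card Q \<ge> 2 then 1 else 0)) \<le> 0"
        by (rule sum_nonpos)
      \<comment> \<open>In the clone every singleton of \<open>X\<close> is as good as
        \<open>{v}\<close>.\<close>
      moreover have "1 + card U \<le> card {Q \<in> C1. card Q \<le> 1}"
      proof -
        have "(\<lambda>x. {x}) ` X \<subseteq> {Q \<in> C1. card Q \<le> 1}"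
          using C1_all[of "{v}"] sub_v[of "{v}"] True by auto
        then have "card ((\<lambda>x. {x}) ` X) \<le> card {Q \<in> C1. card Q \<le> 1}"
          using fin0 by (intro card_mono) auto
        moreover have "card ((\<lambda>x. {x}) ` X) = 1 + card U"
          unfolding X_def using finU vU by (subst card_image) (auto simp: inj_on_def)
        ultimately show ?thesis by simp
      qed
      ultimately show ?thesis unfolding g_def using True by simp
    next
      case False
      have "(\<Sum>Q\<in>CU. 1 - real (card (Q \<inter> U)) + (if card Q \<ge> 2 then 1 else 0)) \<le>
          (\<Sum>Q\<in>CU. if Q = {} then 1 else 0)"
      proof (rule sum_mono)
        fix Q assume "Q \<in> CU"
        then have "Q \<inter> U = Q" "finite Q" using finQ unfolding CU_def by auto
        moreover have "card Q \<ge> 1" if "Q \<noteq> {}" using that \<open>finite Q\<close> by (simp add: Suc_leI card_gt_0_iff)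
        ultimately show "1 - real (card (Q \<inter> U)) + (if card Q \<ge> 2 then 1 else 0) \<le> (if Q = {} then 1 else 0)"
          by auto
      qed
      also have "\<dots> = real (card {Q \<in> CU. Q = {}})"
        by (simp only: sum.inter_filter[OF finCU, symmetric] card_eq_sum of_nat_sum of_nat_1)
      also have "\<dots> \<le> card {Q \<in> C1. card Q \<le> 1}"
      proof -
        have "{Q \<in> CU. Q = {}} \<subseteq> {Q \<in> C1. card Q \<le> 1}"
          using sub_v[of "{}"] unfolding CU_def by auto
        then show ?thesis using fin0 by (intro of_nat_mono card_mono) auto
      qed
      finally show ?thesis using False unfolding g_def by simp
    qed
    have "{v} \<inter> U = {}" using vU by simp
    then have "real (card C0) - (\<Sum>Q\<in>C0. real (card (Q \<inter> U))) + (\<Sum>Q\<in>C0. if card Q \<ge> 2 then 1 else 0)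
      = (\<Sum>Q\<in>CU. 1 - real (card (Q \<inter> U)) + (if card Q \<ge> 2 then 1 else 0)) + real g"
      unfolding c0 s_split by (simp add: sum.distrib sum_subtractf)
    then show ?thesis using key c12 cv c02 by (simp add: algebra_simps)
  qed
  have "v \<in> X" "\<And>u. u \<in> U \<Longrightarrow> u \<in> X" unfolding X_def by auto
  then have "(\<Sum>u\<in>U. real (card {Q. Q \<subseteq> insert v U \<and> copy G (T \<union> Q) \<and> v \<in> T \<union> Q})
      - real (card {Q. Q \<subseteq> insert v U \<and> copy G (T \<union> Q) \<and> u \<in> T \<union> Q})) =
    (\<Sum>u\<in>U. real (card {Q \<in> C0. v \<in> Q}) - real (card {Q \<in> C0. u \<in> Q}))"
    using e1 by (intro sum.cong) auto
  then show ?thesis using main e4 unfolding e2 e3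
    unfolding C0_def C1_def X_def G1_def by simp
qed

text \<open>The correction terms count the copies that have two vertices of one type and distinguish the two
  types: such a copy cannot mix them, so before the merge it exists for one type only.\<close>

lemma merge_gain:
  assumes G: "graph_on n G" and v: "v < n" and U: "U \<subseteq> {0..<n}" and vU: "v \<notin> U"
    and indep: "\<And>x y. x \<in> insert v U \<Longrightarrow> y \<in> insert v U \<Longrightarrow> {x, y} \<notin> G"
    and twins: "\<And>u u' x. u \<in> U \<Longrightarrow> u' \<in> U \<Longrightarrow> x \<notin> insert v U \<Longrightarrow> {u, x} \<in> G \<longleftrightarrow> {u', x} \<in> G"
  shows "ind n G + (\<Sum>u\<in>U. deg n G v - deg n G u)
      + real (card {S \<in> copies n G. card (S \<inter> insert v U) \<ge> 2 \<and> split_pair G U v S})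
      + real (card {S \<in> copies n (clone n G U v). card (S \<inter> insert v U) \<ge> 2 \<and> split_pair G U v S})
      \<le> ind n (clone n G U v)"
proof -
  let ?V = "{0..<n}" and ?X = "insert v U"
  let ?P = "Pow (?V - ?X)"
  have X: "finite ?V" "?X \<subseteq> ?V" using v U by auto
  have c: "real (card {S \<in> copies n H. R S}) =
     (\<Sum>T\<in>?P. real (card {Q. Q \<subseteq> ?X \<and> copy H (T \<union> Q) \<and> R (T \<union> Q)}))" for H R
    using card_sets_split[OF X, of "\<lambda>S. copy H S \<and> R S"] unfolding copies_def
    by (simp add: conj_assoc)
  have ind_eq: "ind n H = (\<Sum>T\<in>?P. real (card {Q. Q \<subseteq> ?X \<and> copy H (T \<union> Q)}))" for H
    using c[of H "\<lambda>S. True"] unfolding ind_def by simp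
  have deg_eq: "deg n G w = (\<Sum>T\<in>?P. real (card {Q. Q \<subseteq> ?X \<and> copy G (T \<union> Q) \<and> w \<in> T \<union> Q}))" for w
    using c[of G "\<lambda>S. w \<in> S"] unfolding deg_def by simp
  have deg_sum: "(\<Sum>u\<in>U. deg n G v - deg n G u) = (\<Sum>T\<in>?P. \<Sum>u\<in>U.
      real (card {Q. Q \<subseteq> ?X \<and> copy G (T \<union> Q) \<and> v \<in> T \<union> Q})
    - real (card {Q. Q \<subseteq> ?X \<and> copy G (T \<union> Q) \<and> u \<in> T \<union> Q}))"
    unfolding deg_eq sum_subtractf[symmetric] by (rule sum.swap)
  show ?thesis unfolding ind_eq deg_sum c sum.distrib[symmetric]
    by (rule sum_mono, rule merge_gain_aux[OF assms], simp_all)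
qed

lemma clone_gain:
  assumes G: "graph_on n G" and uv: "u < n" "v < n" "u \<noteq> v" "{u, v} \<notin> G"
  shows "ind n G + deg n G v - deg n G u \<le> ind n (clone n G {u} v)"
proof -
  have "{x, y} \<notin> G" if "x \<in> insert v {u}" "y \<in> insert v {u}" for x y
    using that uv graph_on_pair[OF G, of x y] by (auto simp: insert_commute)
  then show ?thesis using merge_gain[of n G v "{u}"] assms by auto
qed

text \<open>Copies avoiding \<open>u\<close> survive, and those through \<open>v\<close> but not
  \<open>u\<close> reappear with \<open>u\<close> in place of \<open>v\<close>. The error term
  accounts for the copies containing both.\<close>

lemma clone_gain_adjacent:
  assumes G: "graph_on n G" and uv: "u < n" "v < n" "u \<noteq> v"
  shows "ind n G + deg n G v - deg n G u - real n ^ k / real n ^ 2 \<le> ind n (clone n G {u} v)"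
proof -
  let ?G1 = "clone n G {u} v"
  let ?A = "{S \<in> copies n G. u \<notin> S}" and ?B = "{S \<in> copies n G. v \<in> S \<and> u \<notin> S}"
  define f where "f S = insert u (S - {v})" for S :: "nat set"
  have n: "n > 0" using uv by auto
  have "?A \<subseteq> copies n ?G1"
  proof
    fix S assume S: "S \<in> ?A"
    then have "copy ?G1 S"
    proof (subst copy_cong[of S ?G1 G])
      fix x y assume xy: "x \<in> S" "y \<in> S" "x \<noteq> y"
      then have "x < n" "y < n" "x \<noteq> u" "y \<noteq> u" using S copiesD by fastforce+
      then show "({x, y} \<in> ?G1) = ({x, y} \<in> G)" unfolding clone_pair using xy by simp
    qed (use copiesD in blast)
    then show "S \<in> copies n ?G1" using S unfolding copies_def by blast
  qed
  moreover have "f ` ?B \<subseteq> copies n ?G1"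
  proof
    fix S' assume "S' \<in> f ` ?B"
    then obtain S where S: "S \<in> ?B" "S' = f S" by blast
    let ?h = "\<lambda>x. if x = v then u else x"
    have sub: "S \<subseteq> {0..<n}" "copy G S" "v \<in> S" "u \<notin> S" using S(1) copiesD[of S n G] by auto
    have "copy ?G1 (f S)"
    proof (rule copy_iso[OF sub(2), of ?h])
      show "bij_betw ?h S (f S)"
        using sub uv by (intro bij_betwI[of _ _ _ "\<lambda>x. if x = u then v else x"]) (auto simp: f_def)
      fix x y assume xy: "x \<in> S" "y \<in> S" "x \<noteq> y"
      then have lt: "x < n" "y < n" "x \<noteq> u" "y \<noteq> u" using sub by auto
      show "({x, y} \<in> G) = ({?h x, ?h y} \<in> ?G1)"
        unfolding clone_pair using lt uv xy by auto
    qed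
    then show "S' \<in> copies n ?G1" using S(2) sub uv unfolding copies_def f_def by auto
  qed
  moreover have "?A \<inter> f ` ?B = {}" unfolding f_def by auto
  ultimately have "card ?A + card (f ` ?B) \<le> card (copies n ?G1)"
    by (subst card_Un_disjoint[symmetric]) (auto intro!: card_mono)
  moreover have "inj_on f ?B" unfolding f_def
    by (rule inj_on_inverseI[of _ "\<lambda>T. insert v (T - {u})"]) auto
  ultimately have 1: "real (card ?A) + real (card ?B) \<le> ind n ?G1"
    unfolding ind_def by (simp add: card_image)
  have "copies n G = ?A \<union> {S \<in> copies n G. u \<in> S}" by blast
  then have "card (copies n G) = card ?A + card {S \<in> copies n G. u \<in> S}"
    by (metis (no_types, lifting) card_Un_disjoint disjoint_iff finite_Un finite_copies mem_Collect_eq)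
  then have 2: "ind n G = real (card ?A) + deg n G u" unfolding ind_def deg_def by simp
  have "{S \<in> copies n G. v \<in> S} = ?B \<union> {S \<in> copies n G. {u,v} \<subseteq> S}" by blast
  then have "card {S \<in> copies n G. v \<in> S} \<le> card ?B + card {S \<in> copies n G. {u,v} \<subseteq> S}"
    by (metis (no_types, lifting) card_Un_le)
  then have 4: "deg n G v \<le> real (card ?B) + real (card {S \<in> copies n G. {u,v} \<subseteq> S})"
    unfolding deg_def by (simp only: of_nat_add[symmetric] of_nat_le_iff)
  have c2: "card {u, v} = 2" using uv(3) by simp
  have "real (card {S \<in> copies n G. {u,v} \<subseteq> S}) \<le> real n ^ k / real n ^ card {u,v}"
    by (rule card_supersets_le) (use n in \<open>auto dest: copiesD\<close>)
  then have 3: "deg n G v \<le> real (card ?B) + real n ^ k / real n ^ 2"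
    using 4 unfolding c2 by linarith
  show ?thesis using 1 2 3 by linarith
qed

end

section \<open>Penalised maximisers\<close>

text \<open>Distance for fixed labels: complete multipartite graphs are closed under relabelling, so
  there is no permutation to minimise over.\<close>

definition cmp_dist :: "nat \<Rightarrow> nat set set \<Rightarrow> nat" where
  "cmp_dist n G = (LEAST d. \<exists>c. card (ediff G (cmp_graph n c)) = d)"

lemma cmp_dist_attained: "\<exists>c. card (ediff G (cmp_graph n c)) = cmp_dist n G"
  unfolding cmp_dist_def by (rule LeastI_ex) blast

lemma cmp_dist_le: "cmp_dist n G \<le> card (ediff G (cmp_graph n c))"
  unfolding cmp_dist_def by (rule Least_le) blast

lemma cmp_dist_triangle:
  assumes "graph_on n G" "graph_on n G'"
  shows "cmp_dist n G \<le> card (ediff G G') + cmp_dist n G'"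
proof -
  obtain c where c: "card (ediff G' (cmp_graph n c)) = cmp_dist n G'" using cmp_dist_attained by blast
  have "cmp_dist n G \<le> card (ediff G (cmp_graph n c))" by (rule cmp_dist_le)
  also have "\<dots> \<le> card (ediff G G') + card (ediff G' (cmp_graph n c))"
    by (intro card_ediff_triangle graph_on_finite[of n] assms graph_on_cmp_graph)
  finally show ?thesis using c by simp
qed

section \<open>Twins and the potential function of symmetrisation\<close>

definition twin :: "nat \<Rightarrow> nat set set \<Rightarrow> nat \<Rightarrow> nat \<Rightarrow> bool" where
  "twin n G x y \<longleftrightarrow> (\<forall>z<n. {x, z} \<in> G \<longleftrightarrow> {y, z} \<in> G)"

lemma cmp_dist_0I:
  assumes "graph_on n G" "\<And>u v. u < n \<Longrightarrow> v < n \<Longrightarrow> {u, v} \<notin> G \<Longrightarrow> twin n G u v"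
  shows "cmp_dist n G = 0"
proof -
  \<comment> \<open>A class is named by its least member; \<open>x\<close> itself qualifies because
    there are no loops.\<close>
  define c where "c x = (LEAST y. y < n \<and> {x, y} \<notin> G)" for x
  have loop: "{x, x} \<notin> G" for x using graph_on_pair[OF assms(1)] by blast
  have c: "c x < n \<and> {x, c x} \<notin> G" if "x < n" for x
    unfolding c_def by (rule LeastI[of _ x]) (use that loop in simp)
  have tw: "twin n G x (c x)" if "x < n" for x using c[OF that] assms(2) that by blast
  have adj: "{x, y} \<in> G \<longleftrightarrow> c x \<noteq> c y" if xy: "x < n" "y < n" for x y
  proof
    assume e: "{x, y} \<in> G"
    show "c x \<noteq> c y"
    proof
      assume "c x = c y"
      then have "{x, y} \<in> G \<longleftrightarrow> {y, y} \<in> G" using tw[OF xy(1)] tw[OF xy(2)] xy unfolding twin_def by metis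
      then show False using e loop by blast
    qed
  next
    assume ne: "c x \<noteq> c y"
    show "{x, y} \<in> G"
    proof (rule ccontr)
      assume "{x, y} \<notin> G"
      then have t: "twin n G x y" using assms(2) xy by blast
      have "(\<lambda>z. z < n \<and> {x, z} \<notin> G) = (\<lambda>z. z < n \<and> {y, z} \<notin> G)"
        using t unfolding twin_def by blast
      then show False using ne unfolding c_def by simp
    qed
  qed
  have "G = cmp_graph n c"
  proof (rule set_eqI)
    fix e
    have "\<exists>x y. e = {x, y}" if "e \<in> G \<or> e \<in> cmp_graph n c"
    proof -
      have "card e = 2" using that assms(1) graph_on_cmp_graph unfolding graph_on_def by blast
      then show ?thesis by (meson card_2_iff)
    qed
    moreover have "{x, y} \<in> G \<longleftrightarrow> {x, y} \<in> cmp_graph n c" for x y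
      using adj[of x y] graph_on_pair[OF assms(1), of x y] unfolding cmp_graph_pair by blast
    ultimately show "e \<in> G \<longleftrightarrow> e \<in> cmp_graph n c" by metis
  qed
  then have "card (ediff G (cmp_graph n c)) = 0" unfolding ediff_def by simp
  then show ?thesis using cmp_dist_le[of n G c] by simp
qed

definition twin_pairs :: "nat \<Rightarrow> nat set set \<Rightarrow> (nat \<times> nat) set" where
  "twin_pairs n G = {(x, y). x < n \<and> y < n \<and> twin n G x y}"

text \<open>The vertex \<open>u\<close> leaves its twin class and joins one that is at least as
  large, while twins other than \<open>u\<close> stay twins. Of the old class only the members
  different from \<open>u\<close> count, which makes the increase strict.\<close>

lemma twin_pairs_clone:
  assumes G: "graph_on n G" and uv: "u < n" "v < n" "{u, v} \<notin> G" "\<not> twin n G u v"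
    and le: "card {y. y < n \<and> twin n G u y} \<le> card {y. y < n \<and> twin n G v y}"
  shows "card (twin_pairs n G) < card (twin_pairs n (clone n G {u} v))"
proof -
  let ?G1 = "clone n G {u} v"
  have loop: "{x, x} \<notin> G" for x using graph_on_pair[OF G] by blast
  have uv_ne: "u \<noteq> v" using uv(4) unfolding twin_def by auto
  have G1a: "{x, y} \<in> ?G1 \<longleftrightarrow> {x, y} \<in> G" if "x \<noteq> u" "y \<noteq> u" for x y
    using that graph_on_pair[OF G, of x y] unfolding clone_pair by auto
  have G1b: "{x, u} \<in> ?G1 \<longleftrightarrow> {x, v} \<in> G" if "x \<noteq> u" "x < n" for x
    using that uv(1) unfolding clone_pair by auto
  have G1c: "{u, x} \<in> ?G1 \<longleftrightarrow> {v, x} \<in> G" if "x \<noteq> u" "x < n" for x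
    using that uv(1) unfolding clone_pair by auto
  have G1d: "{u, u} \<notin> ?G1" unfolding clone_pair by simp
  have sym: "twin n H y x" if "twin n H x y" for x y H using that unfolding twin_def by blast
  have t1: "twin n ?G1 x y" if "x \<noteq> u" "y \<noteq> u" "x < n" "y < n" "twin n G x y" for x y
    unfolding twin_def
  proof (intro allI impI)
    fix z assume z: "z < n"
    show "({x, z} \<in> ?G1) = ({y, z} \<in> ?G1)"
      using G1a[of x z] G1a[of y z] G1b[of x] G1b[of y] that z uv(2) unfolding twin_def
      by (cases "z = u") auto
  qed
  have t2: "twin n ?G1 u y" if "y \<noteq> u" "y < n" "twin n G v y" for y
    unfolding twin_def
  proof (intro allI impI)
    fix z assume z: "z < n"
    show "({u, z} \<in> ?G1) = ({y, z} \<in> ?G1)"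
    proof (cases "z = u")
      case True
      have "{y, v} \<in> G \<longleftrightarrow> {v, v} \<in> G" using that(3) uv(2) unfolding twin_def by blast
      then have "{y, u} \<notin> ?G1" using G1b[OF that(1,2)] loop by blast
      then show ?thesis using True G1d by simp
    next
      case False
      then show ?thesis using G1c[OF False z] G1a[OF that(1) False] that(3) z unfolding twin_def by blast
    qed
  qed
  define A where "A = {(x, y) \<in> twin_pairs n G. x \<noteq> u \<and> y \<noteq> u}"
  define B where "B C = (\<lambda>y. (u, y)) ` C \<union> (\<lambda>y. (y, u)) ` C \<union> {(u, u)}" for C :: "nat set"
  define Cv where "Cv = {y. y < n \<and> twin n G v y}"
  define Cu where "Cu = {y. y < n \<and> twin n G u y} - {u}"
  have fin: "finite Cv" "finite Cu" unfolding Cv_def Cu_def by auto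
  have finT: "finite (twin_pairs n H)" for H
    by (rule finite_subset[of _ "{..<n} \<times> {..<n}"]) (auto simp: twin_pairs_def)
  have uCv: "u \<notin> Cv" "u \<notin> Cu" using uv(4) sym unfolding Cv_def Cu_def by blast+
  have cardB: "card (B C) = 2 * card C + 1" if "finite C" "u \<notin> C" for C
  proof -
    have "card ((\<lambda>y. (u, y)) ` C \<union> (\<lambda>y. (y, u)) ` C) = card C + card C"
      using that by (subst card_Un_disjoint) (auto simp: card_image inj_on_def)
    moreover have "(u, u) \<notin> (\<lambda>y. (u, y)) ` C \<union> (\<lambda>y. (y, u)) ` C" using that by auto
    ultimately show ?thesis unfolding B_def using that by (subst card_Un_disjoint) auto
  qed
  have AB: "A \<inter> B C = {}" for C unfolding A_def B_def by auto
  have finB: "finite (B C)" if "finite C" for C unfolding B_def using that by simp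
  have finA: "finite A" unfolding A_def using finT by (auto intro: finite_subset[of _ "twin_pairs n G"])
  have "twin_pairs n G \<subseteq> A \<union> B Cu"
    unfolding A_def B_def Cu_def twin_pairs_def using sym by (auto simp: image_iff)
  then have "card (twin_pairs n G) \<le> card (A \<union> B Cu)" using finA finB fin by (intro card_mono) auto
  also have "\<dots> = card A + (2 * card Cu + 1)"
    using card_Un_disjoint[OF finA finB[OF fin(2)] AB] cardB[OF fin(2) uCv(2)] by simp
  finally have 1: "card (twin_pairs n G) \<le> card A + (2 * card Cu + 1)" .
  have "A \<union> B Cv \<subseteq> twin_pairs n ?G1"
  proof -
    have "A \<subseteq> twin_pairs n ?G1" unfolding A_def twin_pairs_def using t1 by auto
    moreover have "(u, y) \<in> twin_pairs n ?G1 \<and> (y, u) \<in> twin_pairs n ?G1" if "y \<in> Cv" for y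
    proof -
      have "y \<noteq> u" "y < n" "twin n G v y" using that uCv unfolding Cv_def by auto
      then show ?thesis using t2[of y] sym[of ?G1 u y] uv(1) unfolding twin_pairs_def by auto
    qed
    moreover have "(u, u) \<in> twin_pairs n ?G1" using uv(1) unfolding twin_pairs_def twin_def by auto
    ultimately show ?thesis unfolding B_def by auto
  qed
  then have "card (A \<union> B Cv) \<le> card (twin_pairs n ?G1)" using finT by (intro card_mono) auto
  then have 2: "card A + (2 * card Cv + 1) \<le> card (twin_pairs n ?G1)"
    using card_Un_disjoint[OF finA finB[OF fin(1)] AB] cardB[OF fin(1) uCv(1)] by simp
  have "u \<in> {y. y < n \<and> twin n G u y}" using uv(1) unfolding twin_def by auto
  moreover have "{y. y < n \<and> twin n G u y} = insert u Cu" using calculation unfolding Cu_def by blast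
  ultimately have "card {y. y < n \<and> twin n G u y} = card Cu + 1" using fin uCv by simp
  then have "card Cu < card Cv" using le unfolding Cv_def by simp
  then show ?thesis using 1 2 by linarith
qed

lemma finite_graphs: "finite {G. graph_on n G}"
  by (rule finite_subset[of _ "Pow (Pow {0..<n})"]) (auto simp: graph_on_def)

context multipartite_pattern
begin

definition maxind :: "nat \<Rightarrow> real" where
  "maxind n = real (inducibility (cmp_graph k p) k n)"

lemma finite_ind_counts: "finite {ind_count F k G n | G. graph_on n G}"
proof -
  have "{ind_count F k G n | G. graph_on n G} = (\<lambda>G. ind_count F k G n) ` {G. graph_on n G}" by blast
  then show ?thesis using finite_graphs by simp
qed

lemma ind_le_maxind: "graph_on n G \<Longrightarrow> ind n G \<le> maxind n"
  unfolding maxind_def inducibility_def ind_count_eq[symmetric]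
  by (intro of_nat_mono Max_ge finite_ind_counts) blast

lemma maxind_attained: "\<exists>G. graph_on n G \<and> ind n G = maxind n"
proof -
  have "{ind_count (cmp_graph k p) k G n | G. graph_on n G} \<noteq> {}"
    using graph_on_cmp_graph by blast
  then have "inducibility (cmp_graph k p) k n \<in> {ind_count (cmp_graph k p) k G n | G. graph_on n G}"
    unfolding inducibility_def using finite_ind_counts by (intro Max_in) auto
  then show ?thesis unfolding maxind_def ind_count_eq[symmetric] by auto
qed

text \<open>The weight of a unit of distance is of the order of the number of copies through one
  pair, the most that a single edit can change.\<close>

definition penalized :: "nat \<Rightarrow> real \<Rightarrow> real \<Rightarrow> nat set set \<Rightarrow> real" where
  "penalized n c \<epsilon> G = ind n G + c * (real n ^ k / real n ^ 2) * min (real (cmp_dist n G)) (\<epsilon> * real n ^ 2)"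

text \<open>Zykov's symmetrisation: far from the complete multipartite graphs the penalty is constant, so
  cloning steps that do not decrease the number of copies stay among the maximisers; one with the
  most pairs of twins cannot be far.\<close>

lemma penalized_maximizer:
  assumes n: "n > 0" and \<epsilon>0: "\<epsilon> \<ge> 0"
  shows "\<exists>G. graph_on n G \<and> (\<forall>G'. graph_on n G' \<longrightarrow> penalized n c \<epsilon> G' \<le> penalized n c \<epsilon> G) \<and>
    real (cmp_dist n G) \<le> \<epsilon> * real n ^ 2 + real n"
proof (rule ccontr)
  assume H: "\<not> ?thesis"
  have neg: "real (cmp_dist n G) > \<epsilon> * real n ^ 2 + real n"
    if "graph_on n G" "\<forall>G'. graph_on n G' \<longrightarrow> penalized n c \<epsilon> G' \<le> penalized n c \<epsilon> G" for G
  proof (rule ccontr)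
    assume "\<not> ?thesis"
    then have "real (cmp_dist n G) \<le> \<epsilon> * real n ^ 2 + real n" by simp
    then show False using H that by blast
  qed
  define M where "M = {G. graph_on n G \<and> (\<forall>G'. graph_on n G' \<longrightarrow> penalized n c \<epsilon> G' \<le> penalized n c \<epsilon> G)}"
  have finM: "finite M" unfolding M_def using finite_graphs[of n] by (rule rev_finite_subset) auto
  have "\<exists>G\<in>{G. graph_on n G}. \<forall>G'\<in>{G. graph_on n G}. penalized n c \<epsilon> G' \<le> penalized n c \<epsilon> G"
  proof -
    have "{G. graph_on n G} \<noteq> {}" using graph_on_cmp_graph by blast
    then have "Max (penalized n c \<epsilon> ` {G. graph_on n G}) \<in> penalized n c \<epsilon> ` {G. graph_on n G}"
      using finite_graphs by (intro Max_in) auto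
    then obtain G where "graph_on n G" "penalized n c \<epsilon> G = Max (penalized n c \<epsilon> ` {G. graph_on n G})"
      by auto
    then show ?thesis using finite_graphs[of n] by auto
  qed
  then have "M \<noteq> {}" unfolding M_def by blast
  then have "Max ((\<lambda>G. card (twin_pairs n G)) ` M) \<in> (\<lambda>G. card (twin_pairs n G)) ` M"
    using finM by (intro Max_in) auto
  then obtain G where GM: "G \<in> M" and "card (twin_pairs n G) = Max ((\<lambda>G. card (twin_pairs n G)) ` M)"
    by auto
  then have Gmax: "card (twin_pairs n G') \<le> card (twin_pairs n G)" if "G' \<in> M" for G'
    using finM that by simp
  have G: "graph_on n G" and far: "real (cmp_dist n G) > \<epsilon> * real n ^ 2 + real n"
    using GM neg unfolding M_def by auto
  have step: "clone n G {u} v \<in> M \<and> deg n G v \<le> deg n G u"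
    if uv: "u < n" "v < n" "u \<noteq> v" "{u, v} \<notin> G" "deg n G u \<le> deg n G v" for u v
  proof -
    let ?G1 = "clone n G {u} v"
    have g1: "graph_on n ?G1" by (rule graph_on_clone)
    have gain: "ind n G + deg n G v - deg n G u \<le> ind n ?G1" by (rule clone_gain[OF G uv(1-4)])
    have "cmp_dist n G \<le> card (ediff G ?G1) + cmp_dist n ?G1" by (rule cmp_dist_triangle[OF G g1])
    also have "\<dots> \<le> n + cmp_dist n ?G1" using card_clone_diff_le[OF G] by simp
    finally have "real (cmp_dist n G) \<le> real n + real (cmp_dist n ?G1)" by linarith
    \<comment> \<open>The clone moves the distance by at most \<open>n\<close>, which is exactly the
      slack in \<open>far\<close>. Both penalties are therefore truncated and only the counts
      compare.\<close>
    then have far1: "real (cmp_dist n ?G1) \<ge> \<epsilon> * real n ^ 2" using far by linarith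
    then have "penalized n c \<epsilon> ?G1 - penalized n c \<epsilon> G = ind n ?G1 - ind n G"
      using far unfolding penalized_def by (simp add: min_def)
    moreover have "penalized n c \<epsilon> ?G1 \<le> penalized n c \<epsilon> G" using GM g1 unfolding M_def by blast
    ultimately have eq: "ind n ?G1 = ind n G" "penalized n c \<epsilon> ?G1 = penalized n c \<epsilon> G"
      using gain uv(5) by linarith+
    have "\<forall>G'. graph_on n G' \<longrightarrow> penalized n c \<epsilon> G' \<le> penalized n c \<epsilon> G" using GM unfolding M_def by simp
    then have "?G1 \<in> M" using g1 unfolding M_def eq(2)[symmetric] by simp
    then show ?thesis using gain eq(1) by linarith
  qed
  have "cmp_dist n G \<noteq> 0"
  proof
    assume "cmp_dist n G = 0"
    then have "\<epsilon> * real n ^ 2 + real n < 0" using far by simp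
    moreover have "\<epsilon> * real n ^ 2 \<ge> 0" using \<epsilon>0 by simp
    ultimately show False by linarith
  qed
  then have "\<not> (\<forall>u v. u < n \<longrightarrow> v < n \<longrightarrow> {u, v} \<notin> G \<longrightarrow> twin n G u v)"
    using cmp_dist_0I[OF G] by auto
  then obtain u v where uv: "u < n" "v < n" "{u, v} \<notin> G" "\<not> twin n G u v" by auto
  have ne: "u \<noteq> v" using uv(4) unfolding twin_def by auto
  have vu: "{v, u} \<notin> G" "\<not> twin n G v u" using uv(3,4) unfolding twin_def by (simp add: insert_commute, blast)
  \<comment> \<open>With equal degrees cloning is free in both directions, so the one towards the
    larger twin class may be taken.\<close>
  have "deg n G u = deg n G v"
    using step[OF uv(1,2) ne uv(3)] step[OF uv(2,1) ne[symmetric] vu(1)] by linarith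
  then have "clone n G {u} v \<in> M" "clone n G {v} u \<in> M"
    using step[OF uv(1,2) ne uv(3)] step[OF uv(2,1) ne[symmetric] vu(1)] by auto
  then have "card (twin_pairs n (clone n G {u} v)) \<le> card (twin_pairs n G)"
    "card (twin_pairs n (clone n G {v} u)) \<le> card (twin_pairs n G)" using Gmax by auto
  then show False
    using twin_pairs_clone[OF G uv] twin_pairs_clone[OF G uv(2,1) vu] by linarith
qed

text \<open>The local optimality that a penalised maximiser inherits; the structural part of the
  proof works from these conditions alone.\<close>

definition stable_point :: "nat \<Rightarrow> real \<Rightarrow> real \<Rightarrow> nat set set \<Rightarrow> bool" where
  "stable_point n c \<epsilon> G \<longleftrightarrow> graph_on n G \<and>
     (\<forall>G'. graph_on n G' \<longrightarrow> ind n G' \<le> ind n G + c * (real n ^ k / real n ^ 2) * real (card (ediff G G'))) \<and>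
     real (cmp_dist n G) \<le> \<epsilon> * real n ^ 2 + real n \<and>
     maxind n \<le> ind n G + c * \<epsilon> * real n ^ k"

text \<open>The maximiser supplied by symmetrisation is a stable point: the truncated distance is
  1-Lipschitz, so no edit outruns the penalty. Its own penalty then vanishes, and its value is a
  plain count.\<close>

lemma penalized_bound:
  assumes n: "n > 0" and c: "c > 0" and e: "\<epsilon> > 0"
    and stable: "\<And>G. stable_point n c \<epsilon> G \<Longrightarrow> cmp_dist n G = 0"
    and G': "graph_on n G'"
  shows "penalized n c \<epsilon> G' \<le> maxind n"
proof -
  let ?N = "real n ^ k / real n ^ 2"
  obtain G where G: "graph_on n G" and mx: "\<And>G'. graph_on n G' \<Longrightarrow> penalized n c \<epsilon> G' \<le> penalized n c \<epsilon> G"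
    and close: "real (cmp_dist n G) \<le> \<epsilon> * real n ^ 2 + real n"
    using penalized_maximizer[OF n, of \<epsilon> c] e by auto
  have N: "c * ?N \<ge> 0" using c by simp
  have "ind n G'' \<le> ind n G + c * ?N * real (card (ediff G G''))" if g: "graph_on n G''" for G''
  proof -
    have "real (cmp_dist n G) \<le> real (card (ediff G G'')) + real (cmp_dist n G'')"
      using cmp_dist_triangle[OF G g] by linarith
    then have "min (real (cmp_dist n G)) (\<epsilon> * real n ^ 2) \<le>
        real (card (ediff G G'')) + min (real (cmp_dist n G'')) (\<epsilon> * real n ^ 2)"
      by linarith
    then have "c * ?N * min (real (cmp_dist n G)) (\<epsilon> * real n ^ 2) \<le>
        c * ?N * (real (card (ediff G G'')) + min (real (cmp_dist n G'')) (\<epsilon> * real n ^ 2))"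
      using N by (rule mult_left_mono)
    then show ?thesis using mx[OF g] unfolding penalized_def by (simp only: distrib_left)
  qed
  moreover have "maxind n \<le> ind n G + c * \<epsilon> * real n ^ k"
  proof -
    obtain G0 where G0: "graph_on n G0" "ind n G0 = maxind n" using maxind_attained by blast
    have "0 \<le> c * ?N * min (real (cmp_dist n G0)) (\<epsilon> * real n ^ 2)"
      using N e by (intro mult_nonneg_nonneg[of "c * ?N"]) simp_all
    then have "maxind n \<le> penalized n c \<epsilon> G0" unfolding penalized_def G0(2) by linarith
    also have "\<dots> \<le> penalized n c \<epsilon> G" by (rule mx[OF G0(1)])
    also have "\<dots> \<le> ind n G + c * ?N * (\<epsilon> * real n ^ 2)"
      unfolding penalized_def by (intro add_left_mono mult_left_mono N) simp
    also have "c * ?N * (\<epsilon> * real n ^ 2) = c * \<epsilon> * real n ^ k" using n by simp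
    finally show ?thesis .
  qed
  ultimately have "stable_point n c \<epsilon> G" unfolding stable_point_def using G close by blast
  then have "penalized n c \<epsilon> G = ind n G" using stable e unfolding penalized_def by simp
  then show ?thesis using mx[OF G'] ind_le_maxind[OF G] by linarith
qed

end

section \<open>Counting copies when all parts have at most two vertices\<close>

text \<open>The coefficient of a^s b^t in the product of the polynomials 1 + x b + (x choose 2) a
  over the class sizes x: it counts vertex sets meeting s classes in two vertices and t classes in
  one. Integer indices let the recursion run below zero, where the value is 0.\<close>

primrec npart :: "nat list \<Rightarrow> int \<Rightarrow> int \<Rightarrow> real" where
  "npart [] s t = (if s = 0 \<and> t = 0 then 1 else 0)"
| "npart (x # xs) s t = npart xs s t + real x * npart xs s (t - 1) + real (x choose 2) * npart xs (s - 1) t"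

lemma npart_nonneg: "npart xs s t \<ge> 0"
  by (induction xs arbitrary: s t) auto

lemma npart_neg: "s < 0 \<or> t < 0 \<Longrightarrow> npart xs s t = 0"
  by (induction xs arbitrary: s t) auto

lemma npart_swap: "npart (x # y # xs) s t = npart (y # x # xs) s t"
  by (simp add: algebra_simps)

lemma npart_move: "npart (xs @ y # ys) s t = npart (y # xs @ ys) s t"
proof (induction xs arbitrary: s t)
  case (Cons x xs)
  have "npart ((x # xs) @ y # ys) s t = npart (x # y # xs @ ys) s t" using Cons by simp
  then show ?case by (simp only: npart_swap[of x y] append_Cons)
qed simp

text \<open>With \<open>S\<close> the sum of the remaining sizes, the recursion is dominated by the
  binomial expansion of (x + S)^(2 s + t).\<close>

lemma npart_le: "npart xs (int s) (int t) \<le> real (sum_list xs) ^ (2 * s + t)"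
proof (induction xs arbitrary: s t)
  case (Cons x xs)
  define S where "S = real (sum_list xs)"
  have S: "S \<ge> 0" unfolding S_def by simp
  have 0: "npart xs (int s) (int t) \<le> S ^ (2 * s + t)" using Cons unfolding S_def by simp
  have 1: "npart xs (int s) (int t - 1) \<le> (if t = 0 then 0 else S ^ (2 * s + t - 1))"
  proof (cases t)
    case (Suc t') then show ?thesis using Cons[of s t'] unfolding S_def by simp
  qed (simp add: npart_neg)
  have 2: "npart xs (int s - 1) (int t) \<le> (if s = 0 then 0 else S ^ (2 * s + t - 2))"
  proof (cases s)
    case (Suc s') then show ?thesis using Cons[of s' t] unfolding S_def by simp
  qed (simp add: npart_neg)
  have c2: "real (x choose 2) \<le> real x ^ 2"
    using binomial_le_pow[of 2 x] by (cases "2 \<le> x") (auto simp: binomial_eq_0 simp flip: of_nat_power)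
  have "npart (x # xs) (int s) (int t) \<le> S ^ (2 * s + t) + real x * (if t = 0 then 0 else S ^ (2 * s + t - 1))
     + real x ^ 2 * (if s = 0 then 0 else S ^ (2 * s + t - 2))"
    using 0 1 2 c2 S by (simp only: npart.simps) (intro add_mono mult_mono, auto simp: npart_nonneg)
  also have "\<dots> \<le> (real x + S) ^ (2 * s + t)"
  proof -
    consider "2 * s + t \<ge> 2" | "s = 0" "t = 1" | "s = 0" "t = 0" by linarith
    then show ?thesis
    proof cases
      case 1
      then obtain m where m: "2 * s + t = m + 2" by (metis le_add_diff_inverse2)
      have "S ^ (2 * s + t) + real x * (if t = 0 then 0 else S ^ (2 * s + t - 1))
         + real x ^ 2 * (if s = 0 then 0 else S ^ (2 * s + t - 2)) \<le>
         S ^ (m + 2) + real x * S ^ (m + 1) + real x ^ 2 * S ^ m"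
        using S m by (intro add_mono) auto
      also have "\<dots> \<le> S ^ m * (real x + S) ^ 2" using S
        by (simp add: power2_eq_square power_add algebra_simps)
      also have "\<dots> \<le> (real x + S) ^ m * (real x + S) ^ 2"
        using S by (intro mult_right_mono power_mono) auto
      finally show ?thesis by (simp only: m power_add)
    qed (use S in auto)
  qed
  finally show ?case unfolding S_def by simp
qed simp

lemma real_choose_2: "real (x choose 2) = real x * (real x - 1) / 2"
  by (induction x) (simp_all add: numeral_2_eq_2 field_simps)

text \<open>With \<open>x + y\<close> fixed, the count is a quadratic in \<open>w = x y\<close> with nonnegative leading coefficient.\<close>

definition pair_const :: "nat list \<Rightarrow> int \<Rightarrow> int \<Rightarrow> real \<Rightarrow> real" where
  "pair_const R s t \<sigma> = npart R s t + \<sigma> * npart R s (t - 1) + \<sigma> * (\<sigma> - 1) / 2 * npart R (s - 1) t"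
definition pair_lin :: "nat list \<Rightarrow> int \<Rightarrow> int \<Rightarrow> real \<Rightarrow> real" where
  "pair_lin R s t \<sigma> = npart R s (t - 2) - npart R (s - 1) t + (\<sigma> - 2) / 2 * npart R (s - 1) (t - 1)
     + (1 - \<sigma>) / 4 * npart R (s - 2) t"

lemma npart_pair:
  "npart (x # y # R) s t = pair_const R s t (real x + real y)
     + pair_lin R s t (real x + real y) * (real x * real y) + npart R (s - 2) t / 4 * (real x * real y) ^ 2"
  by (simp add: real_choose_2 pair_const_def pair_lin_def)
     (simp add: field_simps power2_eq_square)

lemma npart_single: "npart (x # R) s t = pair_const R s t (real x)"
  by (simp add: real_choose_2 pair_const_def)

text \<open>The graph lies below its chord from 0 to \<open>w'\<close>. The inequality is solved for
  the deficit at 0, since a product of 0 is the situation after two classes have been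
  merged.\<close>

lemma convex_quadratic:
  fixes \<alpha> \<beta> \<gamma> w w' :: real
  assumes "\<gamma> \<ge> 0" "0 \<le> w" "w < w'" "\<alpha> + \<beta> * w' + \<gamma> * w' ^ 2 \<le> M"
  shows "M - \<alpha> \<le> (M - (\<alpha> + \<beta> * w + \<gamma> * w ^ 2)) * (w' / (w' - w))"
proof -
  have "(M - \<alpha>) * (w' - w) \<le> (M - (\<alpha> + \<beta> * w + \<gamma> * w ^ 2)) * w'"
  proof -
    have "(\<alpha> + \<beta> * w' + \<gamma> * w' ^ 2) * w \<le> M * w" using assms by (intro mult_right_mono)
    moreover have "\<gamma> * w * w' * (w' - w) \<ge> 0" using assms by simp
    ultimately show ?thesis by (simp add: algebra_simps power2_eq_square)
  qed
  then show ?thesis using assms(3) by (simp add: field_simps)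
qed

text \<open>Interpolates between the merged pair, with product 0, and the balanced pair, whose
  product \<open>w'\<close> is the largest for this sum. The gap condition puts \<open>x y\<close>
  strictly below \<open>w'\<close>.\<close>

lemma merge_parts:
  assumes M: "\<And>x' y'. x' + y' = x + y \<Longrightarrow> npart (x' # y' # R) s t \<le> M"
    and gap: "(real x - real y) ^ 2 > 1"
  shows "\<exists>w'. w' > real x * real y \<and> 4 * w' \<ge> (real x + real y) ^ 2 - 1 \<and> 4 * w' \<le> (real x + real y) ^ 2 \<and>
    M - npart ((x + y) # R) s t \<le> (M - npart (x # y # R) s t) * (w' / (w' - real x * real y))"
proof -
  define x' where "x' = (x + y) div 2"
  define y' where "y' = x + y - x'"
  have s: "x' + y' = x + y" unfolding y'_def x'_def by simp
  have d: "y' = x' \<or> y' = x' + 1" unfolding y'_def x'_def by linarith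
  let ?w' = "real x' * real y'"
  have sr: "real x' + real y' = real x + real y" using s by (metis of_nat_add)
  have id: "4 * ?w' = (real x + real y) ^ 2 - (real y' - real x') ^ 2"
    unfolding sr[symmetric] by (simp add: power2_eq_square algebra_simps)
  have d2: "0 \<le> (real y' - real x') ^ 2" "(real y' - real x') ^ 2 \<le> 1" using d by auto
  have id2: "4 * (real x * real y) = (real x + real y) ^ 2 - (real x - real y) ^ 2"
    by (simp add: power2_eq_square algebra_simps)
  have lt: "real x * real y < ?w'" using id id2 d2 gap by linarith
  have "npart (x' # y' # R) s t \<le> M" by (rule M[OF s])
  then have "M - pair_const R s t (real x + real y) \<le> (M - npart (x # y # R) s t) * (?w' / (?w' - real x * real y))"
    unfolding npart_pair[of x y] npart_pair[of x' y'] sr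
    using lt by (intro convex_quadratic) (auto simp: npart_nonneg)
  then have "M - npart ((x + y) # R) s t \<le> (M - npart (x # y # R) s t) * (?w' / (?w' - real x * real y))"
    unfolding npart_single by simp
  then show ?thesis using lt id d2 by (intro exI[of _ ?w']) simp
qed

text \<open>The parts are absorbed into the dominant one in turn, each raising the deficit by a
  factor of at most 1 + 512 z / b; the product is bounded by an exponential. A single class holds no
  copy, so the last deficit is \<open>M\<close> itself.\<close>

lemma merge_all:
  assumes M: "\<And>xs. sum_list xs = n \<Longrightarrow> npart xs s t \<le> M" and st: "s \<ge> 0" "t \<ge> 0" "s + t \<ge> 2"
    and b: "b \<ge> 12"
  shows "real B \<ge> b \<Longrightarrow> \<forall>z\<in>set zs. 8 * z \<le> 7 * B \<Longrightarrow> B + sum_list zs = n \<Longrightarrow>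
    M \<le> (M - npart (B # zs) s t) * exp (512 * real (sum_list zs) / b)"
proof (induction zs arbitrary: B)
  case Nil
  then show ?case using st by auto
next
  case (Cons z zs)
  let ?B = "real B" and ?z = "real z"
  have Bb: "?B \<ge> b" using Cons by simp
  have "8 * z \<le> 7 * B" using Cons.prems(2) by simp
  then have zB: "8 * ?z \<le> 7 * ?B" by linarith
  have B12: "?B \<ge> 12" using Bb b by simp
  have g: "?B / 8 \<le> ?B - ?z" using zB by simp
  have "(?B / 8) ^ 2 \<le> (?B - ?z) ^ 2" using g B12 by (intro power_mono) auto
  moreover have "?B * ?B \<ge> 144" using mult_mono[of 12 ?B 12 ?B] B12 by simp
  \<comment> \<open>\<open>B - z \<ge> B / 8\<close> gives \<open>B ^ 2 / 64\<close>, and half of it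
    absorbs the 1 because \<open>B \<ge> 12\<close>. With the factor 4 in front of the products this
    is the origin of 512.\<close>
  ultimately have g2: "(?B - ?z) ^ 2 - 1 \<ge> ?B ^ 2 / 128" "(?B - ?z) ^ 2 > 1"
    by (simp_all add: power2_eq_square)
  have Mm: "npart (x' # y' # zs) s t \<le> M" if "x' + y' = B + z" for x' y'
    using that Cons.prems(3) by (intro M) simp
  obtain w' where w': "w' > ?B * ?z" "4 * w' \<ge> (?B + ?z) ^ 2 - 1"
    "M - npart ((B + z) # zs) s t \<le> (M - npart (B # z # zs) s t) * (w' / (w' - ?B * ?z))"
    using merge_parts[of B z zs s t M, OF Mm g2(2)] by blast
  have "4 * (w' - ?B * ?z) \<ge> (?B - ?z) ^ 2 - 1" using w'(2) by (simp add: power2_eq_square algebra_simps)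
  then have low: "w' - ?B * ?z \<ge> ?B ^ 2 / 512" using g2(1) by simp
  have "w' / (w' - ?B * ?z) = 1 + ?B * ?z / (w' - ?B * ?z)" using w'(1) by (simp add: field_simps)
  also have "\<dots> \<le> 1 + ?B * ?z / (?B ^ 2 / 512)"
    using low B12 w'(1) by (intro add_left_mono divide_left_mono mult_pos_pos) auto
  also have "\<dots> = 1 + 512 * ?z / ?B" using B12 by (simp add: power2_eq_square)
  also have "\<dots> \<le> 1 + 512 * ?z / b" using Bb b by (intro add_left_mono divide_left_mono mult_pos_pos) auto
  also have "\<dots> \<le> exp (512 * ?z / b)" by (rule exp_ge_add_one_self)
  finally have ratio: "w' / (w' - ?B * ?z) \<le> exp (512 * ?z / b)" .
  have nn: "M - npart (B # z # zs) s t \<ge> 0" using Mm[of B z] by simp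
  have "M \<le> (M - npart ((B + z) # zs) s t) * exp (512 * real (sum_list zs) / b)"
  proof (rule Cons.IH)
    show "real (B + z) \<ge> b" using Bb by simp
    show "\<forall>z'\<in>set zs. 8 * z' \<le> 7 * (B + z)" using Cons.prems(2) by fastforce
    show "B + z + sum_list zs = n" using Cons.prems(3) by simp
  qed
  also have "\<dots> \<le> ((M - npart (B # z # zs) s t) * exp (512 * ?z / b)) * exp (512 * real (sum_list zs) / b)"
    using w'(3) mult_left_mono[OF ratio nn] by (intro mult_right_mono) auto
  also have "\<dots> = (M - npart (B # z # zs) s t) * exp (512 * real (sum_list (z # zs)) / b)"
    by (simp add: exp_add[symmetric] add_divide_distrib distrib_left del: npart.simps)
  finally show ?case .
qed

text \<open>If splitting off a vertex of the largest part were (almost) free, then so would be splitting it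
  into two pieces of proportional sizes, and the resulting unequal parts could be merged into one.\<close>

lemma split_cost:
  fixes \<pi> \<beta> :: real
  assumes pos: "\<pi> > 0" "\<beta> > 0" "\<beta> \<le> 1"
  defines "\<kappa> \<equiv> \<pi> / (200 * exp (512 / \<beta>))"
  assumes M: "\<And>xs. sum_list xs = n \<Longrightarrow> npart xs (int s) (int t) \<le> M" and Mlow: "M \<ge> \<pi> * real n ^ (2 * s + t)"
    and st: "s + t \<ge> 2" "2 * s + t \<ge> 2" and n: "\<beta> * real n \<ge> 12" "\<kappa> * real n \<ge> 3"
    and parts: "x + sum_list R = n" "\<And>y. y \<in> set R \<Longrightarrow> y \<le> x" "\<beta> * real n \<le> real x"
    and cheap: "npart (x # R) (int s) (int t - 1) \<ge> npart (x # R) (int s) (int t)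
        - npart ((x - 1) # R) (int s) (int t) - \<kappa> * real n ^ (2 * s + t) / real n"
  shows "npart (x # R) (int s) (int t) \<le> M - \<kappa> * real n ^ (2 * s + t)"
proof (rule ccontr)
  assume near: "\<not> ?thesis"
  let ?k = "2 * s + t" let ?N = "\<lambda>xs. npart xs (int s) (int t)"
  have npos: "real n > 0" using n pos by (cases "n = 0") auto
  have x12: "real x \<ge> 12" using n parts by simp
  have \<kappa>: "\<kappa> > 0" unfolding \<kappa>_def using pos by simp
  have U: "M \<le> (M - ?N (B # zs)) * exp (512 / \<beta>)"
    if B: "\<beta> * real n \<le> real B" and z: "\<forall>z\<in>set zs. 8 * z \<le> 7 * B" and s: "B + sum_list zs = n" for B zs
  proof -
    have "M \<le> (M - ?N (B # zs)) * exp (512 * real (sum_list zs) / (\<beta> * real n))"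
      using st by (intro merge_all[OF M]) (use n B z s in auto)
    also have "\<dots> \<le> (M - ?N (B # zs)) * exp (512 / \<beta>)"
    proof (intro mult_left_mono)
      have "512 * real (sum_list zs) / (\<beta> * real n) \<le> 512 * real n / (\<beta> * real n)"
        using s pos npos by (intro divide_right_mono) auto
      then show "exp (512 * real (sum_list zs) / (\<beta> * real n)) \<le> exp (512 / \<beta>)" using npos by simp
      show "M - ?N (B # zs) \<ge> 0" using M[of "B # zs"] s by simp
    qed
    finally show ?thesis .
  qed
  define E where "E = exp (512 / \<beta>)"
  have E: "E > 0" unfolding E_def by simp
  \<comment> \<open>A near-optimal configuration has no part exceeding all others by the factor 8/7,
    since everything could be merged into it. The 200 in \<open>\<kappa>\<close> leaves room for a
    deficit of 100 \<kappa>.\<close>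
  have contr: False if "M - ?N (B # zs) < 100 * \<kappa> * real n ^ ?k"
    "\<beta> * real n \<le> real B" "\<forall>z\<in>set zs. 8 * z \<le> 7 * B" "B + sum_list zs = n" for B zs
  proof -
    have "\<pi> * real n ^ ?k \<le> (M - ?N (B # zs)) * E" using U[OF that(2-4)] Mlow unfolding E_def by linarith
    also have "\<dots> < 100 * \<kappa> * real n ^ ?k * E" using that(1) E by (rule mult_strict_right_mono)
    also have "\<dots> = \<pi> / 2 * real n ^ ?k" unfolding \<kappa>_def E_def[symmetric] using E by simp
    finally show False using pos npos by simp
  qed
  have pk: "real n ^ ?k > 0" using npos by simp
  have near': "M - ?N (x # R) < \<kappa> * real n ^ ?k" using near by simp
  show False
  proof (cases "\<forall>y\<in>set R. 8 * y \<le> 7 * x")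
    case True
    have "\<kappa> * real n ^ ?k \<le> 100 * \<kappa> * real n ^ ?k" using \<kappa> pk by simp
    then show False using contr[of x R] near' parts True by auto
  next
    case False
    then obtain y where y: "y \<in> set R" "7 * x < 8 * y" by auto
    then obtain R1 R2 where R: "R = R1 @ y # R2" by (meson split_list)
    define R' where "R' = R1 @ R2"
    have NR: "npart (l @ R) i j = npart (l @ y # R') i j" for l i j
      unfolding R R'_def by (induction l arbitrary: i j) (simp_all add: npart_move)
    \<comment> \<open>A third of \<open>x\<close>, joined to a part \<open>y\<close> larger than 7/8
      of \<open>x\<close>, exceeds \<open>x\<close> by the factor 8/7 that \<open>contr\<close>
      forbids.\<close>
    define u where "u = x div 3"
    have ux: "u \<le> x" "3 * u \<le> x" "x \<le> 3 * u + 2" unfolding u_def by auto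
    have yx: "y \<le> x" using parts(2) y(1) .
    have sumR: "sum_list R = y + sum_list R'" unfolding R R'_def by simp
    let ?lin = "pair_lin R (int s) (int t) (real x)"
    let ?w = "real u * real (x - u)"
    have xR: "real x > 0" using x12 by simp
    have xn: "real x \<le> real n" using parts(1) by simp
    have sRn: "real (sum_list R) \<le> real n" using parts(1) by simp
    have bound: "npart R i j \<le> real n ^ m" if "i = int i'" "j = int j'" "m = 2 * i' + j'" for i j m i' j'
      using npart_le[of R i' j'] power_mono[OF sRn, of "2 * i' + j'"] that by simp
    \<comment> \<open>The bounds \<open>b1\<close> to \<open>b3\<close> show that the correction
      terms of \<open>lin\<close> have order n ^ (2 s + t - 2).\<close>
    have b1: "npart R (int s - 1) (int t) \<le> real n ^ ?k / real n ^ 2"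
    proof (cases s)
      case (Suc s')
      have "npart R (int s - 1) (int t) \<le> real n ^ (2 * s' + t)" using Suc by (intro bound) auto
      then show ?thesis using Suc npos by (simp add: power_add power2_eq_square)
    qed (simp add: npart_neg)
    have b2: "real n * npart R (int s - 1) (int t - 1) \<le> real n ^ ?k / real n ^ 2"
    proof (cases "s = 0 \<or> t = 0")
      case False
      then obtain s' t' where e: "s = Suc s'" "t = Suc t'" by (meson not0_implies_Suc)
      have "npart R (int s - 1) (int t - 1) \<le> real n ^ (2 * s' + t')" using e by (intro bound) auto
      then have "real n * npart R (int s - 1) (int t - 1) \<le> real n * real n ^ (2 * s' + t')"
        using npos by (intro mult_left_mono) auto
      then show ?thesis using e npos by (simp add: power_add power2_eq_square field_simps)
    qed (auto simp: npart_neg)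
    have b3: "real n ^ 2 * npart R (int s - 2) (int t) \<le> real n ^ ?k / real n ^ 2"
    proof (cases "s \<ge> 2")
      case True
      then obtain s' where e: "s = s' + 2" by (metis le_add_diff_inverse2)
      have "npart R (int s - 2) (int t) \<le> real n ^ (2 * s' + t)" using e by (intro bound) auto
      then have "real n ^ 2 * npart R (int s - 2) (int t) \<le> real n ^ 2 * real n ^ (2 * s' + t)"
        using npos by (intro mult_left_mono) auto
      then show ?thesis using e npos by (simp add: power_add power2_eq_square field_simps)
    qed (simp add: npart_neg)
    have c1: "real x * npart R (int s - 1) (int t - 1) \<le> real n ^ ?k / real n ^ 2"
      using b2 mult_right_mono[OF xn npart_nonneg[of R "int s - 1" "int t - 1"]] by linarith
    have c2: "real x * (real x - 1) * npart R (int s - 2) (int t) \<le> real n ^ ?k / real n ^ 2"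
    proof -
      have "real x * (real x - 1) \<le> real n ^ 2"
        using xn x12 by (simp add: power2_eq_square) (intro mult_mono, auto)
      then show ?thesis using b3 mult_right_mono[OF _ npart_nonneg[of R "int s - 2" "int t"]] by (meson order_trans)
    qed
    have x1: "real (x - 1) = real x - 1" using x12 by simp
    \<comment> \<open>Up to these corrections, \<open>x\<close> times the linear coefficient is the
      degree of a vertex joined to everything minus the degree of a vertex in the class of size
      \<open>x\<close>; the hypothesis \<open>cheap\<close> bounds it from below.\<close>
    have lin: "real x * ?lin = npart (x # R) (int s) (int t - 1)
        - (?N (x # R) - ?N ((x - 1) # R))
        - npart R (int s - 1) (int t) - real x / 2 * npart R (int s - 1) (int t - 1)
        - real x * (real x - 1) / 4 * npart R (int s - 2) (int t)"
      unfolding npart_single pair_lin_def pair_const_def x1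
      by (simp add: field_simps)
    have "real x * ?lin \<ge> - (\<kappa> * real n ^ ?k / real n) - 3 * (real n ^ ?k / real n ^ 2)"
    proof -
      have "0 \<le> real x * npart R (int s - 1) (int t - 1)" by (simp add: npart_nonneg)
      moreover have "0 \<le> real x * (real x - 1) * npart R (int s - 2) (int t)"
        using x12 by (intro mult_nonneg_nonneg) (auto simp: npart_nonneg)
      moreover have "real x / 2 * npart R (int s - 1) (int t - 1) = (real x * npart R (int s - 1) (int t - 1)) / 2"
        "real x * (real x - 1) / 4 * npart R (int s - 2) (int t) = (real x * (real x - 1) * npart R (int s - 2) (int t)) / 4"
        by simp_all
      ultimately have "real x / 2 * npart R (int s - 1) (int t - 1) \<le> real n ^ ?k / real n ^ 2"
        "real x * (real x - 1) / 4 * npart R (int s - 2) (int t) \<le> real n ^ ?k / real n ^ 2"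
        using c1 c2 by linarith+
      then show ?thesis using lin cheap b1 by linarith
    qed
    moreover have "3 * (real n ^ ?k / real n ^ 2) \<le> \<kappa> * real n ^ ?k / real n"
    proof -
      have "3 * (real n ^ ?k / real n ^ 2) \<le> \<kappa> * real n * (real n ^ ?k / real n ^ 2)"
        using n(2) npos by (intro mult_right_mono) auto
      also have "\<dots> = \<kappa> * real n ^ ?k / real n" using npos by (simp add: power2_eq_square)
      finally show ?thesis .
    qed
    ultimately have linlow: "real x * ?lin \<ge> - (2 * \<kappa> * real n ^ ?k / real n)" by simp
    have wle: "?w \<le> real x * real x" using ux by (intro mult_mono) auto
    have linw: "?lin * ?w \<ge> - (2 * \<kappa> * real n ^ ?k)"
    proof (cases "?lin \<ge> 0")
      case True
      then have "?lin * ?w \<ge> 0" by simp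
      then show ?thesis using \<kappa> pk by (smt (verit) mult_nonneg_nonneg)
    next
      case False
      then have "?lin * ?w \<ge> ?lin * (real x * real x)" using wle by (intro mult_left_mono_neg) auto
      moreover have "?lin * (real x * real x) = (real x * ?lin) * real x" by simp
      moreover have "(real x * ?lin) * real x \<ge> - (2 * \<kappa> * real n ^ ?k / real n) * real x"
        using linlow by (intro mult_right_mono) auto
      moreover have "- (2 * \<kappa> * real n ^ ?k / real n) * real x = - ((2 * \<kappa> * real n ^ ?k / real n) * real x)"
        by simp
      ultimately have 1: "?lin * ?w \<ge> - ((2 * \<kappa> * real n ^ ?k / real n) * real x)" by linarith
      have "(2 * \<kappa> * real n ^ ?k / real n) * real x \<le> (2 * \<kappa> * real n ^ ?k / real n) * real n"
        using xn \<kappa> npos by (intro mult_left_mono) auto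
      then show ?thesis using 1 npos by simp
    qed
    have ur: "real u + real (x - u) = real x" using ux by simp
    \<comment> \<open>The unsplit class is the value at product 0, and the quadratic term that is
      dropped is nonnegative.\<close>
    have "?N (u # (x - u) # R) \<ge> ?N (x # R) + ?lin * ?w"
      unfolding npart_pair npart_single[of x] ur by (simp add: npart_nonneg)
    then have d1: "M - ?N (u # (x - u) # R) < 3 * \<kappa> * real n ^ ?k" using linw near' by simp
    have eqN: "?N (u # (x - u) # R) = ?N (u # y # (x - u) # R')"
    proof -
      have "?N (u # (x - u) # R) = ?N (u # (x - u) # y # R')" using NR[of "[u, x - u]"] by simp
      also have "\<dots> = ?N (u # y # (x - u) # R')"
        using npart_swap[of "x - u" y R'] by (simp only: npart.simps(2)[of u])
      finally show ?thesis .
    qed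
    have ureal: "3 * real u \<le> real x" "real x \<le> 3 * real u + 2" "7 * real x < 8 * real y" "real y \<le> real x"
      using ux y(2) yx by linarith+
    have gap: "real y - real u \<ge> real x / 2" using ureal by linarith
    have gap2: "(real u - real y) ^ 2 \<ge> real x ^ 2 / 4"
    proof -
      have "(real x / 2) ^ 2 \<le> (real y - real u) ^ 2" using gap x12 by (intro power_mono) auto
      then show ?thesis by (simp add: power2_commute[of "real u"] power_divide)
    qed
    have x2: "real x ^ 2 \<ge> 144" using power_mono[of 12 "real x" 2] x12 by simp
    have Mm: "?N (x' # y' # (x - u) # R') \<le> M" if "x' + y' = u + y" for x' y'
      using that parts(1) ux sumR by (intro M) simp
    obtain w' where w': "w' > real u * real y" "4 * w' \<ge> (real u + real y) ^ 2 - 1" "4 * w' \<le> (real u + real y) ^ 2"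
      "M - ?N ((u + y) # (x - u) # R') \<le> (M - ?N (u # y # (x - u) # R')) * (w' / (w' - real u * real y))"
      using merge_parts[of u y "(x - u) # R'" "int s" "int t" M, OF Mm] gap2 x2 by auto
    have "4 * (w' - real u * real y) \<ge> (real u - real y) ^ 2 - 1"
      using w'(2) by (simp add: power2_eq_square algebra_simps)
    then have low: "w' - real u * real y \<ge> real x ^ 2 / 32" using gap2 x2 by simp
    have "(real u + real y) ^ 2 \<le> (2 * real x) ^ 2" using ureal by (intro power_mono) auto
    then have "w' \<le> real x ^ 2" using w'(3) by (simp add: power_mult_distrib)
    then have "w' / (w' - real u * real y) \<le> real x ^ 2 / (real x ^ 2 / 32)"
      using low x2 x12 by (intro frac_le) auto
    then have ratio: "w' / (w' - real u * real y) \<le> 32" using x12 by simp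
    have "M - ?N ((u + y) # (x - u) # R') \<le> (M - ?N (u # y # (x - u) # R')) * 32"
      using w'(4) mult_left_mono[OF ratio, of "M - ?N (u # y # (x - u) # R')"] Mm[of u y] by linarith
    \<comment> \<open>A deficit below 3 \<kappa> grows at most by the factor 32, to less than 96
      \<kappa>.\<close>
    then have "M - ?N ((u + y) # (x - u) # R') < 100 * \<kappa> * real n ^ ?k"
    proof -
      have "A < 100 * \<kappa> * K" if "A \<le> B * 32" "B < 3 * \<kappa> * K" "0 < \<kappa> * K" for A B K :: real
        using that by linarith
      from this[OF _ d1[unfolded eqN] mult_pos_pos[OF \<kappa> pk]] show ?thesis
        using \<open>M - ?N ((u + y) # (x - u) # R') \<le> (M - ?N (u # y # (x - u) # R')) * 32\<close> by blast
    qed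
    then show False
    proof (rule contr)
      show "\<beta> * real n \<le> real (u + y)" using parts(3) ureal x12 by simp
      have "8 * real x \<le> 7 * real u + 7 * real y" using ureal(2,3) x12 by linarith
      then have "real (8 * x) \<le> real (7 * (u + y))" by simp
      then have 8: "8 * x \<le> 7 * (u + y)" by (simp only: of_nat_le_iff)
      have "z \<le> x" if "z \<in> set R'" for z using parts(2)[of z] that unfolding R R'_def by auto
      then show "\<forall>z\<in>set ((x - u) # R'). 8 * z \<le> 7 * (u + y)" using 8 by fastforce
      show "u + y + sum_list ((x - u) # R') = n" using parts(1) sumR ux by simp
    qed
  qed
qed

section \<open>Colourings and the sets counted by the polynomial\<close>

definition pair_type :: "(nat \<Rightarrow> nat) \<Rightarrow> int \<Rightarrow> int \<Rightarrow> nat set \<Rightarrow> bool" where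
  "pair_type c s t S \<longleftrightarrow> finite S \<and> (\<forall>i\<in>c ` S. card {x\<in>S. c x = i} \<le> 2) \<and>
     int (card {i\<in>c ` S. card {x\<in>S. c x = i} = 2}) = s \<and>
     int (card {i\<in>c ` S. card {x\<in>S. c x = i} = 1}) = t"

lemma pair_type_Un:
  assumes fin: "finite T" "finite Q" and ne: "Q \<noteq> {}" and Q: "\<And>x. x \<in> Q \<Longrightarrow> c x = i"
    and T: "\<And>x. x \<in> T \<Longrightarrow> c x \<noteq> i"
  shows "pair_type c s t (T \<union> Q) \<longleftrightarrow>
     card Q = 1 \<and> pair_type c s (t - 1) T \<or> card Q = 2 \<and> pair_type c (s - 1) t T"
proof -
  have im: "c ` (T \<union> Q) = insert i (c ` T)" "i \<notin> c ` T" using Q T ne by auto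
  have ci: "{x \<in> T \<union> Q. c x = i} = Q" using Q T by auto
  have cj: "{x \<in> T \<union> Q. c x = j} = {x\<in>T. c x = j}" if j: "j \<in> c ` T" for j
  proof -
    have "j \<noteq> i" using j im(2) by blast
    then show ?thesis using Q by blast
  qed
  have E: "{j\<in>c ` (T \<union> Q). card {x\<in>T \<union> Q. c x = j} = m} =
      {j\<in>c ` T. card {x\<in>T. c x = j} = m} \<union> (if card Q = m then {i} else {})" for m
    unfolding im using ci cj by auto
  have E': "card {j\<in>c ` (T \<union> Q). card {x\<in>T \<union> Q. c x = j} = m} =
      card {j\<in>c ` T. card {x\<in>T. c x = j} = m} + (if card Q = m then 1 else 0)" for m
    unfolding E using fin im(2) by (auto simp: card_insert_if)
  have all: "(\<forall>j\<in>c ` (T \<union> Q). card {x\<in>T \<union> Q. c x = j} \<le> 2) \<longleftrightarrow>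
      card Q \<le> 2 \<and> (\<forall>j\<in>c ` T. card {x\<in>T. c x = j} \<le> 2)"
    unfolding im using ci cj by auto
  have "card Q \<ge> 1" using fin(2) ne by (simp add: Suc_leI card_gt_0_iff)
  then consider "card Q = 1" | "card Q = 2" | "card Q > 2" by linarith
  then show ?thesis
  proof cases
    case 1
    then show ?thesis unfolding pair_type_def all E' using fin by auto
  next
    case 2
    then show ?thesis unfolding pair_type_def all E' using fin by auto
  next
    case 3
    then show ?thesis unfolding pair_type_def all by auto
  qed
qed

text \<open>The three summands of \<open>npart\<close> correspond to zero, one or two vertices of
  the colour that is split off.\<close>

lemma card_pair_type:
  assumes "finite A" "distinct cs"
  shows "real (card {S. S \<subseteq> {x\<in>A. c x \<in> set cs} \<and> pair_type c s t S}) =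
    npart (map (\<lambda>i. card {x\<in>A. c x = i}) cs) s t"
  using assms(2)
proof (induction cs arbitrary: s t)
  case Nil
  have "{S. S \<subseteq> {x\<in>A. c x \<in> set []} \<and> pair_type c s t S} = (if s = 0 \<and> t = 0 then {{}} else {})"
    by (auto simp: pair_type_def)
  then show ?case by simp
next
  case (Cons i cs)
  let ?V = "{x\<in>A. c x \<in> set (i # cs)}" and ?X = "{x\<in>A. c x = i}" and ?W = "{x\<in>A. c x \<in> set cs}"
  have W: "?V - ?X = ?W" using Cons.prems by auto
  have finX: "finite ?X" using assms(1) by simp
  have "card {S. S \<subseteq> ?V \<and> pair_type c s t S} =
      (\<Sum>T\<in>Pow (?V - ?X). card {Q. Q \<subseteq> ?X \<and> pair_type c s t (T \<union> Q)})"
    using assms(1) by (intro card_sets_split) auto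
  also have "\<dots> = (\<Sum>T\<in>Pow ?W. (if pair_type c s t T then 1 else 0)
     + (if pair_type c s (t - 1) T then card ?X else 0)
     + (if pair_type c (s - 1) t T then card ?X choose 2 else 0))"
    unfolding W
  proof (rule sum.cong[OF refl])
    fix T assume T: "T \<in> Pow ?W"
    have finT: "finite T" using T assms(1) finite_subset[of T A] by auto
    have ni: "c x \<noteq> i" if "x \<in> T" for x using T that Cons.prems by auto
    let ?Q = "\<lambda>m. {Q. Q \<subseteq> ?X \<and> card Q = m}"
    have finQ: "finite (?Q m)" for m using finX by (auto intro: finite_subset[of _ "Pow ?X"])
    have split: "Q \<subseteq> ?X \<and> pair_type c s t (T \<union> Q) \<longleftrightarrow>
        Q = {} \<and> pair_type c s t T \<or> Q \<in> ?Q 1 \<and> pair_type c s (t - 1) T \<or> Q \<in> ?Q 2 \<and> pair_type c (s - 1) t T" for Q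
    proof (cases "Q = {} \<or> \<not> Q \<subseteq> ?X")
      case False
      then have "finite Q" "Q \<noteq> {}" "\<And>x. x \<in> Q \<Longrightarrow> c x = i" using finX finite_subset by auto
      then show ?thesis using pair_type_Un[of T Q c i s t] finT ni False by auto
    qed auto
    define A0 where "A0 = (if pair_type c s t T then {{} :: nat set} else {})"
    define A1 where "A1 = (if pair_type c s (t - 1) T then ?Q 1 else {})"
    define A2 where "A2 = (if pair_type c (s - 1) t T then ?Q 2 else {})"
    have mem: "Q \<in> A0 \<Longrightarrow> card Q = 0" "Q \<in> A1 \<Longrightarrow> card Q = 1" "Q \<in> A2 \<Longrightarrow> card Q = 2" for Q
      unfolding A0_def A1_def A2_def by (simp_all split: if_splits)
    have fins: "finite A0" "finite A1" "finite A2" unfolding A0_def A1_def A2_def using finQ by simp_all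
    have "A0 \<inter> A1 = {}" "(A0 \<union> A1) \<inter> A2 = {}" using mem by fastforce+
    then have "card (A0 \<union> A1 \<union> A2) = card A0 + card A1 + card A2"
      using fins by (simp add: card_Un_disjoint)
    moreover have "{Q. Q \<subseteq> ?X \<and> pair_type c s t (T \<union> Q)} = A0 \<union> A1 \<union> A2"
      unfolding split A0_def A1_def A2_def by auto
    moreover have "card A0 = (if pair_type c s t T then 1 else 0)" unfolding A0_def by simp
    moreover have "card A1 = (if pair_type c s (t - 1) T then card ?X else 0)"
      unfolding A1_def using n_subsets[OF finX, of 1] by simp
    moreover have "card A2 = (if pair_type c (s - 1) t T then card ?X choose 2 else 0)"
      unfolding A2_def using n_subsets[OF finX, of 2] by simp
    ultimately show "card {Q. Q \<subseteq> ?X \<and> pair_type c s t (T \<union> Q)} = (if pair_type c s t T then 1 else 0)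
     + (if pair_type c s (t - 1) T then card ?X else 0)
     + (if pair_type c (s - 1) t T then card ?X choose 2 else 0)" by presburger
  qed
  finally have eq: "card {S. S \<subseteq> ?V \<and> pair_type c s t S} = \<dots>" .
  have cnt: "(\<Sum>T\<in>Pow ?W. if P T then (m::nat) else 0) = m * card {S. S \<subseteq> ?W \<and> P S}" for P m
  proof -
    have "(\<Sum>T\<in>Pow ?W. if P T then m else 0) = (\<Sum>T\<in>{T\<in>Pow ?W. P T}. m)"
      using assms(1) by (subst sum.inter_filter) auto
    moreover have "{T\<in>Pow ?W. P T} = {S. S \<subseteq> ?W \<and> P S}" by auto
    ultimately show ?thesis by simp
  qed
  have IH: "real (card {S. S \<subseteq> ?W \<and> pair_type c s' t' S}) = npart (map (\<lambda>i. card {x\<in>A. c x = i}) cs) s' t'" for s' t'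
    using Cons by simp
  show ?case unfolding eq sum.distrib cnt of_nat_add of_nat_mult IH by (simp add: mult.commute)
qed

lemma coloring_with_sizes:
  "\<exists>c. (\<forall>v<sum_list xs. c v < length xs) \<and>
     (\<forall>i<length xs. card {v\<in>{0..<sum_list xs}. c v = i} = xs ! i)"
proof (induction xs rule: rev_induct)
  case Nil
  show ?case by simp
next
  case (snoc x xs)
  then obtain c where c: "\<forall>v<sum_list xs. c v < length xs"
    "\<forall>i<length xs. card {v\<in>{0..<sum_list xs}. c v = i} = xs ! i" by blast
  define c' where "c' v = (if v < sum_list xs then c v else length xs)" for v
  have F1: "{v\<in>{0..<sum_list (xs @ [x])}. c' v = i} = {v\<in>{0..<sum_list xs}. c v = i}" if "i < length xs" for i
    using that unfolding c'_def by auto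
  have F2: "{v\<in>{0..<sum_list (xs @ [x])}. c' v = length xs} = {sum_list xs..<sum_list xs + x}"
  proof -
    have E: "c' v = length xs \<longleftrightarrow> sum_list xs \<le> v" for v
      using c(1)[rule_format, of v] unfolding c'_def by (cases "v < sum_list xs") auto
    show ?thesis
    proof (rule set_eqI)
      fix v
      show "v \<in> {v\<in>{0..<sum_list (xs @ [x])}. c' v = length xs} \<longleftrightarrow> v \<in> {sum_list xs..<sum_list xs + x}"
        unfolding mem_Collect_eq E by auto
    qed
  qed
  have F3: "c' v < length (xs @ [x])" for v
    using c(1)[rule_format, of v] unfolding c'_def by (cases "v < sum_list xs") (simp_all add: less_SucI)
  show ?case
  proof (intro exI[of _ c'] conjI allI impI F3)
    fix i assume i: "i < length (xs @ [x])"
    show "card {v\<in>{0..<sum_list (xs @ [x])}. c' v = i} = (xs @ [x]) ! i"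
    proof (cases "i < length xs")
      case True
      then show ?thesis unfolding F1[OF True] using c(2) by (simp add: nth_append)
    next
      case False
      then have "i = length xs" using i by simp
      then show ?thesis using F2 by simp
    qed
  qed
qed

context multipartite_pattern
begin

definition n_twos :: nat where "n_twos = card {i. i < r \<and> a i = 2}"
definition n_ones :: nat where "n_ones = card {i. i < r \<and> a i = 1}"

lemma small_parts_counts:
  assumes small: "\<forall>i<r. a i \<le> 2"
  shows "n_twos + n_ones = r" "2 * n_twos + n_ones = k" "n_twos \<ge> 1"
proof -
  have cases: "a i = 1 \<or> a i = 2" if "i < r" for i using small a_pos[OF that] that
    by (metis One_nat_def Suc_1 le_SucE le_antisym)
  have U: "{..<r} = {i. i < r \<and> a i = 2} \<union> {i. i < r \<and> a i = 1}" using cases by auto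
  have "card {..<r} = n_twos + n_ones" unfolding n_twos_def n_ones_def
    by (subst U, subst card_Un_disjoint) auto
  then show "n_twos + n_ones = r" by simp
  have "(\<Sum>i<r. a i) = (\<Sum>i\<in>{i. i < r \<and> a i = 2}. a i) + (\<Sum>i\<in>{i. i < r \<and> a i = 1}. a i)"
    by (subst U, subst sum.union_disjoint) auto
  also have "\<dots> = 2 * n_twos + n_ones" unfolding n_twos_def n_ones_def by simp
  finally show "2 * n_twos + n_ones = k" using sum_a by simp
  obtain i where "i < r" "a i \<ge> 2" using part2 a_def by auto
  then have "i \<in> {i. i < r \<and> a i = 2}" using small by force
  then show "n_twos \<ge> 1" unfolding n_twos_def by (auto simp: Suc_le_eq card_gt_0_iff)
qed

text \<open>In a complete multipartite graph the colouring and the part labelling cut a copy into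
  the same blocks. With blocks of at most two vertices the shape is recorded by the numbers of pairs
  and of singletons.\<close>

lemma copy_cmp_iff_pair_type:
  assumes small: "\<forall>i<r. a i \<le> 2" and S: "S \<subseteq> {0..<n}"
  shows "copy (cmp_graph n c) S \<longleftrightarrow> pair_type c (int n_twos) (int n_ones) S"
proof
  assume "copy (cmp_graph n c) S"
  then obtain q where q: "finite S" "\<And>x. x \<in> S \<Longrightarrow> q x < r" "\<And>i. i < r \<Longrightarrow> card {x\<in>S. q x = i} = a i"
    and adj: "\<forall>x\<in>S. \<forall>y\<in>S. x \<noteq> y \<longrightarrow> ({x, y} \<in> cmp_graph n c \<longleftrightarrow> q x \<noteq> q y)"
    unfolding copy_def by blast
  have same: "c x = c y \<longleftrightarrow> q x = q y" if "x \<in> S" "y \<in> S" for x y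
  proof (cases "x = y")
    case False
    have "x < n" "y < n" using that S by auto
    then show ?thesis using adj that False unfolding cmp_graph_pair by blast
  qed simp
  \<comment> \<open>Sends a colour to the part containing it; by \<open>same\<close> the chosen
    representative is immaterial.\<close>
  define \<kappa> where "\<kappa> i = q (SOME x. x \<in> S \<and> c x = i)" for i
  have \<kappa>: "\<kappa> (c x) = q x" if "x \<in> S" for x
  proof -
    have "(SOME y. y \<in> S \<and> c y = c x) \<in> S \<and> c (SOME y. y \<in> S \<and> c y = c x) = c x"
      by (rule someI[of _ x]) (use that in simp)
    then show ?thesis unfolding \<kappa>_def using same that by blast
  qed
  have sizes: "card {x\<in>S. c x = i} = a (\<kappa> i)" if i: "i \<in> c ` S" for i
  proof -
    obtain x where x: "x \<in> S" "c x = i" using i by auto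
    have "{y\<in>S. c y = i} = {y\<in>S. q y = q x}" using same x by auto
    then show ?thesis using q(2,3) x \<kappa> by auto
  qed
  have bij: "bij_betw \<kappa> (c ` S) {..<r}"
    unfolding bij_betw_def
  proof
    show "inj_on \<kappa> (c ` S)" using \<kappa> same by (auto intro!: inj_onI)
    show "\<kappa> ` c ` S = {..<r}"
    proof
      show "\<kappa> ` c ` S \<subseteq> {..<r}" using \<kappa> q(2) by auto
      show "{..<r} \<subseteq> \<kappa> ` c ` S"
      proof
        fix i assume "i \<in> {..<r}"
        then have "card {x\<in>S. q x = i} \<ge> 1" using q(3) a_pos by simp
        then have "{x\<in>S. q x = i} \<noteq> {}" by force
        then show "i \<in> \<kappa> ` c ` S" using \<kappa> by force
      qed
    qed
  qed
  have cnt: "card {i\<in>c ` S. card {x\<in>S. c x = i} = m} = card {i. i < r \<and> a i = m}" for m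
  proof (rule bij_betw_same_card)
    show "bij_betw \<kappa> {i\<in>c ` S. card {x\<in>S. c x = i} = m} {i. i < r \<and> a i = m}"
      unfolding bij_betw_def
    proof
      show "inj_on \<kappa> {i\<in>c ` S. card {x\<in>S. c x = i} = m}"
        using bij unfolding bij_betw_def by (auto intro: inj_on_subset)
      have im: "\<kappa> ` (c ` S) = {..<r}" using bij by (simp add: bij_betw_def)
      show "\<kappa> ` {i\<in>c ` S. card {x\<in>S. c x = i} = m} = {i. i < r \<and> a i = m}"
      proof
        show "\<kappa> ` {i\<in>c ` S. card {x\<in>S. c x = i} = m} \<subseteq> {i. i < r \<and> a i = m}"
        proof
          fix j assume "j \<in> \<kappa> ` {i\<in>c ` S. card {x\<in>S. c x = i} = m}"
          then obtain i where i: "i \<in> c ` S" "card {x\<in>S. c x = i} = m" "j = \<kappa> i" by blast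
          then have "j \<in> {..<r}" using im by blast
          then show "j \<in> {i. i < r \<and> a i = m}" using sizes[OF i(1)] i by simp
        qed
        show "{i. i < r \<and> a i = m} \<subseteq> \<kappa> ` {i\<in>c ` S. card {x\<in>S. c x = i} = m}"
        proof
          fix j assume j: "j \<in> {i. i < r \<and> a i = m}"
          then have "j \<in> \<kappa> ` (c ` S)" using im by simp
          then obtain i where i: "i \<in> c ` S" "j = \<kappa> i" by blast
          then have "card {x\<in>S. c x = i} = m" using sizes[OF i(1)] j by simp
          then show "j \<in> \<kappa> ` {i\<in>c ` S. card {x\<in>S. c x = i} = m}" using i by blast
        qed
      qed
    qed
  qed
  have "\<kappa> i < r" if "i \<in> c ` S" for i using that \<kappa> q(2) by auto
  then have "\<forall>i\<in>c ` S. card {x\<in>S. c x = i} \<le> 2" using sizes small by simp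
  then show "pair_type c (int n_twos) (int n_ones) S"
    unfolding pair_type_def n_twos_def n_ones_def using cnt q(1) by simp
next
  assume "pair_type c (int n_twos) (int n_ones) S"
  then have fin: "finite S" and le2: "\<forall>i\<in>c ` S. card {x\<in>S. c x = i} \<le> 2"
    and c2: "card {i\<in>c ` S. card {x\<in>S. c x = i} = 2} = card {i. i < r \<and> a i = 2}"
    and c1: "card {i\<in>c ` S. card {x\<in>S. c x = i} = 1} = card {i. i < r \<and> a i = 1}"
    unfolding pair_type_def n_twos_def n_ones_def by simp_all
  let ?C = "\<lambda>m. {i\<in>c ` S. card {x\<in>S. c x = i} = m}"
  obtain h2 where h2: "bij_betw h2 (?C 2) {i. i < r \<and> a i = 2}"
    using finite_same_card_bij[OF _ _ c2] fin by auto
  obtain h1 where h1: "bij_betw h1 (?C 1) {i. i < r \<and> a i = 1}"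
    using finite_same_card_bij[OF _ _ c1] fin by auto
  define h where "h i = (if i \<in> ?C 2 then h2 i else h1 i)" for i
  have cover: "c ` S = ?C 2 \<union> ?C 1"
  proof -
    have "card {x\<in>S. c x = i} \<ge> 1" if "i \<in> c ` S" for i
    proof -
      have "{x\<in>S. c x = i} \<noteq> {}" using that by auto
      then show ?thesis using fin by (simp add: Suc_leI card_gt_0_iff)
    qed
    then show ?thesis using le2 by force
  qed
  have acases: "{..<r} = {i. i < r \<and> a i = 2} \<union> {i. i < r \<and> a i = 1}"
  proof -
    have "a i = 1 \<or> a i = 2" if "i < r" for i using small a_pos[OF that] that
      by (metis One_nat_def Suc_1 le_SucE le_antisym)
    then show ?thesis by auto
  qed
  have "bij_betw h (?C 2) {i. i < r \<and> a i = 2}"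
    using h2 by (subst bij_betw_cong[of _ _ h2]) (auto simp: h_def)
  moreover have "bij_betw h (?C 1) {i. i < r \<and> a i = 1}"
    using h1 by (subst bij_betw_cong[of _ _ h1]) (auto simp: h_def)
  ultimately have "bij_betw h (?C 2 \<union> ?C 1) ({i. i < r \<and> a i = 2} \<union> {i. i < r \<and> a i = 1})"
    by (rule bij_betw_combine) auto
  then have bij: "bij_betw h (c ` S) {..<r}" using cover acases by simp
  have hsize: "a (h i) = card {x\<in>S. c x = i}" if "i \<in> c ` S" for i
  proof (cases "i \<in> ?C 2")
    case True
    then show ?thesis using h2 unfolding h_def bij_betw_def by auto
  next
    case False
    then have "i \<in> ?C 1" using that cover by blast
    then show ?thesis using h1 False unfolding h_def bij_betw_def by auto
  qed
  have him: "h ` (c ` S) = {..<r}" and hinj: "inj_on h (c ` S)" using bij by (simp_all add: bij_betw_def)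
  have hc: "h (c x) = h (c y) \<longleftrightarrow> c x = c y" if "x \<in> S" "y \<in> S" for x y
    using inj_on_eq_iff[OF hinj] that by blast
  show "copy (cmp_graph n c) S" unfolding copy_def
  proof (intro conjI exI[of _ "\<lambda>x. h (c x)"] ballI allI impI)
    fix x assume "x \<in> S"
    then show "h (c x) < r" using him by blast
  next
    fix i assume "i < r"
    then have "i \<in> h ` (c ` S)" using him by simp
    then obtain y where y: "y \<in> S" "h (c y) = i" by blast
    have "{x\<in>S. h (c x) = i} = {x\<in>S. c x = c y}"
    proof (rule Collect_cong)
      show "x \<in> S \<and> h (c x) = i \<longleftrightarrow> x \<in> S \<and> c x = c y" for x
        using hc[OF _ y(1), of x] y(2) by (cases "x \<in> S") simp_all
    qed
    then show "card {x\<in>S. h (c x) = i} = a i" using hsize[of "c y"] y by simp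
  next
    fix x y assume xy: "x \<in> S" "y \<in> S" "x \<noteq> y"
    have "x < n" "y < n" using xy S by auto
    then show "({x, y} \<in> cmp_graph n c) = (h (c x) \<noteq> h (c y))"
      unfolding cmp_graph_pair hc[OF xy(1,2)] by blast
  qed (rule fin)
qed

text \<open>All lists of class sizes are realised by colourings, so \<open>maxind n\<close> can
  serve as the bound \<open>M\<close> in the merging lemmas.\<close>

lemma npart_le_maxind:
  assumes small: "\<forall>i<r. a i \<le> 2" and n: "sum_list xs = n"
  shows "npart xs (int n_twos) (int n_ones) \<le> maxind n"
proof -
  obtain c where c: "\<forall>v<n. c v < length xs" "\<forall>i<length xs. card {v\<in>{0..<n}. c v = i} = xs ! i"
    using coloring_with_sizes[of xs] n by blast
  have eq: "map (\<lambda>i. card {x\<in>{0..<n}. c x = i}) [0..<length xs] = xs"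
    using c(2) by (intro nth_equalityI) auto
  have V: "{x\<in>{0..<n}. c x \<in> set [0..<length xs]} = {0..<n}" using c(1) by auto
  have "npart xs (int n_twos) (int n_ones) = real (card {S. S \<subseteq> {0..<n} \<and> pair_type c (int n_twos) (int n_ones) S})"
    using card_pair_type[of "{0..<n}" "[0..<length xs]" c "int n_twos" "int n_ones"] unfolding eq V by simp
  also have "{S. S \<subseteq> {0..<n} \<and> pair_type c (int n_twos) (int n_ones) S} = copies n (cmp_graph n c)"
    unfolding copies_def using copy_cmp_iff_pair_type[OF small] by blast
  finally show ?thesis using ind_le_maxind[OF graph_on_cmp_graph, of n c] unfolding ind_def by simp
qed

end

section \<open>Graphs close to complete multipartite ones\<close>

lemma choose_ge_power:
  assumes "real m \<ge> y" "y \<ge> real k" "b \<le> k" "k > 0"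
  shows "real (m choose b) \<ge> (y / real k) ^ b"
proof (cases "b = 0")
  case False
  have "real b \<le> real m" using assms by linarith
  then have bm: "b \<le> m" by simp
  have "(y / real k) ^ b \<le> (real m / real b) ^ b"
    using assms False by (intro power_mono frac_le) auto
  also have "\<dots> \<le> real (m choose b)" using binomial_ge_n_over_k_pow_k[OF bm, where 'a = real] .
  finally show ?thesis .
qed simp

definition edge_deg :: "nat set set \<Rightarrow> nat \<Rightarrow> nat" where
  "edge_deg D u = card {e\<in>D. u \<in> e}"

lemma sum_edge_deg:
  assumes "\<And>e. e \<in> D \<Longrightarrow> e \<subseteq> {0..<n} \<and> card e = 2" "finite D"
  shows "(\<Sum>u<n. edge_deg D u) = 2 * card D"
proof -
  have "(\<Sum>u<n. edge_deg D u) = (\<Sum>e\<in>D. card {u\<in>{..<n}. u \<in> e})"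
    unfolding edge_deg_def by (rule sum_multicount_gen) (use assms in auto)
  also have "\<dots> = (\<Sum>e\<in>D. 2)"
  proof (rule sum.cong[OF refl])
    fix e assume "e \<in> D"
    then have "{u\<in>{..<n}. u \<in> e} = e" "card e = 2" using assms(1)[of e] by auto
    then show "card {u\<in>{..<n}. u \<in> e} = 2" by simp
  qed
  finally show ?thesis by simp
qed

text \<open>Markov's inequality for the number of wrong pairs at a vertex.\<close>

lemma few_atypical:
  assumes D: "\<And>e. e \<in> D \<Longrightarrow> e \<subseteq> {0..<n} \<and> card e = 2" "finite D"
    and card: "real (card D) \<le> \<mu> ^ 2 / 2 * real n ^ 2" and pos: "\<mu> > 0" "n > 0"
  shows "real (card {u. u < n \<and> real (edge_deg D u) > \<mu> * real n}) \<le> \<mu> * real n"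
proof -
  let ?B = "{u. u < n \<and> real (edge_deg D u) > \<mu> * real n}"
  have "real (card ?B) * (\<mu> * real n) = (\<Sum>u\<in>?B. \<mu> * real n)" by simp
  also have "\<dots> \<le> (\<Sum>u\<in>?B. real (edge_deg D u))" by (intro sum_mono) auto
  also have "\<dots> \<le> (\<Sum>u<n. real (edge_deg D u))" by (intro sum_mono2) auto
  also have "\<dots> = real (2 * card D)" using sum_edge_deg[of D n, OF D] by (simp only: of_nat_sum[symmetric])
  also have "\<dots> \<le> \<mu> ^ 2 * real n ^ 2" using card by simp
  finally have "real (card ?B) * (\<mu> * real n) \<le> (\<mu> * real n) * (\<mu> * real n)"
    by (simp add: power2_eq_square mult_ac)
  then show ?thesis using pos by simp
qed

definition nonnbrs :: "nat \<Rightarrow> nat set set \<Rightarrow> nat \<Rightarrow> nat set" where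
  "nonnbrs n G v = {w. w < n \<and> w \<noteq> v \<and> {v, w} \<notin> G}"

context multipartite_pattern
begin

lemma k_pos: "k > 0" using k_ge_3 by simp

lemma pieces_family:
  assumes J: "finite J" "disjoint_family_on A J" "\<And>j. j \<in> J \<Longrightarrow> A j \<subseteq> {0..<n}"
    "\<And>j. j \<in> J \<Longrightarrow> c j < r" "\<And>i. i < r \<Longrightarrow> (\<Sum>j\<in>{j\<in>J. c j = i}. b j) = a i"
    "\<And>j l x y. j \<in> J \<Longrightarrow> l \<in> J \<Longrightarrow> x \<in> A j \<Longrightarrow> y \<in> A l \<Longrightarrow> x \<noteq> y \<Longrightarrow> {x, y} \<in> G \<longleftrightarrow> c j \<noteq> c l"
  defines "\<F> \<equiv> {S. S \<subseteq> (\<Union>j\<in>J. A j) \<and> (\<forall>j\<in>J. card (S \<inter> A j) = b j)}"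
  shows "\<F> \<subseteq> copies n G" "card \<F> = (\<Prod>j\<in>J. card (A j) choose b j)"
proof -
  have fin: "finite (A j)" if "j \<in> J" for j using J(3)[OF that] finite_subset by blast
  show "card \<F> = (\<Prod>j\<in>J. card (A j) choose b j)"
    unfolding \<F>_def by (rule card_pieces[OF J(1,2) fin])
  show "\<F> \<subseteq> copies n G"
  proof
    fix S assume S: "S \<in> \<F>"
    then have S': "S \<subseteq> (\<Union>j\<in>J. A j)" "\<And>j. j \<in> J \<Longrightarrow> card (S \<inter> A j) = b j" unfolding \<F>_def by auto
    have "copy G S" by (rule pieces_copy[OF J(1,2) fin J(4-6) S'])
    moreover have "S \<subseteq> {0..<n}" using S'(1) J(3) by blast
    ultimately show "S \<in> copies n G" unfolding copies_def by blast
  qed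
qed

lemma a_le_k: "i < r \<Longrightarrow> a i \<le> k"
  using member_le_sum[of i "{..<r}" a] sum_a by auto

text \<open>Residues modulo \<open>r\<close> give \<open>r\<close> classes of at least n / (2 r)
  vertices, and one class for each part already yields positive density.\<close>

lemma maxind_lower: "\<exists>\<pi>>0. \<pi> \<le> 1 \<and> (\<exists>n0. \<forall>n\<ge>n0. maxind n \<ge> \<pi> * real n ^ k)"
proof -
  define \<pi> where "\<pi> = (1 / (2 * real r * real k)) ^ k"
  have rk: "real r \<ge> 2" "real k \<ge> 3" using r2 k_ge_3 by auto
  have "2 * real r * real k \<ge> 1" using mult_mono[of 1 "2 * real r" 1 "real k"] rk by simp
  then have \<pi>: "\<pi> > 0" "\<pi> \<le> 1" unfolding \<pi>_def using rk by (auto intro!: power_le_one)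
  have "maxind n \<ge> \<pi> * real n ^ k" if n: "n \<ge> 2 * r * k" for n
  proof -
    let ?A = "\<lambda>i. {v. v < n \<and> v mod r = i}"
    let ?G = "cmp_graph n (\<lambda>v. v mod r)"
    let ?F = "{S. S \<subseteq> (\<Union>j\<in>{0..<r}. ?A j) \<and> (\<forall>j\<in>{0..<r}. card (S \<inter> ?A j) = a j)}"
    have d: "disjoint_family_on ?A {0..<r}" unfolding disjoint_family_on_def by auto
    have sm: "(\<Sum>j\<in>{j \<in> {0..<r}. j = i}. a j) = a i" if i: "i < r" for i
    proof -
      have "{j \<in> {0..<r}. j = i} = {i}" using i by auto
      then show ?thesis by simp
    qed
    have "?F \<subseteq> copies n ?G" "card ?F = (\<Prod>j\<in>{0..<r}. card (?A j) choose a j)"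
      by (rule pieces_family[where c = "\<lambda>j. j" and G = ?G]; use d sm in \<open>auto simp: cmp_graph_pair\<close>)+
    then have le: "real (\<Prod>j\<in>{0..<r}. card (?A j) choose a j) \<le> ind n ?G"
      unfolding ind_def using card_mono[of "copies n ?G" ?F] by (simp only: of_nat_le_iff finite_copies)
    have big: "real (card (?A i)) \<ge> real n / (2 * real r)" if i: "i < r" for i
    proof -
      have "inj_on (\<lambda>t. t * r + i) {0..<n div r}" using r2 by (auto intro!: inj_onI)
      moreover have "(\<lambda>t. t * r + i) ` {0..<n div r} \<subseteq> ?A i"
      proof
        fix v assume "v \<in> (\<lambda>t. t * r + i) ` {0..<n div r}"
        then obtain t where t: "t < n div r" "v = t * r + i" by auto
        have "v < (t + 1) * r" using t(2) i by simp
        also have "\<dots> \<le> (n div r) * r" using t(1) by (intro mult_le_mono1) simp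
        also have "\<dots> \<le> n" by simp
        finally show "v \<in> ?A i" using t(2) i by simp
      qed
      ultimately have "card {0..<n div r} \<le> card (?A i)"
        by (intro card_inj_on_le[of "\<lambda>t. t * r + i"]) auto
      then have 1: "n div r \<le> card (?A i)" by simp
      have "n < (n div r + 1) * r" using r2 by (metis Suc_eq_plus1 div_less_iff_less_mult lessI zero_less_iff_neq_zero not_numeral_le_zero)
      then have "real n \<le> (real (n div r) + 1) * real r"
        by (metis less_imp_le of_nat_1 of_nat_add of_nat_le_iff of_nat_mult)
      then have "real n / real r \<le> real (n div r) + 1" using rk by (simp add: field_simps)
      moreover have "real n / (2 * real r) \<ge> 1"
      proof -
        have "2 * r \<le> n" using n k_pos by (metis One_nat_def Suc_leI le_trans mult_le_mono2 nat_mult_1_right)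
        then have "2 * real r \<le> real n" by (metis of_nat_le_iff of_nat_mult of_nat_numeral)
        then show ?thesis using rk by (simp add: field_simps)
      qed
      ultimately show ?thesis using 1 by (simp add: field_simps)
    qed
    have nk: "real n / (2 * real r) \<ge> real k"
    proof -
      have "real (2 * r * k) \<le> real n" using n by (simp only: of_nat_le_iff)
      then show ?thesis using rk by (simp add: field_simps)
    qed
    have "\<pi> * real n ^ k = (real n / (2 * real r) / real k) ^ (\<Sum>i<r. a i)"
      unfolding \<pi>_def sum_a by (simp add: power_divide power_mult_distrib)
    also have "\<dots> = (\<Prod>j\<in>{0..<r}. (real n / (2 * real r) / real k) ^ a j)"
      by (simp add: power_sum atLeast0LessThan)
    also have "\<dots> \<le> (\<Prod>j\<in>{0..<r}. real (card (?A j) choose a j))"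
      using big nk a_le_k k_pos by (intro prod_mono conjI choose_ge_power) auto
    also have "\<dots> \<le> ind n ?G" using le by simp
    finally show ?thesis using ind_le_maxind[OF graph_on_cmp_graph, of n "\<lambda>v. v mod r"] by linarith
  qed
  then show ?thesis using \<pi> by blast
qed

text \<open>One parameter measures everything. The square in the number of wrong pairs is what
  Markov's inequality turns into at most \<mu> n vertices with more than \<mu> n wrong pairs
  each.\<close>

definition close :: "nat \<Rightarrow> real \<Rightarrow> nat set set \<Rightarrow> (nat \<Rightarrow> nat) \<Rightarrow> bool" where
  "close n \<mu> G c \<longleftrightarrow> n > 0 \<and> \<mu> > 0 \<and> \<mu> \<le> 1 \<and> graph_on n G \<and>
     real (card (ediff G (cmp_graph n c))) \<le> \<mu> ^ 2 / 2 * real n ^ 2 \<and>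
     maxind n \<le> ind n G + \<mu> * real n ^ k \<and>
     (\<forall>u<n. \<forall>v<n. deg n G v - deg n G u \<le> 2 * \<mu> * (real n ^ k / real n))"

text \<open>Near-equality of degrees comes from cloning: turning \<open>u\<close> into a twin of
  \<open>v\<close> edits at most \<open>n\<close> pairs and so cannot gain more than c n ^ (k - 1)
  copies.\<close>

lemma stable_point_close:
  assumes st: "stable_point n c \<epsilon> G" and \<mu>: "0 < \<mu>" "\<mu> \<le> 1" and c: "0 < c" "c \<le> \<mu>"
    and \<epsilon>: "\<epsilon> \<le> \<mu> ^ 2 / 4" and n: "real n \<ge> 4 / \<mu> ^ 2"
  shows "\<exists>col. close n \<mu> G col"
proof -
  have npos: "real n > 0" using n \<mu> by (smt (verit) divide_pos_pos zero_less_power)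
  have G: "graph_on n G"
    and edit: "\<And>G'. graph_on n G' \<Longrightarrow> ind n G' \<le> ind n G + c * (real n ^ k / real n ^ 2) * real (card (ediff G G'))"
    and dist: "real (cmp_dist n G) \<le> \<epsilon> * real n ^ 2 + real n"
    and near: "maxind n \<le> ind n G + c * \<epsilon> * real n ^ k" using st unfolding stable_point_def by auto
  have n1: "real n \<le> \<mu> ^ 2 / 4 * real n ^ 2"
  proof -
    have "4 \<le> real n * \<mu> ^ 2" using n \<mu> by (simp add: field_simps)
    then have "4 * real n \<le> real n * \<mu> ^ 2 * real n" using npos by (intro mult_right_mono) auto
    then show ?thesis by (simp add: power2_eq_square mult_ac)
  qed
  have n2: "1 \<le> \<mu> * real n"
  proof -
    have "4 \<le> real n * \<mu> ^ 2" using n \<mu> by (simp add: field_simps)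
    also have "\<mu> ^ 2 \<le> \<mu>" using \<mu> by (simp add: power2_eq_square mult_left_le)
    then have "real n * \<mu> ^ 2 \<le> real n * \<mu>" using npos by (intro mult_left_mono) auto
    finally show ?thesis by (simp add: mult.commute)
  qed
  obtain col where col: "card (ediff G (cmp_graph n col)) = cmp_dist n G" using cmp_dist_attained by blast
  have "\<epsilon> * real n ^ 2 \<le> \<mu> ^ 2 / 4 * real n ^ 2" using \<epsilon> by (intro mult_right_mono) auto
  then have "real (card (ediff G (cmp_graph n col))) \<le> \<mu> ^ 2 / 2 * real n ^ 2"
    using dist n1 unfolding col by simp
  moreover have "maxind n \<le> ind n G + \<mu> * real n ^ k"
  proof -
    have "\<mu> ^ 2 / 4 \<le> 1" using \<mu> power_le_one[of \<mu> 2] by simp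
    then have "c * \<epsilon> \<le> c * 1" using \<epsilon> c by (intro mult_left_mono) auto
    then have "c * \<epsilon> \<le> \<mu>" using c by linarith
    then have "c * \<epsilon> * real n ^ k \<le> \<mu> * real n ^ k" by (intro mult_right_mono) auto
    then show ?thesis using near by linarith
  qed
  moreover have "deg n G v - deg n G u \<le> 2 * \<mu> * (real n ^ k / real n)" if uv: "u < n" "v < n" for u v
  proof (cases "u = v")
    case False
    let ?N = "real n ^ k / real n ^ 2"
    have "ind n G + deg n G v - deg n G u - ?N \<le> ind n (clone n G {u} v)"
      by (rule clone_gain_adjacent[OF G uv False])
    also have "\<dots> \<le> ind n G + c * ?N * real (card (ediff G (clone n G {u} v)))"
      by (rule edit[OF graph_on_clone])
    also have "\<dots> \<le> ind n G + \<mu> * ?N * real n"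
      using card_clone_diff_le[OF G, of u v] c \<mu> by (intro add_left_mono mult_mono) auto
    finally have "deg n G v - deg n G u \<le> ?N + \<mu> * ?N * real n" by simp
    moreover have "?N \<le> \<mu> * ?N * real n" using mult_right_mono[OF n2, of ?N] by (simp add: mult_ac)
    moreover have "\<mu> * ?N * real n + \<mu> * ?N * real n = 2 * \<mu> * (real n ^ k / real n)"
      using npos by (simp add: power2_eq_square)
    ultimately show ?thesis by linarith
  qed (use \<mu> in simp)
  ultimately show ?thesis unfolding close_def using G \<mu> npos by (intro exI[of _ col]) auto
qed

lemma ediff_edges:
  assumes "graph_on n G" "graph_on n G'"
  shows "\<And>e. e \<in> ediff G G' \<Longrightarrow> e \<subseteq> {0..<n} \<and> card e = 2" "finite (ediff G G')"
  using card_edge_ediff[OF assms] graph_on_finite[OF assms(1)] graph_on_finite[OF assms(2)]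
  unfolding ediff_def by blast+

text \<open>The average degree is \<open>k * ind n G / n\<close>, and no two degrees differ
  much.\<close>

lemma close_deg_ge:
  assumes "close n \<mu> G c" "maxind n \<ge> \<pi> * real n ^ k" "\<mu> \<le> \<pi> / 6" "v < n"
  shows "deg n G v \<ge> \<pi> / 2 * (real n ^ k / real n)"
proof -
  have n: "n > 0" and nr: "maxind n \<le> ind n G + \<mu> * real n ^ k"
    and dd: "\<And>u v. u < n \<Longrightarrow> v < n \<Longrightarrow> deg n G v - deg n G u \<le> 2 * \<mu> * (real n ^ k / real n)"
    using assms(1) unfolding close_def by auto
  have "real k * ind n G \<le> (\<Sum>u<n. deg n G v + 2 * \<mu> * (real n ^ k / real n))"
    unfolding sum_deg[symmetric] using dd[OF assms(4)] by (intro sum_mono) (simp add: algebra_simps)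
  also have "\<dots> = real n * deg n G v + 2 * \<mu> * real n ^ k" using n by (simp add: field_simps)
  finally have "real k * ind n G \<le> real n * deg n G v + 2 * \<mu> * real n ^ k" .
  moreover have "ind n G \<le> real k * ind n G" using k_ge_3 mult_right_mono[of 1 "real k" "ind n G"] by (simp add: ind_def)
  ultimately have "(\<pi> - 3 * \<mu>) * real n ^ k \<le> real n * deg n G v" using nr assms(2) by (simp add: algebra_simps)
  moreover have "\<pi> / 2 * real n ^ k \<le> (\<pi> - 3 * \<mu>) * real n ^ k" using assms(3) by (intro mult_right_mono) auto
  ultimately have "\<pi> / 2 * real n ^ k \<le> real n * deg n G v" by linarith
  then have "\<pi> / 2 * real n ^ k / real n \<le> deg n G v" using n by (simp add: divide_le_eq mult.commute)
  then show ?thesis by simp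
qed

lemma card_deg_nonnbrs:
  assumes "graph_on n G" "n > 0"
  shows "real (card {S \<in> copies n G. v \<in> S \<and> S \<inter> nonnbrs n G v \<noteq> {}}) \<le>
    real (card (nonnbrs n G v)) * (real n ^ k / real n ^ 2)"
proof -
  let ?N = "nonnbrs n G v"
  let ?F = "\<lambda>w. {S \<in> copies n G. {v, w} \<subseteq> S}"
  have fin: "finite ?N" unfolding nonnbrs_def by simp
  have "{S \<in> copies n G. v \<in> S \<and> S \<inter> ?N \<noteq> {}} \<subseteq> (\<Union>w\<in>?N. ?F w)" by blast
  then have "card {S \<in> copies n G. v \<in> S \<and> S \<inter> ?N \<noteq> {}} \<le> card (\<Union>w\<in>?N. ?F w)"
    using fin by (intro card_mono) auto
  also have "\<dots> \<le> (\<Sum>w\<in>?N. card (?F w))" by (rule card_UN_le[OF fin])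
  finally have "real (card {S \<in> copies n G. v \<in> S \<and> S \<inter> ?N \<noteq> {}}) \<le> (\<Sum>w\<in>?N. real (card (?F w)))"
    by (simp only: of_nat_sum[symmetric] of_nat_le_iff)
  also have "\<dots> \<le> (\<Sum>w\<in>?N. real n ^ k / real n ^ 2)"
  proof (rule sum_mono)
    fix w assume "w \<in> ?N"
    then have c2: "card {v, w} = 2" unfolding nonnbrs_def by simp
    have "real (card (?F w)) \<le> real n ^ k / real n ^ card {v, w}"
      by (rule card_supersets_le) (use assms in \<open>auto dest: copiesD\<close>)
    then show "real (card (?F w)) \<le> real n ^ k / real n ^ 2" unfolding c2 .
  qed
  finally show ?thesis by simp
qed

lemma copy_has_nonnbr:
  assumes "copy G S" "S \<subseteq> {0..<n}" "v \<in> S" "\<forall>i<r. a i \<ge> 2"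
  shows "S \<inter> nonnbrs n G v \<noteq> {}"
proof -
  obtain q where q: "finite S" "\<forall>x\<in>S. q x < r" "\<forall>i<r. card {x\<in>S. q x = i} = a i"
    and adj: "\<forall>x\<in>S. \<forall>y\<in>S. x \<noteq> y \<longrightarrow> ({x, y} \<in> G \<longleftrightarrow> q x \<noteq> q y)"
    using assms(1) unfolding copy_def by blast
  have "card {x\<in>S. q x = q v} \<ge> 2" using q assms(3,4) by simp
  then have "\<not> {x\<in>S. q x = q v} \<subseteq> {v}" using card_mono[of "{v}" "{x\<in>S. q x = q v}"] by auto
  then obtain w where "w \<in> S" "q w = q v" "w \<noteq> v" by blast
  then have "w \<in> nonnbrs n G v" unfolding nonnbrs_def using adj assms(2,3) by auto
  then show ?thesis using \<open>w \<in> S\<close> by blast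
qed

end

section \<open>No vertex is adjacent to almost all others\<close>

lemma pair_type_cong:
  assumes "\<And>x. x \<in> T \<Longrightarrow> c x = c' x"
  shows "pair_type c s t T \<longleftrightarrow> pair_type c' s t T"
proof -
  have "c ` T = c' ` T" using assms by (rule image_cong[OF refl])
  moreover have "{x\<in>T. c x = i} = {x\<in>T. c' x = i}" for i
    by (rule Collect_cong) (use assms in \<open>auto\<close>)
  ultimately show ?thesis unfolding pair_type_def by simp
qed

lemma sum_class_sizes:
  assumes "finite A" shows "(\<Sum>j\<in>c ` A. card {x\<in>A. c x = j}) = card A"
  using sum.image_gen[OF assms, of "\<lambda>_. 1::nat" c] by simp

context multipartite_pattern
begin

text \<open>Besides the copies using a non-neighbour of \<open>v\<close> or a wrong pair off
  \<open>v\<close>, which give the first two terms, only copies remain in which \<open>v\<close> is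
  joined to all the rest. There \<open>v\<close> is a part of size one, and the rest can be read off
  from the colouring.\<close>

lemma deg_le_full:
  assumes small: "\<forall>i<r. a i \<le> 2" and G: "graph_on n G" and n: "n > 0" and v: "v < n"
  shows "deg n G v \<le> real (card (nonnbrs n G v)) * (real n ^ k / real n ^ 2)
     + real (card (ediff G (cmp_graph n c))) * (real n ^ k / real n ^ 3)
     + real (card {T. T \<subseteq> {0..<n} \<and> pair_type c (int n_twos) (int n_ones - 1) T})"
proof -
  let ?D = "ediff G (cmp_graph n c)" and ?N = "nonnbrs n G v"
  let ?T = "{T. T \<subseteq> {0..<n} \<and> pair_type c (int n_twos) (int n_ones - 1) T}"
  let ?A1 = "{S \<in> copies n G. v \<in> S \<and> S \<inter> ?N \<noteq> {}}"
  let ?F = "\<lambda>e. {S \<in> copies n G. insert v e \<subseteq> S}"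
  let ?D' = "{e\<in>?D. v \<notin> e}"
  let ?A3 = "{S \<in> copies n G. v \<in> S \<and> S \<inter> ?N = {} \<and> (\<forall>e\<in>?D'. \<not> e \<subseteq> S)}"
  note D = ediff_edges[OF G graph_on_cmp_graph]
  have finD': "finite ?D'" using D(2) by simp
  have "{S \<in> copies n G. v \<in> S} \<subseteq> ?A1 \<union> (\<Union>e\<in>?D'. ?F e) \<union> ?A3" by blast
  then have "card {S \<in> copies n G. v \<in> S} \<le> card (?A1 \<union> (\<Union>e\<in>?D'. ?F e) \<union> ?A3)"
    using finD' by (intro card_mono) auto
  also have "\<dots> \<le> card ?A1 + (\<Sum>e\<in>?D'. card (?F e)) + card ?A3"
    using card_Un_le[of "?A1 \<union> (\<Union>e\<in>?D'. ?F e)" ?A3] card_Un_le[of ?A1 "\<Union>e\<in>?D'. ?F e"]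
      card_UN_le[OF finD', of ?F] by linarith
  finally have 1: "deg n G v \<le> real (card ?A1) + (\<Sum>e\<in>?D'. real (card (?F e))) + real (card ?A3)"
    unfolding deg_def by (simp only: of_nat_sum[symmetric] of_nat_add[symmetric] of_nat_le_iff)
  have 2: "(\<Sum>e\<in>?D'. real (card (?F e))) \<le> (\<Sum>e\<in>?D'. real n ^ k / real n ^ 3)"
  proof (rule sum_mono)
    fix e assume e: "e \<in> ?D'"
    then have c3: "card (insert v e) = 3" and fe: "finite e"
      using D(1)[of e] finite_subset[of e "{0..<n}"] by (auto simp: card_insert_if)
    have "real (card (?F e)) \<le> real n ^ k / real n ^ card (insert v e)"
      by (rule card_supersets_le) (use n fe in \<open>auto dest: copiesD\<close>)
    then show "real (card (?F e)) \<le> real n ^ k / real n ^ 3" unfolding c3 .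
  qed
  have "(\<Sum>e\<in>?D'. real n ^ k / real n ^ 3) \<le> (\<Sum>e\<in>?D. real n ^ k / real n ^ 3)"
    using D(2) by (intro sum_mono2) auto
  then have 2: "(\<Sum>e\<in>?D'. real (card (?F e))) \<le> real (card ?D) * (real n ^ k / real n ^ 3)" using 2 by simp
  have "card ?A3 \<le> card ?T"
  proof (rule card_inj_on_le[of "\<lambda>S. S - {v}"])
    show "inj_on (\<lambda>S. S - {v}) ?A3"
      by (rule inj_on_inverseI[of _ "\<lambda>T. insert v T"]) auto
    show "finite ?T" by (rule finite_subset[of _ "Pow {0..<n}"]) auto
    show "(\<lambda>S. S - {v}) ` ?A3 \<subseteq> ?T"
    proof
      fix T assume "T \<in> (\<lambda>S. S - {v}) ` ?A3"
      then obtain S where S: "S \<in> copies n G" "v \<in> S" "S \<inter> ?N = {}" "\<forall>e\<in>?D'. \<not> e \<subseteq> S" "T = S - {v}"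
        by blast
      note SD = copiesD[OF S(1)]
      \<comment> \<open>A fresh colour for \<open>v\<close> makes the coloured graph agree with
        \<open>G\<close> on all of \<open>S\<close>.\<close>
      obtain f where f: "f \<notin> c ` S" using SD ex_new_if_finite[of "c ` S"] by auto
      define c' where "c' = c(v := f)"
      have "copy (cmp_graph n c') S"
      proof (subst copy_cong[of S _ G])
        fix x y assume xy: "x \<in> S" "y \<in> S" "x \<noteq> y"
        then have lt: "x < n" "y < n" using SD by auto
        have adjv: "{v, z} \<in> G" if "z \<in> S" "z \<noteq> v" for z
        proof -
          have "z \<notin> ?N" "z < n" using that(1) S(3) SD by auto
          then show ?thesis using that(2) unfolding nonnbrs_def by blast
        qed
        have fc: "f \<noteq> c z" if "z \<in> S" for z using f that by blast
        show "({x, y} \<in> cmp_graph n c') = ({x, y} \<in> G)"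
        proof (cases "x = v \<or> y = v")
          case True
          then have "{x, y} \<in> G" using adjv[OF xy(1)] adjv[OF xy(2)] xy(3) by (auto simp: insert_commute)
          moreover have "c' x \<noteq> c' y" unfolding c'_def using True xy fc[OF xy(1)] fc[OF xy(2)] by auto
          ultimately show ?thesis unfolding cmp_graph_pair using lt by blast
        next
          case False
          then have "{x, y} \<notin> ?D" using S(4) xy by auto
          then have "{x, y} \<in> G \<longleftrightarrow> {x, y} \<in> cmp_graph n c" unfolding ediff_def by blast
          moreover have "c' x = c x" "c' y = c y" unfolding c'_def using False by auto
          ultimately show ?thesis unfolding cmp_graph_pair by simp
        qed
      qed (use SD in simp)
      then have "pair_type c' (int n_twos) (int n_ones) S" using copy_cmp_iff_pair_type[OF small] SD by blast
      moreover have "S = T \<union> {v}" using S(2,5) by blast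
      moreover have "pair_type c' (int n_twos) (int n_ones) (T \<union> {v}) \<longleftrightarrow>
        card {v} = 1 \<and> pair_type c' (int n_twos) (int n_ones - 1) T \<or> card {v} = 2 \<and> pair_type c' (int n_twos - 1) (int n_ones) T"
      proof (rule pair_type_Un[where i = f])
        show "finite T" using S(5) SD by simp
        show "c' x \<noteq> f" if "x \<in> T" for x using that S(5) f unfolding c'_def by auto
      qed (auto simp: c'_def)
      ultimately have "pair_type c' (int n_twos) (int n_ones - 1) T" by simp
      then have "pair_type c (int n_twos) (int n_ones - 1) T"
        by (subst pair_type_cong[of T c c']) (auto simp: c'_def S(5))
      then show "T \<in> ?T" using S(5) SD by auto
    qed
  qed
  then show ?thesis using 1 2 card_deg_nonnbrs[OF G n, of v] by linarith
qed

lemma copies_cmp_eq: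
  assumes small: "\<forall>i<r. a i \<le> 2"
  shows "copies n (cmp_graph n c) = {S. S \<subseteq> {0..<n} \<and> pair_type c (int n_twos) (int n_ones) S}"
  unfolding copies_def using copy_cmp_iff_pair_type[OF small] by blast

text \<open>Without parts of size one each copy through \<open>v\<close> uses a non-neighbour of
  \<open>v\<close>, so the lower bound on the degree is a lower bound on their number.\<close>

lemma nonnbrs_large_parts:
  assumes cl: "close n \<mu> G c" and \<pi>: "maxind n \<ge> \<pi> * real n ^ k" "\<mu> \<le> \<pi> / 6" and v: "v < n"
    and big: "\<forall>i<r. a i \<ge> 2"
  shows "real (card (nonnbrs n G v)) \<ge> \<pi> / 2 * real n"
proof -
  have G: "graph_on n G" and n: "n > 0" using cl unfolding close_def by auto
  have "{S \<in> copies n G. v \<in> S} = {S \<in> copies n G. v \<in> S \<and> S \<inter> nonnbrs n G v \<noteq> {}}"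
    using copy_has_nonnbr[OF _ _ _ big] copiesD by blast
  then have "deg n G v \<le> real (card (nonnbrs n G v)) * (real n ^ k / real n ^ 2)"
    unfolding deg_def using card_deg_nonnbrs[OF G n, of v] by simp
  then have "\<pi> / 2 * (real n ^ k / real n) \<le> real (card (nonnbrs n G v)) * (real n ^ k / real n ^ 2)"
    using close_deg_ge[OF cl \<pi> v] by linarith
  also have "\<dots> = real (card (nonnbrs n G v)) / real n * (real n ^ k / real n)"
    by (simp add: power2_eq_square)
  finally have "\<pi> / 2 * (real n ^ k / real n) \<le> real (card (nonnbrs n G v)) / real n * (real n ^ k / real n)" .
  moreover have "real n ^ k / real n > 0" using n by simp
  ultimately have "\<pi> / 2 \<le> real (card (nonnbrs n G v)) / real n" by (simp only: mult_le_cancel_right_pos)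
  then show ?thesis using n by (simp add: field_simps)
qed

text \<open>An almost universal vertex has about \<open>npart (x # R) s (t - 1)\<close> copies, and
  its degree nearly equals that of a vertex in the largest class. This is the hypothesis
  \<open>cheap\<close> of \<open>split_cost\<close>, whose conclusion contradicts the
  near-optimality of the coloured graph.\<close>

lemma nonnbrs_small_parts:
  assumes cl: "close n \<mu> G c" and \<pi>: "maxind n \<ge> \<pi> * real n ^ k" "0 < \<pi>" "\<pi> \<le> 1"
    and small: "\<forall>i<r. a i \<le> 2"
  defines "\<kappa> \<equiv> \<pi> / (200 * exp (512 / (\<pi> / 2)))"
  assumes \<mu>: "\<mu> \<le> \<pi> / 6" "\<mu> \<le> \<kappa> / 20" and n: "\<pi> / 2 * real n \<ge> 12" "\<kappa> * real n \<ge> 3" and v: "v < n"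
  shows "real (card (nonnbrs n G v)) \<ge> \<kappa> / 4 * real n"
proof (rule ccontr)
  assume neg: "\<not> ?thesis"
  let ?H = "cmp_graph n c" let ?D = "ediff G ?H"
  define K1 where "K1 = real n ^ k / real n"
  have G: "graph_on n G" and n0: "n > 0" and \<mu>0: "0 < \<mu>" "\<mu> \<le> 1"
    and cardD: "real (card ?D) \<le> \<mu> ^ 2 / 2 * real n ^ 2"
    and near: "maxind n \<le> ind n G + \<mu> * real n ^ k"
    and dd: "\<And>u v. u < n \<Longrightarrow> v < n \<Longrightarrow> deg n G v - deg n G u \<le> 2 * \<mu> * K1"
    using cl unfolding close_def K1_def by auto
  note D = ediff_edges[OF G graph_on_cmp_graph]
  have K1: "K1 > 0" unfolding K1_def using n0 by simp
  have nK: "real n ^ k / real n ^ 2 = K1 / real n" "real n ^ k / real n ^ 3 = K1 / real n ^ 2"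
    "real n ^ k = K1 * real n"
    unfolding K1_def using n0 by (simp_all add: power2_eq_square power3_eq_cube)
  have \<mu>2: "\<mu> ^ 2 / 2 \<le> \<mu> / 2" using \<mu>0 by (simp add: power2_eq_square mult_left_le)
  have cardD': "real (card ?D) \<le> \<mu> / 2 * real n ^ 2"
    using cardD mult_right_mono[OF \<mu>2, of "real n ^ 2"] by simp
  have D2: "real (card ?D) * (K1 / real n) \<le> \<mu> / 2 * real n ^ k"
  proof -
    have "real (card ?D) * (K1 / real n) \<le> \<mu> / 2 * real n ^ 2 * (K1 / real n)"
      using cardD' K1 by (intro mult_right_mono) auto
    then show ?thesis using n0 by (simp add: nK(3) power2_eq_square mult_ac)
  qed
  have D3: "real (card ?D) * (K1 / real n ^ 2) \<le> \<mu> / 2 * K1"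
  proof -
    have "real (card ?D) * (K1 / real n ^ 2) \<le> \<mu> / 2 * real n ^ 2 * (K1 / real n ^ 2)"
      using cardD' K1 by (intro mult_right_mono) auto
    then show ?thesis using n0 by simp
  qed
  have indH: "ind n ?H \<ge> maxind n - 2 * \<mu> * real n ^ k"
  proof -
    have "ind n G \<le> ind n ?H + real (card ?D) * (K1 / real n)"
      using ind_edit[OF G graph_on_cmp_graph n0] unfolding nK(1) .
    moreover have "0 < \<mu> * real n ^ k" using \<mu>0 n0 by simp
    ultimately show ?thesis using near D2 by linarith
  qed
  define sz where "sz j = card {x\<in>{0..<n}. c x = j}" for j
  let ?I = "c ` {0..<n}"
  have I: "finite ?I" "?I \<noteq> {}" using n0 by auto
  have "Max (sz ` ?I) \<in> sz ` ?I" using I by (intro Max_in) auto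
  then obtain i where i: "i \<in> ?I" "sz i = Max (sz ` ?I)" by (metis imageE)
  have imax: "sz j \<le> sz i" if "j \<in> ?I" for j unfolding i(2) using I that by simp
  define js where "js = sorted_list_of_set (?I - {i})"
  have js: "set js = ?I - {i}" "distinct js" unfolding js_def using I by auto
  define R where "R = map sz js"
  define x where "x = sz i"
  have cs: "distinct (i # js)" "set (i # js) = ?I" using js i(1) by auto
  have sumx: "x + sum_list R = n"
  proof -
    have "x + sum_list R = sum_list (map sz (i # js))" unfolding x_def R_def by simp
    also have "\<dots> = (\<Sum>j\<in>?I. sz j)" using sum_list_distinct_conv_sum_set[OF cs(1), of sz] cs(2) by simp
    also have "\<dots> = n" unfolding sz_def using sum_class_sizes[of "{0..<n}" c] by simp
    finally show ?thesis .
  qed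
  have Rx: "y \<le> x" if "y \<in> set R" for y using that imax js(1) unfolding R_def x_def by auto
  have V: "{x\<in>{0..<n}. c x \<in> set (i # js)} = {0..<n}" unfolding cs(2) by auto
  have np: "real (card {S. S \<subseteq> {0..<n} \<and> pair_type c s t S}) = npart (x # R) s t" for s t
    using card_pair_type[of "{0..<n}" "i # js" c s t] cs(1) unfolding V x_def R_def sz_def by simp
  have indN: "ind n ?H = npart (x # R) (int n_twos) (int n_ones)"
    unfolding ind_def copies_cmp_eq[OF small] by (rule np)
  \<comment> \<open>Each copy contains a non-adjacent pair, so there are at most x n ^ (k - 1)
    copies.\<close>
  have xbig: "\<pi> / 2 * real n \<le> real x"
  proof -
    have nb: "real (card (nonnbrs n ?H u)) \<le> real x" if "u < n" for u
    proof -
      have "nonnbrs n ?H u \<subseteq> {w\<in>{0..<n}. c w = c u}"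
        unfolding nonnbrs_def cmp_graph_pair using that by auto
      then have "card (nonnbrs n ?H u) \<le> sz (c u)" unfolding sz_def by (intro card_mono) auto
      also have "\<dots> \<le> x" unfolding x_def using imax that by simp
      finally show ?thesis by simp
    qed
    have "copies n ?H \<subseteq> (\<Union>u\<in>{..<n}. {S \<in> copies n ?H. u \<in> S \<and> S \<inter> nonnbrs n ?H u \<noteq> {}})"
    proof
      fix S assume S: "S \<in> copies n ?H"
      then obtain x y where xy: "x \<in> S" "y \<in> S" "x \<noteq> y" "{x, y} \<notin> ?H" using copiesD copy_nonadj by metis
      then have "x < n" "y < n" using copiesD[OF S] by auto
      then show "S \<in> (\<Union>u\<in>{..<n}. {S \<in> copies n ?H. u \<in> S \<and> S \<inter> nonnbrs n ?H u \<noteq> {}})"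
        using S xy unfolding nonnbrs_def by auto
    qed
    then have "card (copies n ?H) \<le> card (\<Union>u\<in>{..<n}. {S \<in> copies n ?H. u \<in> S \<and> S \<inter> nonnbrs n ?H u \<noteq> {}})"
      by (intro card_mono) auto
    also have "\<dots> \<le> (\<Sum>u<n. card {S \<in> copies n ?H. u \<in> S \<and> S \<inter> nonnbrs n ?H u \<noteq> {}})"
      by (rule card_UN_le) simp
    finally have "ind n ?H \<le> (\<Sum>u<n. real (card {S \<in> copies n ?H. u \<in> S \<and> S \<inter> nonnbrs n ?H u \<noteq> {}}))"
      unfolding ind_def by (simp only: of_nat_sum[symmetric] of_nat_le_iff)
    also have "\<dots> \<le> (\<Sum>u<n. real x * (K1 / real n))"
    proof (rule sum_mono)
      fix u assume "u \<in> {..<n}"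
      then have "real (card (nonnbrs n ?H u)) * (K1 / real n) \<le> real x * (K1 / real n)"
        using nb[of u] K1 by (intro mult_right_mono) auto
      then show "real (card {S \<in> copies n ?H. u \<in> S \<and> S \<inter> nonnbrs n ?H u \<noteq> {}}) \<le> real x * (K1 / real n)"
        using card_deg_nonnbrs[OF graph_on_cmp_graph n0, of c u] unfolding nK(1) by linarith
    qed
    also have "\<dots> = real x * K1" using n0 by simp
    finally have 1: "ind n ?H \<le> real x * K1" .
    have "(\<pi> - 2 * \<mu>) * real n ^ k \<le> real x * K1" using 1 indH \<pi>(1) by (simp add: algebra_simps)
    moreover have "\<pi> / 2 * real n ^ k \<le> (\<pi> - 2 * \<mu>) * real n ^ k"
      using \<mu> \<mu>0 by (intro mult_right_mono) auto
    ultimately have "\<pi> / 2 * real n ^ k \<le> real x * K1" by linarith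
    then have "(\<pi> / 2 * real n) * K1 \<le> real x * K1" unfolding nK(3) by (simp add: mult_ac)
    then show ?thesis using K1 by simp
  qed
  have \<kappa>: "\<kappa> > 0" unfolding \<kappa>_def using \<pi> by simp
  \<comment> \<open>The largest class is too big to consist of atypical vertices only.\<close>
  obtain u where u: "u < n" "c u = i" "real (edge_deg ?D u) \<le> \<mu> * real n"
  proof -
    let ?B = "{u. u < n \<and> real (edge_deg ?D u) > \<mu> * real n}"
    have "real (card ?B) \<le> \<mu> * real n" by (rule few_atypical[OF D cardD \<mu>0(1) n0])
    also have "\<dots> < \<pi> / 2 * real n" using \<mu> \<mu>0 \<pi> n0 by simp
    also have "\<dots> \<le> real (card {y\<in>{0..<n}. c y = i})" using xbig unfolding x_def sz_def .
    finally have "card ?B < card {y\<in>{0..<n}. c y = i}" by simp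
    then have "\<not> {y\<in>{0..<n}. c y = i} \<subseteq> ?B" using card_mono[of ?B "{y\<in>{0..<n}. c y = i}"] by auto
    then show ?thesis using that by force
  qed
  \<comment> \<open>The copies avoiding \<open>u\<close> are those of the colouring with
    \<open>u\<close> deleted, where the largest class has lost one vertex.\<close>
  have degu: "deg n ?H u = npart (x # R) (int n_twos) (int n_ones) - npart ((x - 1) # R) (int n_twos) (int n_ones)"
  proof -
    let ?A = "{0..<n} - {u}"
    have "card {y\<in>?A. c y = i} = x - 1"
    proof -
      have "{y\<in>?A. c y = i} = {y\<in>{0..<n}. c y = i} - {u}" by auto
      then show ?thesis unfolding x_def sz_def using u by (simp add: card_Diff_singleton)
    qed
    moreover have "map (\<lambda>j. card {y\<in>?A. c y = j}) js = R"
      unfolding R_def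
    proof (rule map_cong[OF refl])
      fix j assume "j \<in> set js"
      then have "j \<noteq> c u" using js(1) u(2) by blast
      then have "{y\<in>?A. c y = j} = {y\<in>{0..<n}. c y = j}" by blast
      then show "card {y\<in>?A. c y = j} = sz j" unfolding sz_def by simp
    qed
    moreover have "{y\<in>?A. c y \<in> set (i # js)} = ?A" unfolding cs(2) by auto
    ultimately have 1: "real (card {S. S \<subseteq> ?A \<and> pair_type c (int n_twos) (int n_ones) S}) =
       npart ((x - 1) # R) (int n_twos) (int n_ones)"
      using card_pair_type[of ?A "i # js" c "int n_twos" "int n_ones"] cs(1) by simp
    have sub: "{S. S \<subseteq> ?A \<and> pair_type c (int n_twos) (int n_ones) S} = {S \<in> copies n ?H. u \<notin> S}"
      unfolding copies_cmp_eq[OF small] by auto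
    have "copies n ?H = {S \<in> copies n ?H. u \<in> S} \<union> {S \<in> copies n ?H. u \<notin> S}" by blast
    moreover have "{S \<in> copies n ?H. u \<in> S} \<inter> {S \<in> copies n ?H. u \<notin> S} = {}" by blast
    ultimately have "card (copies n ?H) = card {S \<in> copies n ?H. u \<in> S} + card {S \<in> copies n ?H. u \<notin> S}"
      using card_Un_disjoint[of "{S \<in> copies n ?H. u \<in> S}" "{S \<in> copies n ?H. u \<notin> S}"] by simp
    then have "ind n ?H = deg n ?H u + real (card {S \<in> copies n ?H. u \<notin> S})" unfolding ind_def deg_def by simp
    then show ?thesis using indN 1 unfolding sub by simp
  qed
  have h1: "deg n ?H u \<le> deg n G u + real (edge_deg ?D u) * (K1 / real n) + real (card ?D) * (K1 / real n ^ 2)"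
    using deg_edit[OF graph_on_cmp_graph[of n c] G n0, of u] unfolding edge_deg_def nK(1,2)
    by (simp add: ediff_commute[of "cmp_graph n c" G])
  have h2: "real (edge_deg ?D u) * (K1 / real n) \<le> \<mu> * K1"
  proof -
    have "real (edge_deg ?D u) * (K1 / real n) \<le> \<mu> * real n * (K1 / real n)"
      using u(3) K1 by (intro mult_right_mono) auto
    then show ?thesis using n0 by simp
  qed
  have h3: "deg n G u \<le> deg n G v + 2 * \<mu> * K1" using dd[OF v u(1)] by linarith
  have h4: "deg n G v \<le> real (card (nonnbrs n G v)) * (K1 / real n) + real (card ?D) * (K1 / real n ^ 2)
      + npart (x # R) (int n_twos) (int n_ones - 1)"
    using deg_le_full[OF small G n0 v, of c] unfolding nK(1,2) np .
  have h5: "real (card (nonnbrs n G v)) * (K1 / real n) \<le> \<kappa> / 4 * K1"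
  proof -
    have "real (card (nonnbrs n G v)) * (K1 / real n) \<le> \<kappa> / 4 * real n * (K1 / real n)"
      using neg K1 by (intro mult_right_mono) auto
    then show ?thesis using n0 by simp
  qed
  have h6: "\<mu> * K1 \<le> \<kappa> / 20 * K1" using \<mu>(2) K1 by (intro mult_right_mono) auto
  have h7: "0 < \<kappa> * K1" using \<kappa> K1 by simp
  have "dH - \<kappa> * K1 \<le> N" if "dH \<le> dG + e + d" "e \<le> \<mu> * K1" "dG \<le> dv + 2 * \<mu> * K1"
    "dv \<le> w + d + N" "w \<le> \<kappa> / 4 * K1" "d \<le> \<mu> / 2 * K1" for dH dG e d dv w N :: real
    using that h6 h7 by simp
  from this[OF h1 h2 h3 h4 h5 D3]
  have cheap: "deg n ?H u - \<kappa> * K1 \<le> npart (x # R) (int n_twos) (int n_ones - 1)" .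
  note cnt = small_parts_counts[OF small]
  have \<kappa>K: "\<kappa> * real n ^ k / real n = \<kappa> * K1" unfolding K1_def by simp
  have "npart (x # R) (int n_twos) (int n_ones) \<le> maxind n - \<kappa> * real n ^ (2 * n_twos + n_ones)"
    unfolding \<kappa>_def
  proof (rule split_cost)
    show "npart xs (int n_twos) (int n_ones) \<le> maxind n" if "sum_list xs = n" for xs
      by (rule npart_le_maxind[OF small that])
    show "\<pi> * real n ^ (2 * n_twos + n_ones) \<le> maxind n" using \<pi>(1) unfolding cnt(2) .
    show "2 \<le> n_twos + n_ones" using cnt(1) r2 by simp
    show "2 \<le> 2 * n_twos + n_ones" using cnt(3) by simp
    show "12 \<le> \<pi> / 2 * real n" "3 \<le> \<pi> / (200 * exp (512 / (\<pi> / 2))) * real n"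
      using n unfolding \<kappa>_def by auto
    show "npart (x # R) (int n_twos) (int n_ones) - npart ((x - 1) # R) (int n_twos) (int n_ones) -
       \<pi> / (200 * exp (512 / (\<pi> / 2))) * real n ^ (2 * n_twos + n_ones) / real n
       \<le> npart (x # R) (int n_twos) (int n_ones - 1)"
      using cheap unfolding degu cnt(2) \<kappa>_def[symmetric] \<kappa>K .
  qed (use \<pi> sumx Rx xbig in auto)
  then have "ind n ?H \<le> maxind n - \<kappa> * real n ^ k" unfolding indN cnt(2) .
  then have "\<kappa> * real n ^ k \<le> 2 * \<mu> * real n ^ k" using indH by linarith
  then have "\<kappa> \<le> 2 * \<mu>" using n0 by simp
  then show False using \<mu>(2) \<kappa> by simp
qed

text \<open>The order of quantifiers matters: \<open>\<nu>\<close> is fixed before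
  \<open>\<mu>\<close>, so later constants may depend on \<open>\<nu>\<close> and
  \<open>\<mu>\<close> can be chosen last.\<close>

lemma many_nonnbrs:
  assumes "(\<forall>i<r. a i \<ge> 2) \<or> (\<forall>i<r. a i \<le> 2)"
  shows "\<exists>\<nu>>0. \<nu> \<le> 1 \<and> (\<exists>\<mu>0>0. \<exists>n0. \<forall>n\<ge>n0. \<forall>\<mu>\<le>\<mu>0. \<forall>G c. close n \<mu> G c \<longrightarrow>
     (\<forall>v<n. real (card (nonnbrs n G v)) \<ge> \<nu> * real n))"
proof -
  obtain \<pi> n1 where \<pi>: "\<pi> > 0" "\<pi> \<le> 1" "\<And>n. n \<ge> n1 \<Longrightarrow> maxind n \<ge> \<pi> * real n ^ k"
    using maxind_lower by blast
  show ?thesis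
  proof (cases "\<forall>i<r. a i \<ge> 2")
    case True
    show ?thesis
      using \<pi> nonnbrs_large_parts[OF _ \<pi>(3) _ _ True]
      by (intro exI[of _ "\<pi> / 2"] conjI exI[of _ "\<pi> / 6"] exI[of _ n1]) auto
  next
    case False
    then have small: "\<forall>i<r. a i \<le> 2" using assms by blast
    define \<kappa> where "\<kappa> = \<pi> / (200 * exp (512 / (\<pi> / 2)))"
    have \<kappa>: "\<kappa> > 0" unfolding \<kappa>_def using \<pi> by simp
    have "1 \<le> exp (512 / (\<pi> / 2))" using \<pi>(1) by (intro one_le_exp_iff[THEN iffD2]) simp
    then have "1 \<le> 200 * exp (512 / (\<pi> / 2))" by linarith
    then have "\<kappa> \<le> \<pi> / 1" unfolding \<kappa>_def using \<pi> by (intro divide_left_mono) auto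
    then have \<kappa>1: "\<kappa> / 4 \<le> 1" using \<pi> by simp
    define n2 where "n2 = max n1 (max (nat \<lceil>24 / \<pi>\<rceil>) (nat \<lceil>3 / \<kappa>\<rceil>))"
    have "real (card (nonnbrs n G v)) \<ge> \<kappa> / 4 * real n"
      if h: "n \<ge> n2" "\<mu> \<le> min (\<pi> / 6) (\<kappa> / 20)" "close n \<mu> G c" "v < n" for n \<mu> G c v
      unfolding \<kappa>_def
    proof (rule nonnbrs_small_parts[OF h(3) \<pi>(3) \<pi>(1,2) small])
      have "n \<ge> nat \<lceil>24 / \<pi>\<rceil>" "n \<ge> nat \<lceil>3 / \<kappa>\<rceil>" using h(1) unfolding n2_def by auto
      then have "real n \<ge> 24 / \<pi>" "real n \<ge> 3 / \<kappa>" by linarith+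
      then show "12 \<le> \<pi> / 2 * real n" "3 \<le> \<pi> / (200 * exp (512 / (\<pi> / 2))) * real n"
        unfolding \<kappa>_def[symmetric] using \<pi> \<kappa> by (simp_all add: field_simps)
      show "\<mu> \<le> \<pi> / (200 * exp (512 / (\<pi> / 2))) / 20" unfolding \<kappa>_def[symmetric] using h(2) by simp
    qed (use h in \<open>auto simp: n2_def\<close>)
    then show ?thesis using \<kappa> \<kappa>1 \<pi>
      by (intro exI[of _ "\<kappa> / 4"] conjI exI[of _ "min (\<pi> / 6) (\<kappa> / 20)"] exI[of _ n2]) auto
  qed
qed

end

section \<open>Attaching a vertex to a complete multipartite graph\<close>

lemma prod_choose_lower:
  assumes "finite J" "\<And>j. j \<in> J \<Longrightarrow> real (m j) \<ge> y" "y \<ge> real k" "k > 0" "\<And>j. j \<in> J \<Longrightarrow> b j \<le> k"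
  shows "(y / real k) ^ (\<Sum>j\<in>J. b j) \<le> real (\<Prod>j\<in>J. m j choose b j)"
proof -
  have "(y / real k) ^ (\<Sum>j\<in>J. b j) = (\<Prod>j\<in>J. (y / real k) ^ b j)" by (rule power_sum)
  also have "\<dots> \<le> (\<Prod>j\<in>J. real (m j choose b j))"
  proof (intro prod_mono conjI)
    fix j assume "j \<in> J"
    then show "(y / real k) ^ b j \<le> real (m j choose b j)" using assms by (intro choose_ge_power) auto
    show "0 \<le> (y / real k) ^ b j" using assms by simp
  qed
  finally show ?thesis by simp
qed

text \<open>Only the neighbourhood of \<open>v\<close> is arbitrary. The non-neighbours of
  \<open>v\<close> in one class are then twins and independent, as \<open>merge_gain\<close>
  demands.\<close>

definition attached_to :: "nat \<Rightarrow> (nat \<Rightarrow> nat) \<Rightarrow> nat \<Rightarrow> nat set set \<Rightarrow> bool" where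
  "attached_to n c v G \<longleftrightarrow> graph_on n G \<and>
     (\<forall>x<n. \<forall>y<n. x \<noteq> v \<longrightarrow> y \<noteq> v \<longrightarrow> ({x, y} \<in> G \<longleftrightarrow> c x \<noteq> c y))"

definition class_nonnbrs :: "nat \<Rightarrow> (nat \<Rightarrow> nat) \<Rightarrow> nat set set \<Rightarrow> nat \<Rightarrow> nat \<Rightarrow> nat set" where
  "class_nonnbrs n c G v i = {w. w < n \<and> w \<noteq> v \<and> c w = i \<and> {v, w} \<notin> G}"

definition class_nbrs :: "nat \<Rightarrow> (nat \<Rightarrow> nat) \<Rightarrow> nat set set \<Rightarrow> nat \<Rightarrow> nat \<Rightarrow> nat set" where
  "class_nbrs n c G v i = {w. w < n \<and> w \<noteq> v \<and> c w = i \<and> {v, w} \<in> G}"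

lemma class_sets_finite [simp]: "finite (class_nonnbrs n c G v i)" "finite (class_nbrs n c G v i)"
  unfolding class_nonnbrs_def class_nbrs_def by simp_all

context multipartite_pattern
begin

text \<open>\<open>extra1\<close> and \<open>extra2\<close> are the two correction terms of
  \<open>merge_gain\<close>, before and after the merge.\<close>

definition extra1 :: "nat \<Rightarrow> nat set set \<Rightarrow> nat set \<Rightarrow> nat \<Rightarrow> nat set set" where
  "extra1 n G U v = {S \<in> copies n G. card (S \<inter> insert v U) \<ge> 2 \<and> split_pair G U v S}"

definition extra2 :: "nat \<Rightarrow> nat set set \<Rightarrow> nat set \<Rightarrow> nat \<Rightarrow> nat set set" where
  "extra2 n G U v = {S \<in> copies n (clone n G U v). card (S \<inter> insert v U) \<ge> 2 \<and> split_pair G U v S}"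

lemma vertex_merge:
  fixes i :: nat
  assumes att: "attached_to n c v G" and v: "v < n"
  defines "U \<equiv> class_nonnbrs n c G v i"
  shows "ind n G + (\<Sum>u\<in>U. deg n G v - deg n G u) + real (card (extra1 n G U v)) + real (card (extra2 n G U v))
     \<le> maxind n"
proof -
  have G: "graph_on n G" and adj: "\<And>x y. x < n \<Longrightarrow> y < n \<Longrightarrow> x \<noteq> v \<Longrightarrow> y \<noteq> v \<Longrightarrow> {x, y} \<in> G \<longleftrightarrow> c x \<noteq> c y"
    using att unfolding attached_to_def by blast+
  have U: "u < n" "u \<noteq> v" "c u = i" "{v, u} \<notin> G" if "u \<in> U" for u
    using that unfolding U_def class_nonnbrs_def by auto
  have U5: "{u, v} \<notin> G" if "u \<in> U" for u using U(4)[OF that] insert_commute[of u v] by metis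
  have vv: "{v, v} \<notin> G" using graph_on_pair[OF G, of v v] by blast
  have "ind n G + (\<Sum>u\<in>U. deg n G v - deg n G u) + real (card (extra1 n G U v)) + real (card (extra2 n G U v))
     \<le> ind n (clone n G U v)"
    unfolding extra1_def extra2_def
  proof (rule merge_gain[OF G v])
    show "U \<subseteq> {0..<n}" "v \<notin> U" using U by auto
    fix x y assume xy: "x \<in> insert v U" "y \<in> insert v U"
    show "{x, y} \<notin> G"
    proof (cases "x = v \<or> y = v")
      case True
      then show ?thesis using xy vv U(4) U5 by auto
    next
      case False
      then have "x \<in> U" "y \<in> U" using xy by auto
      then show ?thesis using adj[of x y] U by simp
    qed
  next
    fix u u' x assume h: "u \<in> U" "u' \<in> U" "x \<notin> insert v U"
    show "({u, x} \<in> G) = ({u', x} \<in> G)"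
    proof (cases "x < n")
      case True
      have "x \<noteq> v" using h(3) by blast
      then show ?thesis using adj[of u x] adj[of u' x] U[OF h(1)] U[OF h(2)] True by simp
    next
      case False
      then show ?thesis using graph_on_pair[OF G] by blast
    qed
  qed
  also have "\<dots> \<le> maxind n" by (rule ind_le_maxind[OF graph_on_clone])
  finally show ?thesis .
qed

lemma sum_a_split:
  assumes "i2 < r"
  shows "(\<Sum>j\<in>{0..<r} - {i2}. a j) + a i2 = k"
proof -
  have "(\<Sum>j\<in>{0..<r}. a j) = a i2 + (\<Sum>j\<in>{0..<r} - {i2}. a j)" using assms by (intro sum.remove) auto
  then show ?thesis using sum_a by (simp add: atLeast0LessThan)
qed

text \<open>Copies with at least two vertices in \<open>U\<close> and exactly one vertex in a set \<open>W\<close> of non-neighbours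
  of \<open>v\<close> outside the class of \<open>U\<close>.\<close>

lemma extra1_lower:
  assumes att: "attached_to n c v G"
    and \<phi>: "inj_on \<phi> {0..<r}" "\<phi> i1 = i" and i12: "i1 < r" "i2 < r" "i1 \<noteq> i2" "a i1 \<ge> 2"
    and W: "W \<subseteq> class_nonnbrs n c G v (\<phi> i2)"
    and y: "y \<ge> real k" "real (card (class_nonnbrs n c G v i)) \<ge> y"
      "real (card ({w. w < n \<and> w \<noteq> v \<and> c w = \<phi> i2} - W)) \<ge> y"
      "\<And>j. j < r \<Longrightarrow> j \<noteq> i1 \<Longrightarrow> j \<noteq> i2 \<Longrightarrow> real (card {w. w < n \<and> w \<noteq> v \<and> c w = \<phi> j}) \<ge> y"
  shows "real (card W) * (y / real k) ^ (k - 1) \<le> real (card (extra1 n G (class_nonnbrs n c G v i) v))"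
proof -
  define U where "U = class_nonnbrs n c G v i"
  define B where "B j = {w. w < n \<and> w \<noteq> v \<and> c w = \<phi> j}" for j
  \<comment> \<open>The additional index \<open>r\<close> splits part \<open>i2\<close>: one of its
    vertices is taken in \<open>W\<close>, the others in the same class outside
    \<open>W\<close>.\<close>
  define A where "A j = (if j = i1 then U else if j = i2 then B i2 - W else if j = r then W else B j)" for j
  define b where "b j = (if j = i2 then a i2 - 1 else if j = r then 1 else a j)" for j
  define cl where "cl j = (if j = r then i2 else j)" for j
  let ?J = "{0..r}"
  have G: "graph_on n G" and adj: "\<And>x y. x < n \<Longrightarrow> y < n \<Longrightarrow> x \<noteq> v \<Longrightarrow> y \<noteq> v \<Longrightarrow> {x, y} \<in> G \<longleftrightarrow> c x \<noteq> c y"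
    using att unfolding attached_to_def by blast+
  have WB: "W \<subseteq> B i2" using W unfolding class_nonnbrs_def B_def by blast
  have UB: "U \<subseteq> B i1" unfolding U_def class_nonnbrs_def B_def using \<phi>(2) by auto
  have AB: "A j \<subseteq> B (cl j)" if "j \<le> r" for j
    using that WB UB i12 unfolding A_def cl_def by auto
  have cl: "cl j < r" if "j \<le> r" for j using that i12 unfolding cl_def by auto
  have Bcol: "x < n \<and> x \<noteq> v \<and> c x = \<phi> j" if "x \<in> B j" for x j using that unfolding B_def by auto
  have \<phi>eq: "\<phi> (cl j) = \<phi> (cl l) \<longleftrightarrow> cl j = cl l" if "j \<le> r" "l \<le> r" for j l
    using inj_on_eq_iff[OF \<phi>(1)] cl[OF that(1)] cl[OF that(2)] by simp
  have disj: "disjoint_family_on A ?J"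
    unfolding disjoint_family_on_def
  proof (intro ballI impI)
    fix j l assume jl: "j \<in> ?J" "l \<in> ?J" "j \<noteq> l"
    show "A j \<inter> A l = {}"
    proof (cases "cl j = cl l")
      case True
      then have "j = i2 \<and> l = r \<or> j = r \<and> l = i2" using jl i12 unfolding cl_def by (auto split: if_splits)
      then show ?thesis unfolding A_def using i12 by auto
    next
      case False
      then have "\<phi> (cl j) \<noteq> \<phi> (cl l)" using \<phi>eq jl by simp
      moreover have "A j \<subseteq> B (cl j)" "A l \<subseteq> B (cl l)" using AB jl by auto
      ultimately show ?thesis using Bcol by (metis disjoint_iff subsetD)
    qed
  qed
  have A_adj: "{x, y} \<in> G \<longleftrightarrow> cl j \<noteq> cl l" if "j \<in> ?J" "l \<in> ?J" "x \<in> A j" "y \<in> A l" "x \<noteq> y" for j l x y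
  proof -
    have "x \<in> B (cl j)" "y \<in> B (cl l)" using AB that by auto
    then show ?thesis using adj[of x y] Bcol[of x "cl j"] Bcol[of y "cl l"] \<phi>eq that(1,2) by simp
  qed
  have b_sum: "(\<Sum>j\<in>{j\<in>?J. cl j = i'}. b j) = a i'" if "i' < r" for i'
  proof (cases "i' = i2")
    case True
    have "{j\<in>?J. cl j = i'} = {i2, r}" using True i12 unfolding cl_def by auto
    then show ?thesis using True i12 a_pos[of i2] unfolding b_def by simp
  next
    case False
    have "{j\<in>?J. cl j = i'} = {i'}" using False that i12 unfolding cl_def by auto
    then show ?thesis using False that unfolding b_def by simp
  qed
  define F where "F = {S. S \<subseteq> (\<Union>j\<in>?J. A j) \<and> (\<forall>j\<in>?J. card (S \<inter> A j) = b j)}"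
  have An: "A j \<subseteq> {0..<n}" if "j \<in> ?J" for j
  proof -
    have "B (cl j) \<subseteq> {0..<n}" unfolding B_def by auto
    then show ?thesis using AB[of j] that by auto
  qed
  have clr: "\<And>j. j \<in> ?J \<Longrightarrow> cl j < r" using cl by simp
  have Fc: "F \<subseteq> copies n G" "card F = (\<Prod>j\<in>?J. card (A j) choose b j)"
    unfolding F_def
    by (rule pieces_family[OF _ disj An clr b_sum A_adj]; simp)+
  have "F \<subseteq> extra1 n G U v"
  proof
    fix S assume S: "S \<in> F"
    have all: "card (S \<inter> A j) = b j" if "j \<le> r" for j using S that unfolding F_def by simp
    have cU: "card (S \<inter> U) = a i1" using all[of i1] i12 unfolding A_def b_def by simp
    have finS: "finite S" using S Fc(1) copiesD by blast
    have "card (S \<inter> U) \<le> card (S \<inter> insert v U)" using finS by (intro card_mono) auto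
    then have two: "card (S \<inter> insert v U) \<ge> 2" using cU i12 by simp
    have "card (S \<inter> W) = 1" using all[of r] i12 unfolding A_def b_def by simp
    then have "S \<inter> W \<noteq> {}" by auto
    then obtain x where x: "x \<in> S" "x \<in> W" by blast
    have "S \<inter> U \<noteq> {}" using cU i12(4) by auto
    then obtain u where u: "u \<in> S" "u \<in> U" by blast
    have xn: "x < n" "x \<noteq> v" "c x = \<phi> i2" "{v, x} \<notin> G" using x W unfolding class_nonnbrs_def by auto
    have un: "u < n" "u \<noteq> v" "c u = \<phi> i1" using u(2) UB Bcol by auto
    have "\<phi> i1 \<noteq> \<phi> i2" using inj_on_eq_iff[OF \<phi>(1)] i12 by simp
    then have "{u, x} \<in> G" "x \<notin> U" using adj[of u x] un xn UB Bcol by auto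
    then have "split_pair G U v S" unfolding split_pair_def using x(1) xn u(2) by blast
    then show "S \<in> extra1 n G U v" unfolding extra1_def using S Fc(1) two by blast
  qed
  then have "card F \<le> card (extra1 n G U v)"
    unfolding extra1_def by (intro card_mono) auto
  moreover have "real (card F) \<ge> real (card W) * (y / real k) ^ (k - 1)"
  proof -
    have "{0..r} = insert r {0..<r}" by auto
    then have "(\<Prod>j\<in>?J. card (A j) choose b j) = (card (A r) choose b r) * (\<Prod>j\<in>{0..<r}. card (A j) choose b j)"
      by simp
    also have "card (A r) choose b r = card W" unfolding A_def b_def using i12 by auto
    finally have 1: "real (card F) = real (card W) * real (\<Prod>j\<in>{0..<r}. card (A j) choose b j)"
      unfolding Fc(2) by simp
    have "(\<Sum>j\<in>{0..<r}. b j) = b i2 + (\<Sum>j\<in>{0..<r} - {i2}. b j)"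
      using i12 by (intro sum.remove) auto
    also have "(\<Sum>j\<in>{0..<r} - {i2}. b j) = (\<Sum>j\<in>{0..<r} - {i2}. a j)"
      unfolding b_def by (intro sum.cong) auto
    finally have "(\<Sum>j\<in>{0..<r}. b j) = k - 1"
      using sum_a_split[OF i12(2)] a_pos[OF i12(2)] unfolding b_def by simp
    moreover have "(y / real k) ^ (\<Sum>j\<in>{0..<r}. b j) \<le> real (\<Prod>j\<in>{0..<r}. card (A j) choose b j)"
    proof (rule prod_choose_lower)
      show "real (card (A j)) \<ge> y" if "j \<in> {0..<r}" for j
        using y that unfolding A_def U_def B_def by auto
      show "b j \<le> k" if "j \<in> {0..<r}" for j
        using a_le_k[of j] that k_pos unfolding b_def by auto
    qed (use y k_pos in auto)
    ultimately show ?thesis unfolding 1 by (intro mult_left_mono) auto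
  qed
  ultimately show ?thesis unfolding U_def by linarith
qed

text \<open>After the merge \<open>U\<close> has the neighbourhood of \<open>v\<close> and is thus
  completely joined to \<open>W\<close>, although both come from class \<open>i\<close>. One class
  now hosts the two parts \<open>i1\<close> and \<open>i2\<close>, and copies appear that
  distinguish the types through \<open>W\<close>.\<close>

lemma extra2_lower:
  assumes att: "attached_to n c v G" and v: "v < n"
    and \<phi>: "inj_on \<phi> {0..<r}" "\<phi> i1 = i" and i12: "i1 < r" "i2 < r" "i1 \<noteq> i2" "a i1 \<ge> 2"
    and W: "W \<subseteq> class_nbrs n c G v i"
    and y: "y \<ge> real k" "real (card (class_nonnbrs n c G v i)) \<ge> y"
      "\<And>j. j < r \<Longrightarrow> j \<noteq> i1 \<Longrightarrow> j \<noteq> i2 \<Longrightarrow> real (card (class_nbrs n c G v (\<phi> j))) \<ge> y"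
  shows "real (card W choose a i2) * (y / real k) ^ (k - a i2)
    \<le> real (card (extra2 n G (class_nonnbrs n c G v i) v))"
proof -
  define U where "U = class_nonnbrs n c G v i"
  define A where "A j = (if j = i1 then U else if j = i2 then W else class_nbrs n c G v (\<phi> j))" for j
  let ?J = "{0..<r}" and ?G1 = "clone n G U v"
  have G: "graph_on n G" and adj: "\<And>x y. x < n \<Longrightarrow> y < n \<Longrightarrow> x \<noteq> v \<Longrightarrow> y \<noteq> v \<Longrightarrow> {x, y} \<in> G \<longleftrightarrow> c x \<noteq> c y"
    using att unfolding attached_to_def by blast+
  have vv: "{v, v} \<notin> G" using graph_on_pair[OF G, of v v] by blast
  have U: "x < n" "x \<noteq> v" "c x = \<phi> i1" "{v, x} \<notin> G" if "x \<in> U" for x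
    using that \<phi>(2) unfolding U_def class_nonnbrs_def by auto
  have Wn: "x < n" "x \<noteq> v" "c x = \<phi> i1" "{v, x} \<in> G" "x \<notin> U" if "x \<in> W" for x
    using that \<phi>(2) W unfolding class_nbrs_def U_def class_nonnbrs_def by auto
  have B: "x < n" "x \<noteq> v" "c x = \<phi> j" "{v, x} \<in> G" "x \<notin> U"
    if "x \<in> A j" "j < r" "j \<noteq> i1" "j \<noteq> i2" for x j
    using that unfolding A_def U_def class_nbrs_def class_nonnbrs_def by auto
  have \<phi>eq: "\<phi> j = \<phi> l \<longleftrightarrow> j = l" if "j < r" "l < r" for j l
    using inj_on_eq_iff[OF \<phi>(1)] that by simp
  have Anbr: "x < n \<and> x \<noteq> v \<and> {v, x} \<in> G \<and> x \<notin> U" if "x \<in> A j" "j < r" "j \<noteq> i1" for x j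
    using Wn[of x] B[of x j] that unfolding A_def by (cases "j = i2") auto
  have disj: "disjoint_family_on A ?J"
    unfolding disjoint_family_on_def
  proof (intro ballI impI)
    fix j l assume jl: "j \<in> ?J" "l \<in> ?J" "j \<noteq> l"
    have "x \<notin> A l" if x: "x \<in> A j" for x
    proof
      assume x': "x \<in> A l"
      have 1: "j \<noteq> i1" using Anbr[OF x'] x jl unfolding A_def by auto
      have 2: "l \<noteq> i1" using Anbr[OF x] x' jl unfolding A_def by auto
      have "c x = \<phi> (if j = i2 then i1 else j)"
        using 1 B[OF x] Wn[of x] x jl i12 unfolding A_def by (cases "j = i2") auto
      moreover have "c x = \<phi> (if l = i2 then i1 else l)"
        using 2 B[OF x'] Wn[of x] x' jl i12 unfolding A_def by (cases "l = i2") auto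
      ultimately have "(if j = i2 then i1 else j) = (if l = i2 then i1 else l)"
        using \<phi>eq jl i12 by simp
      then show False using 1 2 jl(3) by (auto split: if_splits)
    qed
    then show "A j \<inter> A l = {}" by blast
  qed
  have G1: "{x, y} \<in> ?G1 \<longleftrightarrow> {if x \<in> U then v else x, if y \<in> U then v else y} \<in> G"
    if "x < n" "y < n" "x \<noteq> y" for x y unfolding clone_pair using that by simp
  have A_n: "x < n" if "x \<in> A j" "j < r" for x j
    using Anbr[of x j] U(1)[of x] that unfolding A_def by (cases "j = i1") auto
  have A_adj: "{x, y} \<in> ?G1 \<longleftrightarrow> j \<noteq> l"
    if jl: "j \<in> ?J" "l \<in> ?J" and x: "x \<in> A j" and y: "y \<in> A l" and ne: "x \<noteq> y" for j l x y
  proof -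
    have jr: "j < r" "l < r" using jl by auto
    have lt: "x < n" "y < n" using A_n x y jr by auto
    have U1: "z \<in> U" if "z \<in> A i1" for z using that unfolding A_def by simp
    consider "j = i1" "l = i1" | "j = i1" "l \<noteq> i1" | "j \<noteq> i1" "l = i1" | "j \<noteq> i1" "l \<noteq> i1" by blast
    then show ?thesis
    proof cases
      case 1
      then have "x \<in> U" "y \<in> U" using U1 x y by auto
      then show ?thesis unfolding G1[OF lt ne] using 1 vv by simp
    next
      case 2
      then have "x \<in> U" "y \<notin> U" "{v, y} \<in> G" using U1 x Anbr[OF y jr(2)] by auto
      then show ?thesis unfolding G1[OF lt ne] using 2 by simp
    next
      case 3
      then have "y \<in> U" "x \<notin> U" "{v, x} \<in> G" using U1 y Anbr[OF x jr(1)] by auto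
      then show ?thesis unfolding G1[OF lt ne] using 3 by (simp add: insert_commute)
    next
      case 4
      have nU: "x \<notin> U" "y \<notin> U" "x \<noteq> v" "y \<noteq> v" using Anbr[OF x jr(1)] Anbr[OF y jr(2)] 4 by auto
      have cx: "c x = \<phi> (if j = i2 then i1 else j)"
        using 4 B[OF x] Wn[of x] x jr i12 unfolding A_def by (cases "j = i2") auto
      have cy: "c y = \<phi> (if l = i2 then i1 else l)"
        using 4 B[OF y] Wn[of y] y jr i12 unfolding A_def by (cases "l = i2") auto
      have "{x, y} \<in> ?G1 \<longleftrightarrow> c x \<noteq> c y" unfolding G1[OF lt ne] using nU adj[OF lt] by simp
      also have "c x = c y \<longleftrightarrow> j = l" unfolding cx cy using \<phi>eq jr i12 4 by (auto split: if_splits)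
      finally show ?thesis .
    qed
  qed
  have An: "A j \<subseteq> {0..<n}" if "j \<in> ?J" for j using A_n that by auto
  have b_sum: "(\<Sum>j\<in>{j\<in>?J. j = i'}. a j) = a i'" if "i' < r" for i'
  proof -
    have "{j\<in>?J. j = i'} = {i'}" using that by auto
    then show ?thesis by simp
  qed
  define F where "F = {S. S \<subseteq> (\<Union>j\<in>?J. A j) \<and> (\<forall>j\<in>?J. card (S \<inter> A j) = a j)}"
  have clr: "\<And>j. j \<in> ?J \<Longrightarrow> j < r" by simp
  have Fc: "F \<subseteq> copies n ?G1"
    unfolding F_def by (rule pieces_family(1)[OF _ disj An clr b_sum A_adj]) auto
  have Fcard: "card F = (\<Prod>j\<in>?J. card (A j) choose a j)"
    unfolding F_def by (rule pieces_family(2)[OF _ disj An clr b_sum A_adj]) auto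
  have "F \<subseteq> extra2 n G U v"
  proof
    fix S assume S: "S \<in> F"
    have all: "card (S \<inter> A j) = a j" if "j < r" for j using S that unfolding F_def by simp
    have cU: "card (S \<inter> U) = a i1" using all[OF i12(1)] unfolding A_def by simp
    have finS: "finite S" using S Fc copiesD by blast
    have "card (S \<inter> U) \<le> card (S \<inter> insert v U)" using finS by (intro card_mono) auto
    then have two: "card (S \<inter> insert v U) \<ge> 2" using cU i12 by simp
    have "card (S \<inter> W) = a i2" using all[OF i12(2)] i12(3) unfolding A_def by simp
    then have "S \<inter> W \<noteq> {}" using a_pos[OF i12(2)] by auto
    then obtain x where x: "x \<in> S" "x \<in> W" by blast
    have "S \<inter> U \<noteq> {}" using cU i12(4) by auto
    then obtain u where u: "u \<in> U" by blast
    have "{u, x} \<notin> G" using adj[of u x] U[OF u] Wn[OF x(2)] by simp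
    then have "split_pair G U v S" unfolding split_pair_def using x(1) Wn[OF x(2)] u by blast
    then show "S \<in> extra2 n G U v" unfolding extra2_def using S Fc two by blast
  qed
  then have "card F \<le> card (extra2 n G U v)"
    unfolding extra2_def by (intro card_mono) auto
  moreover have "real (card F) \<ge> real (card W choose a i2) * (y / real k) ^ (k - a i2)"
  proof -
    have "(\<Prod>j\<in>?J. card (A j) choose a j) = (card (A i2) choose a i2) * (\<Prod>j\<in>?J - {i2}. card (A j) choose a j)"
      using i12 by (intro prod.remove) auto
    also have "card (A i2) choose a i2 = card W choose a i2" unfolding A_def using i12 by auto
    finally have 1: "real (card F) = real (card W choose a i2) * real (\<Prod>j\<in>?J - {i2}. card (A j) choose a j)"
      unfolding Fcard by simp
    have "(\<Sum>j\<in>?J - {i2}. a j) = k - a i2" using sum_a_split[OF i12(2)] by simp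
    moreover have "(y / real k) ^ (\<Sum>j\<in>?J - {i2}. a j) \<le> real (\<Prod>j\<in>?J - {i2}. card (A j) choose a j)"
    proof (rule prod_choose_lower)
      show "real (card (A j)) \<ge> y" if "j \<in> ?J - {i2}" for j
        using y that unfolding A_def U_def by auto
      show "a j \<le> k" if "j \<in> ?J - {i2}" for j using a_le_k[of j] that by auto
    qed (use y k_pos in auto)
    ultimately show ?thesis unfolding 1 by (intro mult_left_mono) auto
  qed
  ultimately show ?thesis unfolding U_def by linarith
qed

end

text \<open>Assigns classes to the parts of the pattern when the classes for two of the parts are
  prescribed.\<close>

lemma inj_on_with_two_values:
  assumes "finite B" "r \<le> card B" "i \<in> B" "j \<in> B" "i \<noteq> j" "i1 < r" "i2 < r" "i1 \<noteq> i2"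
  shows "\<exists>\<phi>. inj_on \<phi> {0..<r} \<and> \<phi> ` {0..<r} \<subseteq> B \<and> \<phi> i1 = i \<and> \<phi> i2 = (j::nat)"
proof -
  have "card ({0..<r} - {i1, i2}) = r - 2" using assms by (subst card_Diff_subset) auto
  moreover have "card (B - {i, j}) = card B - 2" using assms by (subst card_Diff_subset) auto
  ultimately have "card ({0..<r} - {i1, i2}) \<le> card (B - {i, j})" using assms(2) by simp
  then obtain g where g: "g ` ({0..<r} - {i1, i2}) \<subseteq> B - {i, j}" "inj_on g ({0..<r} - {i1, i2})"
    using card_le_inj[of "{0..<r} - {i1, i2}" "B - {i, j}"] assms(1) by auto
  define \<phi> where "\<phi> = g(i1 := i, i2 := j)"
  have g': "g x \<in> B" "g x \<noteq> i" "g x \<noteq> j" if "x < r" "x \<noteq> i1" "x \<noteq> i2" for x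
  proof -
    have "g x \<in> g ` ({0..<r} - {i1, i2})" using that by simp
    then show "g x \<in> B" "g x \<noteq> i" "g x \<noteq> j" using g(1) by blast+
  qed
  have "inj_on \<phi> {0..<r}"
  proof (rule inj_onI)
    fix x y assume xy: "x \<in> {0..<r}" "y \<in> {0..<r}" "\<phi> x = \<phi> y"
    show "x = y"
    proof (cases "x \<in> {i1, i2} \<or> y \<in> {i1, i2}")
      case True
      then show ?thesis using xy g'[of x] g'[of y] assms(5,8) unfolding \<phi>_def by (auto split: if_splits)
    next
      case False
      then have "g x = g y" using xy(3) unfolding \<phi>_def by auto
      then show ?thesis using inj_onD[OF g(2), of x y] False xy by auto
    qed
  qed
  moreover have "\<phi> ` {0..<r} \<subseteq> B" using g' assms(3,4) unfolding \<phi>_def by auto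
  ultimately show ?thesis using assms(8) unfolding \<phi>_def by (intro exI[of _ "g(i1 := i, i2 := j)"]) auto
qed

text \<open>Keeps the true neighbourhood of \<open>v\<close> and idealises everything else. The
  exact merging inequality then applies, and wrong pairs at \<open>v\<close> are not corrected
  away.\<close>

definition attach :: "nat set set \<Rightarrow> nat set set \<Rightarrow> nat \<Rightarrow> nat set set" where
  "attach G H v = {e\<in>H. v \<notin> e} \<union> {e\<in>G. v \<in> e}"

lemma graph_on_attach: "graph_on n G \<Longrightarrow> graph_on n H \<Longrightarrow> graph_on n (attach G H v)"
  unfolding graph_on_def attach_def by blast

lemma attached_to_attach:
  assumes "graph_on n G" shows "attached_to n c v (attach G (cmp_graph n c) v)"
proof -
  have "{x, y} \<in> attach G (cmp_graph n c) v \<longleftrightarrow> c x \<noteq> c y" if "x < n" "y < n" "x \<noteq> v" "y \<noteq> v" for x y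
    unfolding attach_def using cmp_graph_pair[of x y n c] that by auto
  then show ?thesis unfolding attached_to_def using graph_on_attach[OF assms graph_on_cmp_graph] by blast
qed

lemma class_nonnbrs_attach [simp]: "class_nonnbrs n c (attach G H v) v i = class_nonnbrs n c G v i"
  unfolding class_nonnbrs_def attach_def by auto

lemma class_nbrs_attach [simp]: "class_nbrs n c (attach G H v) v i = class_nbrs n c G v i"
  unfolding class_nbrs_def attach_def by auto

lemma ediff_attach: "ediff G (attach G H v) \<subseteq> {e \<in> ediff G H. v \<notin> e}"
  unfolding ediff_def attach_def by blast

lemma edge_deg_eq_card_nbrs:
  assumes "\<And>e. e \<in> D \<Longrightarrow> card e = 2"
  shows "edge_deg D v = card {w. {v, w} \<in> D}"
  unfolding edge_deg_def
proof (rule bij_betw_same_card[symmetric])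
  show "bij_betw (\<lambda>w. {v, w}) {w. {v, w} \<in> D} {e \<in> D. v \<in> e}"
    unfolding bij_betw_def
  proof
    show "inj_on (\<lambda>w. {v, w}) {w. {v, w} \<in> D}" by (auto intro!: inj_onI simp: doubleton_eq_iff)
    show "(\<lambda>w. {v, w}) ` {w. {v, w} \<in> D} = {e \<in> D. v \<in> e}"
    proof
      show "{e \<in> D. v \<in> e} \<subseteq> (\<lambda>w. {v, w}) ` {w. {v, w} \<in> D}"
      proof
        fix e assume e: "e \<in> {e \<in> D. v \<in> e}"
        then have "card e = 2" using assms by blast
        then obtain x y where xy: "e = {x, y}" by (meson card_2_iff)
        then have "e = {v, x} \<or> e = {v, y}" using e by auto
        then show "e \<in> (\<lambda>w. {v, w}) ` {w. {v, w} \<in> D}" using e by blast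
      qed
    qed blast
  qed
qed

context multipartite_pattern
begin

lemma close_card_bounds:
  assumes "close n \<mu> G c"
  shows "real (card (ediff G (cmp_graph n c))) * (real n ^ k / real n ^ 2) \<le> \<mu> / 2 * real n ^ k"
    and "real (card (ediff G (cmp_graph n c))) * (real n ^ k / real n ^ 3) \<le> \<mu> / 2 * (real n ^ k / real n)"
proof -
  let ?D = "ediff G (cmp_graph n c)"
  have n: "n > 0" and \<mu>: "0 < \<mu>" "\<mu> \<le> 1" and D: "real (card ?D) \<le> \<mu> ^ 2 / 2 * real n ^ 2"
    using assms unfolding close_def by auto
  have "\<mu> ^ 2 / 2 \<le> \<mu> / 2" using \<mu> by (simp add: power2_eq_square mult_left_le)
  then have D': "real (card ?D) \<le> \<mu> / 2 * real n ^ 2"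
    using D mult_right_mono[of "\<mu> ^ 2 / 2" "\<mu> / 2" "real n ^ 2"] by simp
  have "real (card ?D) * (real n ^ k / real n ^ 2) \<le> \<mu> / 2 * real n ^ 2 * (real n ^ k / real n ^ 2)"
    using D' by (intro mult_right_mono) auto
  then show "real (card ?D) * (real n ^ k / real n ^ 2) \<le> \<mu> / 2 * real n ^ k" using n by simp
  have "real (card ?D) * (real n ^ k / real n ^ 3) \<le> \<mu> / 2 * real n ^ 2 * (real n ^ k / real n ^ 3)"
    using D' by (intro mult_right_mono) auto
  also have "\<dots> = \<mu> / 2 * (real n ^ k / real n)" using n by (simp add: power2_eq_square power3_eq_cube)
  finally show "real (card ?D) * (real n ^ k / real n ^ 3) \<le> \<mu> / 2 * (real n ^ k / real n)" .
qed

text \<open>Idealising off \<open>v\<close> disturbs counts and degrees little, so the degree terms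
  of the merge lose at most 4 \<mu> n ^ k. Together with \<mu> for near-maximality and \<mu> / 2 for
  idealising, this leaves less than 6 \<mu> n ^ k for the extras.\<close>

lemma close_extras:
  assumes cl: "close n \<mu> G c" and v: "v < n"
  defines "G0 \<equiv> attach G (cmp_graph n c) v"
  shows "real (card (extra1 n G0 (class_nonnbrs n c G v i) v)) + real (card (extra2 n G0 (class_nonnbrs n c G v i) v))
     \<le> 6 * \<mu> * real n ^ k"
proof -
  let ?H = "cmp_graph n c" let ?D = "ediff G ?H" and ?E = "ediff G G0"
  let ?N2 = "real n ^ k / real n ^ 2" and ?N3 = "real n ^ k / real n ^ 3"
  define K1 where "K1 = real n ^ k / real n"
  define U where "U = class_nonnbrs n c G v i"
  have G: "graph_on n G" and n: "n > 0" and \<mu>: "0 < \<mu>"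
    and near: "maxind n \<le> ind n G + \<mu> * real n ^ k"
    and dd: "\<And>u w. u < n \<Longrightarrow> w < n \<Longrightarrow> deg n G w - deg n G u \<le> 2 * \<mu> * K1"
    using cl unfolding close_def K1_def by auto
  have K1: "K1 > 0" "K1 * real n = real n ^ k" unfolding K1_def using n by simp_all
  have G0: "graph_on n G0" unfolding G0_def by (rule graph_on_attach[OF G graph_on_cmp_graph])
  note D = ediff_edges[OF G graph_on_cmp_graph[of n c]] and D0 = ediff_edges[OF G G0]
  have sub: "?E \<subseteq> {e\<in>?D. v \<notin> e}" unfolding G0_def by (rule ediff_attach)
  then have cardD0: "card ?E \<le> card ?D" using D(2) by (intro card_mono) auto
  have b2: "real (card ?E) * ?N2 \<le> \<mu> / 2 * real n ^ k"
  proof -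
    have "real (card ?E) * ?N2 \<le> real (card ?D) * ?N2" using cardD0 by (intro mult_right_mono) auto
    then show ?thesis using close_card_bounds(1)[OF cl] by linarith
  qed
  have b3: "real (card ?E) * ?N3 \<le> \<mu> / 2 * K1"
  proof -
    have "real (card ?E) * ?N3 \<le> real (card ?D) * ?N3" using cardD0 by (intro mult_right_mono) auto
    then show ?thesis using close_card_bounds(2)[OF cl] unfolding K1_def by linarith
  qed
  have ind0: "ind n G \<le> ind n G0 + \<mu> / 2 * real n ^ k"
    using ind_edit[OF G G0 n] b2 by linarith
  have e0: "{e\<in>?E. v \<in> e} = {}" using sub by blast
  have degv: "deg n G v \<le> deg n G0 v + \<mu> / 2 * K1"
    using deg_edit[OF G G0 n, of v] b3 unfolding e0 card.empty of_nat_0 mult_zero_left by linarith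
  have degu: "deg n G0 u \<le> deg n G u + real (edge_deg ?E u) * ?N2 + \<mu> / 2 * K1" for u
    using deg_edit[OF G0 G n, of u] b3 unfolding edge_deg_def ediff_commute[of G0 G] by linarith
  have Usub: "U \<subseteq> {..<n}" unfolding U_def class_nonnbrs_def by auto
  have cardU: "real (card U) \<le> real n" using card_mono[OF _ Usub] by simp
  \<comment> \<open>A single degree in \<open>U\<close> may change considerably, but summed over
    \<open>U\<close> each edited pair is counted at most twice.\<close>
  have edges: "(\<Sum>u\<in>U. real (edge_deg ?E u) * ?N2) \<le> \<mu> * real n ^ k"
  proof -
    have "(\<Sum>u\<in>U. real (edge_deg ?E u) * ?N2) \<le> (\<Sum>u<n. real (edge_deg ?E u) * ?N2)"
      using Usub by (intro sum_mono2) auto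
    also have "\<dots> = real (\<Sum>u<n. edge_deg ?E u) * ?N2" by (simp add: sum_distrib_right sum_divide_distrib)
    also have "\<dots> = 2 * (real (card ?E) * ?N2)" using sum_edge_deg[OF D0] by simp
    finally show ?thesis using b2 by linarith
  qed
  have "(\<Sum>u\<in>U. - (3 * \<mu> * K1) - real (edge_deg ?E u) * ?N2) \<le> (\<Sum>u\<in>U. deg n G0 v - deg n G0 u)"
  proof (rule sum_mono)
    fix u assume "u \<in> U"
    then have "deg n G u - deg n G v \<le> 2 * \<mu> * K1" using dd[of v u] Usub v by auto
    moreover have "0 < \<mu> * K1" using \<mu> K1 by simp
    ultimately show "- (3 * \<mu> * K1) - real (edge_deg ?E u) * ?N2 \<le> deg n G0 v - deg n G0 u"
      using degv degu[of u] by linarith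
  qed
  moreover have "(\<Sum>u\<in>U. - (3 * \<mu> * K1) - real (edge_deg ?E u) * ?N2) \<ge> - (4 * \<mu> * real n ^ k)"
  proof -
    have "real (card U) * (3 * \<mu> * K1) \<le> real n * (3 * \<mu> * K1)"
      using cardU \<mu> K1 by (intro mult_right_mono) auto
    also have "\<dots> = 3 * \<mu> * real n ^ k" using K1(2) by (simp add: mult_ac)
    finally show ?thesis using edges by (simp add: sum_subtractf)
  qed
  moreover have "ind n G0 + (\<Sum>u\<in>U. deg n G0 v - deg n G0 u) + real (card (extra1 n G0 U v)) + real (card (extra2 n G0 U v))
     \<le> maxind n"
    using vertex_merge[OF attached_to_attach[OF G, of c v] v, of i] unfolding G0_def U_def by simp
  moreover have "0 < \<mu> * real n ^ k" using \<mu> n by simp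
  ultimately show ?thesis using near ind0 unfolding U_def by simp
qed

text \<open>Many non-neighbours in two large classes would give many copies in
  \<open>extra1\<close>, and a large class split by \<open>v\<close> many in \<open>extra2\<close>.
  Hence \<open>v\<close> misses essentially one class and almost all of it. Recolouring
  \<open>v\<close> accordingly bounds the wrong pairs at every vertex, not just at typical
  ones.\<close>

lemma phase1_aux:
  assumes cl: "close n \<mu> G c" and i12: "i1 < r" "i2 < r" "i1 \<noteq> i2" "a i1 \<ge> 2"
    and \<nu>: "0 < \<nu>" "\<nu> \<le> 1" and nn: "\<And>v. v < n \<Longrightarrow> real (card (nonnbrs n G v)) \<ge> \<nu> * real n"
    and \<pi>: "maxind n \<ge> \<pi> * real n ^ k" "3 * \<mu> < \<pi>"
    and h: "0 < h" "h \<le> \<nu> ^ 2 / 16" "\<mu> \<le> h / 4" "6 * \<mu> < (h / (2 * real k)) ^ k" "h / 2 * real n \<ge> real k"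
  shows "\<exists>c2 B. finite B \<and> r \<le> card B \<and> (\<forall>v<n. c2 v \<in> B) \<and>
     (\<forall>j\<in>B. real (card {w. w < n \<and> c2 w = j}) \<ge> \<nu> / 4 * real n) \<and>
     (\<forall>v<n. real (edge_deg (ediff G (cmp_graph n c2)) v) \<le> 4 / \<nu> * h * real n)"
proof -
  let ?H = "cmp_graph n c" let ?D = "ediff G ?H"
  have G: "graph_on n G" and n: "n > 0" and \<mu>: "0 < \<mu>"
    and cardD: "real (card ?D) \<le> \<mu> ^ 2 / 2 * real n ^ 2"
    and near: "maxind n \<le> ind n G + \<mu> * real n ^ k"
    using cl unfolding close_def by auto
  note D = ediff_edges[OF G graph_on_cmp_graph[of n c]]
  have Dpair: "{x, y} \<in> ?D \<longleftrightarrow> ({x, y} \<in> G) \<noteq> (c x \<noteq> c y)" if "x < n" "y < n" for x y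
    unfolding ediff_def using that by (auto simp: cmp_graph_pair)
  have Dsym: "{w. {v, w} \<in> ?D} = {w. w < n \<and> w \<noteq> v \<and> ({v, w} \<in> G) \<noteq> (c v \<noteq> c w)}" if "v < n" for v
  proof -
    have "w < n \<and> w \<noteq> v" if "{v, w} \<in> ?D" for w using D(1)[OF that] by (cases "w = v") auto
    then show ?thesis using Dpair that by blast
  qed
  have hn: "h * real n \<ge> 6" using h(5) k_ge_3 by linarith
  have \<nu>h: "\<nu> / 16 \<ge> h"
  proof -
    have "\<nu> ^ 2 \<le> \<nu>" using \<nu> by (simp add: power2_eq_square mult_left_le)
    then show ?thesis using h(2) by simp
  qed
  have \<nu>n: "\<nu> * real n \<ge> 16 * (h * real n)" using \<nu>h n by (simp add: field_simps)
  have \<mu>n: "\<mu> * real n \<le> h * real n / 4" using h(3) n by (simp add: field_simps)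
  define y where "y = h / 2 * real n"
  have yk: "y \<ge> real k" using h(5) unfolding y_def .
  define sz where "sz j = card {w. w < n \<and> c w = j}" for j
  define B where "B = {j \<in> c ` {0..<n}. real (sz j) \<ge> \<nu> / 2 * real n}"
  have finB: "finite B" unfolding B_def by simp
  define At where "At = {u. u < n \<and> real (edge_deg ?D u) > \<mu> * real n}"
  have cardAt: "real (card At) \<le> \<mu> * real n" unfolding At_def by (rule few_atypical[OF D cardD \<mu> n])
  have finAt: "finite At" unfolding At_def by simp
  have typical: "real (card {w. {u, w} \<in> ?D}) \<le> \<mu> * real n" if "u < n" "u \<notin> At" for u
    using that edge_deg_eq_card_nbrs[of ?D u] D(1) unfolding At_def by auto
  \<comment> \<open>A typical vertex misses little outside its own class, so that class has to
    contain most of its \<nu> n non-neighbours.\<close>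
  have bigB: "c u \<in> B" if u: "u < n" "u \<notin> At" for u
  proof -
    have "nonnbrs n G u \<subseteq> {w. w < n \<and> c w = c u} \<union> {w. {u, w} \<in> ?D}"
      unfolding nonnbrs_def Dsym[OF u(1)] by auto
    moreover have fin: "finite {w. {u, w} \<in> ?D}" unfolding Dsym[OF u(1)] by simp
    ultimately have "card (nonnbrs n G u) \<le> card ({w. w < n \<and> c w = c u} \<union> {w. {u, w} \<in> ?D})"
      by (intro card_mono) auto
    also have "\<dots> \<le> sz (c u) + card {w. {u, w} \<in> ?D}" unfolding sz_def by (rule card_Un_le)
    finally have "real (card (nonnbrs n G u)) \<le> real (sz (c u)) + real (card {w. {u, w} \<in> ?D})" by linarith
    then have "\<nu> * real n \<le> real (sz (c u)) + \<mu> * real n" using nn[OF u(1)] typical[OF u] by linarith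
    then have "real (sz (c u)) \<ge> \<nu> / 2 * real n" using \<mu>n \<nu>n hn by linarith
    then show ?thesis unfolding B_def using u by simp
  qed
  \<comment> \<open>The atypical vertices meet too few copies to spoil all of them. In a copy
    avoiding them the \<open>r\<close> parts lie in different classes, all belonging to
    \<open>B\<close>.\<close>
  have rB: "r \<le> card B"
  proof -
    let ?F = "\<lambda>u. {S \<in> copies n ?H. u \<in> S}"
    have "real (card (\<Union>u\<in>At. ?F u)) \<le> \<mu> * real n ^ k"
    proof -
      have "card (\<Union>u\<in>At. ?F u) \<le> (\<Sum>u\<in>At. card (?F u))" by (rule card_UN_le[OF finAt])
      then have "real (card (\<Union>u\<in>At. ?F u)) \<le> (\<Sum>u\<in>At. deg n ?H u)"
        unfolding deg_def by (simp only: of_nat_sum[symmetric] of_nat_le_iff)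
      also have "\<dots> \<le> (\<Sum>u\<in>At. real n ^ k / real n)" by (intro sum_mono deg_le n)
      also have "\<dots> = real (card At) * (real n ^ k / real n)" by simp
      also have "\<dots> \<le> \<mu> * real n * (real n ^ k / real n)" using cardAt by (intro mult_right_mono) auto
      also have "\<dots> = \<mu> * real n ^ k" using n by simp
      finally show ?thesis .
    qed
    moreover have "ind n ?H \<ge> \<pi> * real n ^ k - 3 / 2 * \<mu> * real n ^ k"
      using ind_edit[OF G graph_on_cmp_graph[of n c] n] close_card_bounds(1)[OF cl] near \<pi>(1) by linarith
    moreover have "\<pi> * real n ^ k - 3 / 2 * \<mu> * real n ^ k > \<mu> * real n ^ k"
    proof -
      have "3 * \<mu> * real n ^ k < \<pi> * real n ^ k" using \<pi>(2) n by simp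
      moreover have "0 < \<mu> * real n ^ k" using \<mu> n by simp
      ultimately show ?thesis by linarith
    qed
    ultimately have "card (\<Union>u\<in>At. ?F u) < card (copies n ?H)" unfolding ind_def by linarith
    then have "\<not> copies n ?H \<subseteq> (\<Union>u\<in>At. ?F u)" using card_mono[of "\<Union>u\<in>At. ?F u" "copies n ?H"] finAt by auto
    then obtain S where S: "S \<in> copies n ?H" "S \<inter> At = {}" by blast
    note SD = copiesD[OF S(1)]
    obtain q where q: "\<forall>x\<in>S. q x < r" "\<forall>i<r. card {x\<in>S. q x = i} = a i"
      and adj: "\<forall>x\<in>S. \<forall>y\<in>S. x \<noteq> y \<longrightarrow> ({x, y} \<in> ?H \<longleftrightarrow> q x \<noteq> q y)"
      using SD unfolding copy_def by blast
    have "\<exists>x\<in>S. q x = i" if "i < r" for i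
    proof -
      have "card {x\<in>S. q x = i} \<noteq> 0" using q(2) a_pos[OF that] that by simp
      then have "{x\<in>S. q x = i} \<noteq> {}" by (metis card.empty)
      then show ?thesis by blast
    qed
    then obtain x where x: "\<And>i. i < r \<Longrightarrow> x i \<in> S \<and> q (x i) = i" by metis
    have "card {0..<r} \<le> card B"
    proof (rule card_inj_on_le[of "\<lambda>i. c (x i)"])
      show "inj_on (\<lambda>i. c (x i)) {0..<r}"
      proof (rule inj_onI)
        fix i j assume ij: "i \<in> {0..<r}" "j \<in> {0..<r}" "c (x i) = c (x j)"
        have xi: "x i \<in> S" "q (x i) = i" "x j \<in> S" "q (x j) = j" using x ij by auto
        show "i = j"
        proof (rule ccontr)
          assume "i \<noteq> j"
          then have "x i \<noteq> x j" using xi by metis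
          then have "{x i, x j} \<in> ?H" using adj xi \<open>i \<noteq> j\<close> by metis
          then show False using ij(3) unfolding cmp_graph_pair by blast
        qed
      qed
      show "(\<lambda>i. c (x i)) ` {0..<r} \<subseteq> B"
      proof
        fix j assume "j \<in> (\<lambda>i. c (x i)) ` {0..<r}"
        then obtain i where i: "i < r" "j = c (x i)" by auto
        then have "x i \<in> S" using x by blast
        then have "x i < n" "x i \<notin> At" using SD S(2) by auto
        then show "j \<in> B" using bigB i by simp
      qed
    qed (rule finB)
    then show ?thesis by simp
  qed
  have class_split: "real (sz j) \<le> 1 + real (card (class_nonnbrs n c G v j)) + real (card (class_nbrs n c G v j))" for v j
  proof -
    have "{w. w < n \<and> c w = j} \<subseteq> insert v (class_nonnbrs n c G v j \<union> class_nbrs n c G v j)"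
      unfolding class_nonnbrs_def class_nbrs_def by auto
    then have "sz j \<le> card (insert v (class_nonnbrs n c G v j \<union> class_nbrs n c G v j))"
      unfolding sz_def by (intro card_mono) auto
    also have "\<dots> \<le> Suc (card (class_nonnbrs n c G v j \<union> class_nbrs n c G v j))"
      by (rule card_insert_le_m1) auto
    also have "card (class_nonnbrs n c G v j \<union> class_nbrs n c G v j) \<le>
       card (class_nonnbrs n c G v j) + card (class_nbrs n c G v j)" by (rule card_Un_le)
    finally show ?thesis by linarith
  qed
  have class_minus: "real (card {w. w < n \<and> w \<noteq> v \<and> c w = j}) \<ge> real (sz j) - 1" for v j
  proof -
    have "{w. w < n \<and> c w = j} \<subseteq> insert v {w. w < n \<and> w \<noteq> v \<and> c w = j}" by auto
    then have "sz j \<le> card (insert v {w. w < n \<and> w \<noteq> v \<and> c w = j})" unfolding sz_def by (intro card_mono) auto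
    also have "\<dots> \<le> Suc (card {w. w < n \<and> w \<noteq> v \<and> c w = j})" by (rule card_insert_le_m1) auto
    finally show ?thesis by linarith
  qed
  have szB: "real (sz j) \<ge> 8 * (h * real n)" if "j \<in> B" for j
    using that \<nu>n unfolding B_def by auto
  have ykpow: "(y / real k) ^ k > 6 * \<mu> * real n ^ k"
  proof -
    have "y / real k = h / (2 * real k) * real n" unfolding y_def by simp
    then have "(y / real k) ^ k = (h / (2 * real k)) ^ k * real n ^ k" by (simp only: power_mult_distrib)
    then show ?thesis using mult_strict_right_mono[OF h(4), of "real n ^ k"] n by simp
  qed
  have ypos: "y > 0" "y \<ge> 3" unfolding y_def using hn h n by simp_all
  have only_one: "i = j"
    if v: "v < n" and ij: "i \<in> B" "j \<in> B" and big: "real (card (class_nonnbrs n c G v i)) \<ge> h * real n"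
      "real (card (class_nonnbrs n c G v j)) \<ge> h * real n" for v i j
  proof (rule ccontr)
    assume ne: "i \<noteq> j"
    obtain \<phi> where \<phi>: "inj_on \<phi> {0..<r}" "\<phi> ` {0..<r} \<subseteq> B" "\<phi> i1 = i" "\<phi> i2 = j"
      using inj_on_with_two_values[OF finB rB ij ne i12(1-3)] by blast
    \<comment> \<open>Trimming the non-neighbours to about \<open>y\<close> of them leaves at least
      \<open>y\<close> vertices in the rest of their class.\<close>
    define m where "m = nat \<lceil>y\<rceil>"
    have m: "real m \<ge> y" "real m \<le> y + 1" unfolding m_def using ypos by linarith+
    have "real m \<le> h * real n" using m(2) ypos(2) unfolding y_def by simp
    then have "m \<le> card (class_nonnbrs n c G v j)" using big(2) by linarith
    then obtain W where W: "W \<subseteq> class_nonnbrs n c G v j" "card W = m" by (meson obtain_subset_with_card_n)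
    let ?G0 = "attach G ?H v"
    have finW: "finite W" using W(1) class_sets_finite(1) finite_subset by blast
    have "real (card W) * (y / real k) ^ (k - 1) \<le> real (card (extra1 n ?G0 (class_nonnbrs n c ?G0 v i) v))"
    proof (rule extra1_lower[OF attached_to_attach[OF G] \<phi>(1,3) i12])
      show "W \<subseteq> class_nonnbrs n c ?G0 v (\<phi> i2)" using W(1) \<phi>(4) by simp
      show "real k \<le> y" by (rule yk)
      show "y \<le> real (card (class_nonnbrs n c ?G0 v i))" using big(1) ypos unfolding y_def by simp
      have "card {w. w < n \<and> w \<noteq> v \<and> c w = \<phi> i2} - card W \<le> card ({w. w < n \<and> w \<noteq> v \<and> c w = \<phi> i2} - W)"
        by (rule diff_card_le_card_Diff[OF finW])
      then have "real (card {w. w < n \<and> w \<noteq> v \<and> c w = \<phi> i2}) - real m \<le> real (card ({w. w < n \<and> w \<noteq> v \<and> c w = \<phi> i2} - W))"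
        using W(2) by linarith
      then show "y \<le> real (card ({w. w < n \<and> w \<noteq> v \<and> c w = \<phi> i2} - W))"
        using class_minus[where v = v and j = j] szB[OF ij(2)] m(2) ypos unfolding \<phi>(4) y_def by linarith
      fix l assume "l < r"
      then have "\<phi> l \<in> B" using \<phi>(2) by auto
      then show "y \<le> real (card {w. w < n \<and> w \<noteq> v \<and> c w = \<phi> l})"
        using class_minus[where v = v and j = "\<phi> l"] szB[of "\<phi> l"] ypos unfolding y_def by linarith
    qed
    moreover have "(y / real k) ^ k \<le> real (card W) * (y / real k) ^ (k - 1)"
    proof -
      have "y / real k \<le> y" using ypos k_ge_3 by (simp add: field_simps)
      then have "y / real k \<le> real (card W)" using m(1) W(2) by simp
      then have "(y / real k) * (y / real k) ^ (k - 1) \<le> real (card W) * (y / real k) ^ (k - 1)"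
        using ypos by (intro mult_right_mono) auto
      then show ?thesis using k_pos by (simp add: power_eq_if)
    qed
    moreover have "real (card (extra1 n ?G0 (class_nonnbrs n c ?G0 v i) v)) \<le> 6 * \<mu> * real n ^ k"
      using close_extras[OF cl v, of i] by simp
    ultimately show False using ykpow by linarith
  qed
  have few_nbrs: "real (card (class_nbrs n c G v i)) < h * real n"
    if v: "v < n" and i: "i \<in> B" and big: "real (card (class_nonnbrs n c G v i)) \<ge> h * real n" for v i
  proof (rule ccontr)
    assume "\<not> ?thesis"
    then have nb: "real (card (class_nbrs n c G v i)) \<ge> h * real n" by simp
    have "card B \<ge> 2" using rB r2 by simp
    then have "\<not> B \<subseteq> {i}" using card_mono[of "{i}" B] by auto
    then obtain j where j: "j \<in> B" "i \<noteq> j" by blast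
    obtain \<phi> where \<phi>: "inj_on \<phi> {0..<r}" "\<phi> ` {0..<r} \<subseteq> B" "\<phi> i1 = i" "\<phi> i2 = j"
      using inj_on_with_two_values[OF finB rB i j i12(1-3)] by blast
    let ?G0 = "attach G ?H v"
    have "real (card (class_nbrs n c ?G0 v i) choose a i2) * (y / real k) ^ (k - a i2)
      \<le> real (card (extra2 n ?G0 (class_nonnbrs n c ?G0 v i) v))"
    proof (rule extra2_lower[OF attached_to_attach[OF G] v \<phi>(1,3) i12 subset_refl yk])
      show "y \<le> real (card (class_nonnbrs n c ?G0 v i))" using big ypos unfolding y_def by simp
      fix l assume l: "l < r" "l \<noteq> i1" "l \<noteq> i2"
      then have lB: "\<phi> l \<in> B" using \<phi>(2) by auto
      have "\<phi> l \<noteq> i" using inj_on_eq_iff[OF \<phi>(1), of l i1] l i12 \<phi>(3) by auto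
      then have "real (card (class_nonnbrs n c G v (\<phi> l))) < h * real n"
        using only_one[OF v lB i _ big] by linarith
      then show "y \<le> real (card (class_nbrs n c ?G0 v (\<phi> l)))"
        using class_split[where v = v and j = "\<phi> l"] szB[OF lB] hn unfolding y_def by simp
    qed
    moreover have "(y / real k) ^ a i2 \<le> real (card (class_nbrs n c ?G0 v i) choose a i2)"
      using nb ypos yk a_le_k[OF i12(2)] k_pos by (intro choose_ge_power) (auto simp: y_def)
    then have "(y / real k) ^ a i2 * (y / real k) ^ (k - a i2) \<le>
       real (card (class_nbrs n c ?G0 v i) choose a i2) * (y / real k) ^ (k - a i2)"
      using ypos by (intro mult_right_mono) auto
    moreover have "(y / real k) ^ a i2 * (y / real k) ^ (k - a i2) = (y / real k) ^ k"
      using a_le_k[OF i12(2)] by (simp flip: power_add)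
    moreover have "real (card (extra2 n ?G0 (class_nonnbrs n c ?G0 v i) v)) \<le> 6 * \<mu> * real n ^ k"
      using close_extras[OF cl v, of i] by simp
    ultimately show False using ykpow by linarith
  qed
  have cardB: "real (card B) * (\<nu> / 2) \<le> 1"
  proof -
    have "real (card B) * (\<nu> / 2 * real n) = (\<Sum>j\<in>B. \<nu> / 2 * real n)" by simp
    also have "\<dots> \<le> (\<Sum>j\<in>B. real (sz j))" unfolding B_def by (intro sum_mono) auto
    also have "\<dots> \<le> (\<Sum>j\<in>c ` {0..<n}. real (sz j))" unfolding B_def by (intro sum_mono2) auto
    also have "\<dots> = real (\<Sum>j\<in>c ` {0..<n}. card {x\<in>{0..<n}. c x = j})" unfolding sz_def by simp
    also have "\<dots> = real n" by (subst sum_class_sizes) auto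
    finally show ?thesis using n by simp
  qed
  \<comment> \<open>There are at most 2 / \<nu> classes in \<open>B\<close>, so if each held fewer
    than \<open>h n\<close> non-neighbours, \<open>h \<le> \<nu> ^ 2 / 16\<close> would leave at
    most \<nu> n / 8 of them apart from the atypical ones.\<close>
  have exist: "\<exists>i\<in>B. real (card (class_nonnbrs n c G v i)) \<ge> h * real n" if v: "v < n" for v
  proof (rule ccontr)
    assume "\<not> ?thesis"
    then have small: "real (card (class_nonnbrs n c G v i)) \<le> h * real n" if "i \<in> B" for i using that by force
    have "nonnbrs n G v \<subseteq> At \<union> (\<Union>i\<in>B. class_nonnbrs n c G v i)"
      unfolding nonnbrs_def class_nonnbrs_def using bigB by blast
    then have "card (nonnbrs n G v) \<le> card (At \<union> (\<Union>i\<in>B. class_nonnbrs n c G v i))"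
      using finAt finB by (intro card_mono) auto
    also have "\<dots> \<le> card At + (\<Sum>i\<in>B. card (class_nonnbrs n c G v i))"
      using card_Un_le[of At "\<Union>i\<in>B. class_nonnbrs n c G v i"] card_UN_le[OF finB, of "class_nonnbrs n c G v"]
      by linarith
    finally have "real (card (nonnbrs n G v)) \<le> real (card At) + (\<Sum>i\<in>B. real (card (class_nonnbrs n c G v i)))"
      by (simp only: of_nat_sum[symmetric] of_nat_add[symmetric] of_nat_le_iff)
    also have "(\<Sum>i\<in>B. real (card (class_nonnbrs n c G v i))) \<le> (\<Sum>i\<in>B. h * real n)"
      using small by (rule sum_mono)
    also have "(\<Sum>i\<in>B. h * real n) = real (card B) * (h * real n)" by simp
    also have "\<dots> \<le> real (card B) * (\<nu> ^ 2 / 16 * real n)" using h(2) by (intro mult_left_mono mult_right_mono) auto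
    also have "\<dots> = (real (card B) * (\<nu> / 2)) * (\<nu> / 8 * real n)" by (simp add: power2_eq_square)
    also have "\<dots> \<le> 1 * (\<nu> / 8 * real n)" using cardB \<nu> by (intro mult_right_mono) auto
    finally show False using nn[OF v] cardAt \<mu>n \<nu>n hn by simp
  qed
  \<comment> \<open>The choice is unique by \<open>only_one\<close>. Typical vertices keep their
    colour, so the classes of \<open>B\<close> stay large.\<close>
  define c2 where "c2 v = (SOME i. i \<in> B \<and> real (card (class_nonnbrs n c G v i)) \<ge> h * real n)" for v
  have c2: "c2 v \<in> B \<and> real (card (class_nonnbrs n c G v (c2 v))) \<ge> h * real n" if "v < n" for v
    unfolding c2_def by (rule someI_ex) (use exist[OF that] in blast)
  have c2_typ: "c2 u = c u" if u: "u < n" "u \<notin> At" for u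
  proof -
    have "class_nbrs n c G u (c u) \<subseteq> {w. {u, w} \<in> ?D}"
      unfolding class_nbrs_def Dsym[OF u(1)] by auto
    moreover have "finite {w. {u, w} \<in> ?D}" unfolding Dsym[OF u(1)] by simp
    ultimately have "card (class_nbrs n c G u (c u)) \<le> card {w. {u, w} \<in> ?D}" by (intro card_mono)
    then have "real (card (class_nbrs n c G u (c u))) \<le> \<mu> * real n" using typical[OF u] by linarith
    then have "real (card (class_nonnbrs n c G u (c u))) \<ge> h * real n"
      using class_split[where v = u and j = "c u"] szB[OF bigB[OF u]] \<mu>n hn by linarith
    then show ?thesis using only_one[OF u(1)] c2[OF u(1)] bigB[OF u] by blast
  qed
  let ?H2 = "cmp_graph n c2"
  let ?D2 = "ediff G ?H2"
  note D2 = ediff_edges[OF G graph_on_cmp_graph[of n c2]]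
  \<comment> \<open>A wrong pair at \<open>v\<close> leads to an atypical vertex, to a neighbour in
    the new class of \<open>v\<close>, or to a non-neighbour in another class: at most \<mu> n, h n
    and 2 h n / \<nu> of them.\<close>
  have deg2: "real (edge_deg ?D2 v) \<le> 4 / \<nu> * h * real n" if v: "v < n" for v
  proof -
    let ?X = "At \<union> class_nbrs n c G v (c2 v)" and ?Y = "\<Union>j\<in>B - {c2 v}. class_nonnbrs n c G v j"
    have "{w. {v, w} \<in> ?D2} \<subseteq> ?X \<union> ?Y"
    proof
      fix w assume "w \<in> {w. {v, w} \<in> ?D2}"
      then have e: "{v, w} \<in> ?D2" by simp
      have w: "w < n" "w \<noteq> v" using D2(1)[OF e] by (cases "w = v"; auto)+
      have e2: "({v, w} \<in> G) \<noteq> (c2 v \<noteq> c2 w)"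
        using e v w unfolding ediff_def by (auto simp: cmp_graph_pair)
      show "w \<in> ?X \<union> ?Y"
      proof (cases "w \<in> At")
        case False
        then have cw: "c2 w = c w" "c w \<in> B" using c2_typ bigB w(1) by auto
        show ?thesis
        proof (cases "{v, w} \<in> G")
          case True
          then show ?thesis using e2 cw w unfolding class_nbrs_def by auto
        next
          case False
          then show ?thesis using e2 cw w unfolding class_nonnbrs_def by auto
        qed
      qed simp
    qed
    then have "card {w. {v, w} \<in> ?D2} \<le> card (?X \<union> ?Y)" using finAt finB by (intro card_mono) auto
    also have "\<dots> \<le> card At + card (class_nbrs n c G v (c2 v)) + (\<Sum>j\<in>B - {c2 v}. card (class_nonnbrs n c G v j))"
      using card_Un_le[of ?X ?Y] card_Un_le[of At "class_nbrs n c G v (c2 v)"]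
        card_UN_le[of "B - {c2 v}" "class_nonnbrs n c G v"] finB by simp
    finally have "real (card {w. {v, w} \<in> ?D2}) \<le> real (card At) + real (card (class_nbrs n c G v (c2 v)))
        + (\<Sum>j\<in>B - {c2 v}. real (card (class_nonnbrs n c G v j)))"
      by (simp only: of_nat_sum[symmetric] of_nat_add[symmetric] of_nat_le_iff)
    also have "(\<Sum>j\<in>B - {c2 v}. real (card (class_nonnbrs n c G v j))) \<le> (\<Sum>j\<in>B - {c2 v}. h * real n)"
    proof (rule sum_mono)
      fix j assume j: "j \<in> B - {c2 v}"
      then show "real (card (class_nonnbrs n c G v j)) \<le> h * real n"
        using only_one[OF v, of j "c2 v"] c2[OF v] by force
    qed
    also have "\<dots> \<le> real (card B) * (h * real n)"
      using finB h by (simp add: card_Diff1_le mult_right_mono)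
    also have "\<dots> \<le> 2 / \<nu> * (h * real n)"
      using cardB \<nu> h by (intro mult_right_mono) (auto simp: field_simps)
    finally have 1: "real (card {w. {v, w} \<in> ?D2}) \<le> real (card At) + real (card (class_nbrs n c G v (c2 v))) + 2 / \<nu> * (h * real n)"
      by simp
    have "h * real n \<le> 1 / \<nu> * (h * real n)"
      using mult_right_mono[of 1 "1 / \<nu>" "h * real n"] \<nu> h by simp
    moreover have "2 / \<nu> * (h * real n) = 2 * (1 / \<nu> * (h * real n))" "4 / \<nu> * h * real n = 4 * (1 / \<nu> * (h * real n))"
      by simp_all
    moreover have "real (card (class_nbrs n c G v (c2 v))) < h * real n" using few_nbrs[OF v] c2[OF v] by blast
    ultimately show ?thesis
      using 1 cardAt \<mu>n hn edge_deg_eq_card_nbrs[of ?D2 v] D2(1) by simp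
  qed
  have size2: "real (card {w. w < n \<and> c2 w = j}) \<ge> \<nu> / 4 * real n" if j: "j \<in> B" for j
  proof -
    have "{w. w < n \<and> c w = j} - At \<subseteq> {w. w < n \<and> c2 w = j}" using c2_typ by auto
    then have "card ({w. w < n \<and> c w = j} - At) \<le> card {w. w < n \<and> c2 w = j}" by (intro card_mono) auto
    moreover have "sz j - card At \<le> card ({w. w < n \<and> c w = j} - At)"
      unfolding sz_def by (rule diff_card_le_card_Diff[OF finAt])
    ultimately have "real (sz j) - real (card At) \<le> real (card {w. w < n \<and> c2 w = j})" by linarith
    moreover have "real (sz j) \<ge> \<nu> / 2 * real n" using j unfolding B_def by simp
    ultimately show ?thesis using cardAt \<mu>n \<nu>n hn by linarith
  qed
  show ?thesis using finB rB c2 size2 deg2 by (intro exI[of _ c2] exI[of _ B]) auto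
qed

end

section \<open>Flipping a single pair\<close>

lemma in_ediff: "e \<in> ediff A B \<longleftrightarrow> (e \<in> A) \<noteq> (e \<in> B)"
  unfolding ediff_def by blast

context multipartite_pattern
begin

definition sets_at :: "nat \<Rightarrow> nat \<Rightarrow> nat set set" where
  "sets_at n v = {S. S \<subseteq> {0..<n} \<and> card S = k \<and> v \<in> S}"

lemma finite_sets_at [simp]: "finite (sets_at n v)"
  unfolding sets_at_def by (rule finite_subset[of _ "Pow {0..<n}"]) auto

lemma card_copies_at:
  "real (card {S \<in> copies n G. v \<in> S}) = (\<Sum>S\<in>sets_at n v. of_bool (copy G S))"
proof -
  have "{S \<in> copies n G. v \<in> S} = {S \<in> sets_at n v. copy G S}"
    unfolding copies_def sets_at_def using copy_card by blast
  then show ?thesis by (simp add: of_bool_def sum.inter_filter[symmetric])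
qed

lemma ind_diff_at:
  assumes "\<And>S. v \<notin> S \<Longrightarrow> S \<subseteq> {0..<n} \<Longrightarrow> copy G S \<longleftrightarrow> copy G' S"
  shows "ind n G' - ind n G = (\<Sum>S\<in>sets_at n v. of_bool (copy G' S) - of_bool (copy G S))"
proof -
  have split: "ind n X = real (card {S \<in> copies n X. v \<in> S}) + real (card {S \<in> copies n X. v \<notin> S})" for X
  proof -
    have "copies n X = {S \<in> copies n X. v \<in> S} \<union> {S \<in> copies n X. v \<notin> S}" by blast
    moreover have "{S \<in> copies n X. v \<in> S} \<inter> {S \<in> copies n X. v \<notin> S} = {}" by blast
    ultimately have "card (copies n X) = card {S \<in> copies n X. v \<in> S} + card {S \<in> copies n X. v \<notin> S}"
      using card_Un_disjoint[of "{S \<in> copies n X. v \<in> S}" "{S \<in> copies n X. v \<notin> S}"] by simp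
    then show ?thesis unfolding ind_def by simp
  qed
  have "{S \<in> copies n G. v \<notin> S} = {S \<in> copies n G'. v \<notin> S}"
    unfolding copies_def using assms by blast
  then show ?thesis unfolding split card_copies_at by (simp add: sum_subtractf)
qed

text \<open>To first order, flipping a star at \<open>v\<close> changes the degree of \<open>v\<close> by the sum of the effects of
  the single flips.\<close>

lemma star_deg:
  assumes v: "v < n" and Y: "Y \<subseteq> {0..<n} - {v}"
  shows "(\<Sum>y\<in>Y. ind n (ediff H {{v, y}}) - ind n H) \<le>
    deg n (ediff H ((\<lambda>y. {v, y}) ` Y)) v - deg n H v + 2 * real (card Y) ^ 2 * (real n ^ k / real n ^ 3)"
proof -
  let ?st = "ediff H ((\<lambda>y. {v, y}) ` Y)" and ?Hy = "\<lambda>y. ediff H {{v, y}}"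
  let ?chi = "\<lambda>G S. of_bool (copy G S) :: real"
  let ?P = "\<lambda>S. {z \<in> Y \<times> Y. fst z \<noteq> snd z \<and> fst z \<in> S \<and> snd z \<in> S}"
  have finY: "finite Y" using Y finite_subset by blast
  have n: "n > 0" using v by simp
  have loc: "copy H S \<longleftrightarrow> copy (?Hy y) S" if "v \<notin> S \<or> y \<notin> S" for y S
    by (rule copy_cong) (use that in \<open>auto simp: in_ediff doubleton_eq_iff\<close>)
  have diff: "ind n (?Hy y) - ind n H = (\<Sum>S\<in>sets_at n v. ?chi (?Hy y) S - ?chi H S)" for y
    by (rule ind_diff_at) (use loc in blast)
  \<comment> \<open>If \<open>S\<close> meets \<open>Y\<close> in at most one vertex, the star acts
    on \<open>S\<close> like a single flip or not at all. Larger intersections are charged to the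
    ordered pairs in \<open>?P S\<close>.\<close>
  have per: "(\<Sum>y\<in>Y. ?chi (?Hy y) S - ?chi H S) \<le> ?chi ?st S - ?chi H S + 2 * real (card (?P S))" for S
  proof -
    let ?Q = "S \<inter> Y"
    have finQ: "finite ?Q" using finY by simp
    have "(\<Sum>y\<in>Y. ?chi (?Hy y) S - ?chi H S) = (\<Sum>y\<in>?Q. ?chi (?Hy y) S - ?chi H S)"
    proof (rule sum.mono_neutral_right[OF finY])
      show "\<forall>y\<in>Y - ?Q. ?chi (?Hy y) S - ?chi H S = 0" using loc by auto
    qed auto
    moreover have "(\<Sum>y\<in>?Q. ?chi (?Hy y) S - ?chi H S) \<le> ?chi ?st S - ?chi H S + 2 * real (card (?P S))"
    proof -
      consider "?Q = {}" | y where "?Q = {y}" | "card ?Q \<ge> 2"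
      proof -
        have "card ?Q = 0 \<or> card ?Q = 1 \<or> card ?Q \<ge> 2" by linarith
        then show ?thesis using finQ that by (metis card_0_eq card_1_singletonE)
      qed
      then show ?thesis
      proof cases
        case 1
        have "copy ?st S \<longleftrightarrow> copy H S"
        proof (rule copy_cong)
          fix x y assume "x \<in> S" "y \<in> S"
          then have "{x, y} \<notin> (\<lambda>y. {v, y}) ` Y" using 1 by (auto simp: doubleton_eq_iff)
          then show "({x, y} \<in> ?st) = ({x, y} \<in> H)" unfolding in_ediff by blast
        qed
        then show ?thesis using 1 by simp
      next
        case (2 y)
        have "copy ?st S \<longleftrightarrow> copy (?Hy y) S"
        proof (rule copy_cong)
          fix x z assume xz: "x \<in> S" "z \<in> S" "x \<noteq> z"
          have "{x, z} \<in> (\<lambda>y. {v, y}) ` Y \<longleftrightarrow> {x, z} = {v, y}"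
          proof
            assume "{x, z} \<in> (\<lambda>y. {v, y}) ` Y"
            then obtain y' where y': "y' \<in> Y" "{x, z} = {v, y'}" by blast
            then have "y' \<in> S" using xz by (auto simp: doubleton_eq_iff)
            then have "y' = y" using y'(1) 2 by blast
            then show "{x, z} = {v, y}" using y'(2) by simp
          next
            assume "{x, z} = {v, y}"
            moreover have "y \<in> Y" using 2 by blast
            ultimately show "{x, z} \<in> (\<lambda>y. {v, y}) ` Y" by blast
          qed
          then show "({x, z} \<in> ?st) = ({x, z} \<in> ?Hy y)" unfolding in_ediff by simp
        qed
        then show ?thesis unfolding 2 by simp
      next
        case 3
        have "?P S = (?Q \<times> ?Q) - (\<lambda>y. (y, y)) ` ?Q" by auto
        then have "card (?P S) = card (?Q \<times> ?Q) - card ((\<lambda>y. (y, y)) ` ?Q)"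
          using finQ by (simp only:) (rule card_Diff_subset, auto)
        also have "card ((\<lambda>y. (y, y)) ` ?Q) = card ?Q" by (intro card_image) (simp add: inj_on_def)
        finally have "card (?P S) = card ?Q * card ?Q - card ?Q" by (simp add: card_cartesian_product)
        moreover have "2 * card ?Q \<le> card ?Q * card ?Q" using 3 by (intro mult_right_mono) auto
        ultimately have P: "card (?P S) \<ge> card ?Q" by linarith
        have "(\<Sum>y\<in>?Q. ?chi (?Hy y) S - ?chi H S) \<le> (\<Sum>y\<in>?Q. 1)"
          by (rule sum_mono) (simp add: of_bool_def)
        also have "\<dots> = real (card ?Q)" by simp
        finally have "(\<Sum>y\<in>?Q. ?chi (?Hy y) S - ?chi H S) \<le> real (card ?Q)" .
        moreover have "?chi ?st S - ?chi H S \<ge> -1" by (simp add: of_bool_def)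
        ultimately show ?thesis using P 3 by linarith
      qed
    qed
    ultimately show ?thesis by simp
  qed
  have pairs: "(\<Sum>S\<in>sets_at n v. real (card (?P S))) \<le> real (card Y) ^ 2 * (real n ^ k / real n ^ 3)"
  proof -
    let ?Z = "{z \<in> Y \<times> Y. fst z \<noteq> snd z}"
    have "(\<Sum>z\<in>?Z. card {S\<in>sets_at n v. fst z \<in> S \<and> snd z \<in> S}) =
        (\<Sum>S\<in>sets_at n v. card {z\<in>?Z. fst z \<in> S \<and> snd z \<in> S})"
      by (rule sum_multicount_gen) (use finY in auto)
    also have "\<dots> = (\<Sum>S\<in>sets_at n v. card (?P S))"
      by (intro sum.cong refl arg_cong[of _ _ card]) blast
    finally have "(\<Sum>S\<in>sets_at n v. real (card (?P S))) =
        (\<Sum>z\<in>?Z. real (card {S\<in>sets_at n v. fst z \<in> S \<and> snd z \<in> S}))"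
      by (simp only: of_nat_sum[symmetric])
    also have "\<dots> \<le> (\<Sum>z\<in>?Z. real n ^ k / real n ^ 3)"
    proof (rule sum_mono)
      fix z assume z: "z \<in> ?Z"
      then have "v \<noteq> fst z" "v \<noteq> snd z" "fst z \<noteq> snd z" using Y by auto
      then have c3: "card {v, fst z, snd z} = 3" by simp
      have "real (card {S\<in>sets_at n v. fst z \<in> S \<and> snd z \<in> S}) \<le> real n ^ k / real n ^ card {v, fst z, snd z}"
        by (rule card_supersets_le) (use n in \<open>auto simp: sets_at_def\<close>)
      then show "real (card {S\<in>sets_at n v. fst z \<in> S \<and> snd z \<in> S}) \<le> real n ^ k / real n ^ 3"
        unfolding c3 .
    qed
    also have "\<dots> = real (card ?Z) * (real n ^ k / real n ^ 3)" by simp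
    also have "\<dots> \<le> real (card Y) ^ 2 * (real n ^ k / real n ^ 3)"
    proof (rule mult_right_mono)
      have "card ?Z \<le> card (Y \<times> Y)" using finY by (intro card_mono) auto
      then have "real (card ?Z) \<le> real (card (Y \<times> Y))" by simp
      then show "real (card ?Z) \<le> real (card Y) ^ 2" by (simp add: card_cartesian_product power2_eq_square)
    qed simp
    finally show ?thesis .
  qed
  have "(\<Sum>y\<in>Y. ind n (?Hy y) - ind n H) = (\<Sum>S\<in>sets_at n v. \<Sum>y\<in>Y. ?chi (?Hy y) S - ?chi H S)"
    unfolding diff by (rule sum.swap)
  also have "\<dots> \<le> (\<Sum>S\<in>sets_at n v. ?chi ?st S - ?chi H S + 2 * real (card (?P S)))"
    by (rule sum_mono) (rule per)
  also have "\<dots> = deg n ?st v - deg n H v + 2 * (\<Sum>S\<in>sets_at n v. real (card (?P S)))"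
    unfolding deg_def card_copies_at by (simp add: sum.distrib sum_subtractf sum_distrib_left)
  finally show ?thesis using pairs by linarith
qed

section \<open>The cost of a flip in a complete multipartite graph\<close>

lemma ind_le_iso:
  assumes \<pi>: "bij_betw \<pi> {0..<n} {0..<n}"
    and adj: "\<And>x y. x < n \<Longrightarrow> y < n \<Longrightarrow> x \<noteq> y \<Longrightarrow> {x, y} \<in> G \<longleftrightarrow> {\<pi> x, \<pi> y} \<in> G'"
  shows "ind n G \<le> ind n G'"
proof -
  have inj: "inj_on \<pi> {0..<n}" and im: "\<pi> ` {0..<n} = {0..<n}" using \<pi> by (simp_all add: bij_betw_def)
  have "inj_on (\<lambda>S. \<pi> ` S) (copies n G)"
  proof (rule inj_onI)
    fix S T assume "S \<in> copies n G" "T \<in> copies n G" "\<pi> ` S = \<pi> ` T"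
    then show "S = T" using inj_on_image_eq_iff[OF inj] copiesD by metis
  qed
  moreover have "(\<lambda>S. \<pi> ` S) ` copies n G \<subseteq> copies n G'"
  proof
    fix S' assume "S' \<in> (\<lambda>S. \<pi> ` S) ` copies n G"
    then obtain S where S: "S \<in> copies n G" "S' = \<pi> ` S" by blast
    note SD = copiesD[OF S(1)]
    have "bij_betw \<pi> S S'" unfolding S(2) bij_betw_def using inj_on_subset[OF inj] SD by blast
    then have "copy G' S'"
    proof (rule copy_iso[OF conjunct2[OF conjunct2[OF conjunct2[OF SD]]]])
      fix x y assume "x \<in> S" "y \<in> S" "x \<noteq> y"
      moreover from this have "x < n" "y < n" using SD by auto
      ultimately show "({x, y} \<in> G) = ({\<pi> x, \<pi> y} \<in> G')" using adj by blast
    qed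
    moreover have "S' \<subseteq> {0..<n}" using S(2) SD im by blast
    ultimately show "S' \<in> copies n G'" unfolding copies_def by blast
  qed
  ultimately have "card (copies n G) \<le> card (copies n G')"
    by (intro card_inj_on_le[of "\<lambda>S. \<pi> ` S"]) auto
  then show ?thesis unfolding ind_def by simp
qed

text \<open>Transposing \<open>y\<close> and \<open>y'\<close> is an automorphism of the complete
  multipartite graph. A star into one class therefore consists of equally costly flips.\<close>

lemma ind_flip_same_class:
  assumes "y < n" "y' < n" "y \<noteq> v" "y' \<noteq> v" "c y = c y'"
  shows "ind n (ediff (cmp_graph n c) {{v, y}}) = ind n (ediff (cmp_graph n c) {{v, y'}})"
proof -
  have "ind n (ediff (cmp_graph n c) {{v, y}}) \<le> ind n (ediff (cmp_graph n c) {{v, y'}})"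
    if h: "y < n" "y' < n" "y \<noteq> v" "y' \<noteq> v" "c y = c y'" for y y'
  proof (rule ind_le_iso)
    let ?t = "Transposition.transpose y y'"
    show "bij_betw ?t {0..<n} {0..<n}"
      using h by (intro bij_betwI[of _ _ _ ?t]) (auto simp: Transposition.transpose_def)
    fix x z assume xz: "x < n" "z < n" "x \<noteq> z"
    have lt: "?t w < n" if "w < n" for w using that h by (auto simp: Transposition.transpose_def)
    have col: "c (?t w) = c w" for w using h(5) by (auto simp: Transposition.transpose_def)
    have tv: "?t v = v" "?t y = y'" using h by (auto simp: Transposition.transpose_def)
    have inj: "?t p = ?t q \<longleftrightarrow> p = q" for p q by (metis transpose_involutory)
    have "{?t x, ?t z} = {v, y'} \<longleftrightarrow> {?t x, ?t z} = {?t v, ?t y}" unfolding tv ..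
    also have "\<dots> \<longleftrightarrow> {x, z} = {v, y}" unfolding doubleton_eq_iff inj ..
    finally have 1: "{?t x, ?t z} = {v, y'} \<longleftrightarrow> {x, z} = {v, y}" .
    have 2: "{?t x, ?t z} \<in> cmp_graph n c \<longleftrightarrow> {x, z} \<in> cmp_graph n c"
      unfolding cmp_graph_pair col using lt xz by blast
    show "({x, z} \<in> ediff (cmp_graph n c) {{v, y}}) = ({?t x, ?t z} \<in> ediff (cmp_graph n c) {{v, y'}})"
      unfolding in_ediff 2 singleton_iff 1 ..
  qed
  from this[OF assms] this[OF assms(2,1,4,3) assms(5)[symmetric]] show ?thesis by linarith
qed

lemma graph_on_ediff: "graph_on n G \<Longrightarrow> graph_on n G' \<Longrightarrow> graph_on n (ediff G G')"
  unfolding graph_on_def ediff_def by blast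

lemma graph_on_star: "v < n \<Longrightarrow> Y \<subseteq> {0..<n} - {v} \<Longrightarrow> graph_on n ((\<lambda>y. {v, y}) ` Y)"
  unfolding graph_on_def by (auto simp: card_insert_if)

text \<open>If one flip were cheap, the whole star would be, so \<open>v\<close> would still have
  nearly the degree of the members of its class; merging it with them would then collect the extras
  and exceed the maximum. The choice \<open>\<tau> = c3 / 32\<close> brings the quadratic error 8
  \<tau> ^ 2 down to a quarter of c3 \<tau>.\<close>

lemma star_loss:
  fixes \<rho> \<tau> c3 :: real
  assumes v: "v < n" and Y: "Y \<subseteq> {0..<n} - {v}" "\<And>y. y \<in> Y \<Longrightarrow> c y = c y0" and y0: "y0 < n" "y0 \<noteq> v"
    and near: "maxind n \<le> ind n (cmp_graph n c) + \<rho> * real n ^ k"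
    and dd: "\<And>x x'. x < n \<Longrightarrow> x' < n \<Longrightarrow> deg n (cmp_graph n c) x - deg n (cmp_graph n c) x' \<le> \<rho> * (real n ^ k / real n)"
    and \<rho>: "\<rho> * real n \<ge> 1" "8 * \<rho> < c3 * \<tau>" and \<tau>: "\<tau> = c3 / 32" "c3 > 0"
    and cardY: "real (card Y) \<ge> \<tau> * real n" "real (card Y) \<le> 2 * \<tau> * real n"
  defines "G0 \<equiv> ediff (cmp_graph n c) ((\<lambda>y. {v, y}) ` Y)"
  defines "U \<equiv> class_nonnbrs n c G0 v (c v)"
  assumes UY: "U \<inter> Y = {}"
    and extras: "real (card Y) * (c3 * (real n ^ k / real n)) \<le> real (card (extra1 n G0 U v)) + real (card (extra2 n G0 U v))"
  shows "ind n (ediff (cmp_graph n c) {{v, y0}}) - ind n (cmp_graph n c) \<le> - (c3 / 8 * (real n ^ k / real n ^ 2))"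
proof (rule ccontr)
  assume neg: "\<not> ?thesis"
  let ?H = "cmp_graph n c" and ?st = "(\<lambda>y. {v, y}) ` Y"
  define K1 where "K1 = real n ^ k / real n"
  define \<delta> where "\<delta> = ind n (ediff ?H {{v, y0}}) - ind n ?H"
  have n: "n > 0" using v by simp
  have K1: "K1 > 0" "K1 * real n = real n ^ k" unfolding K1_def using n by simp_all
  have N2: "real n ^ k / real n ^ 2 = K1 / real n" and N3: "real n ^ k / real n ^ 3 = K1 / real n ^ 2"
    unfolding K1_def using n by (simp_all add: power2_eq_square power3_eq_cube)
  have \<delta>: "\<delta> > - (c3 / 8 * (K1 / real n))" using neg unfolding \<delta>_def N2 by simp
  have \<rho>pos: "\<rho> > 0" using \<rho>(1) n by (smt (verit) mult_nonpos_nonneg of_nat_0_le_iff)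
  have \<tau>pos: "\<tau> > 0" using \<tau> by simp
  have finY: "finite Y" using Y finite_subset by blast
  have G0: "graph_on n G0" unfolding G0_def by (intro graph_on_ediff graph_on_cmp_graph graph_on_star v Y)
  have ed: "ediff ?H G0 = ?st" unfolding G0_def ediff_def by blast
  have att: "attached_to n c v G0" unfolding attached_to_def
  proof (intro conjI G0 allI impI)
    fix x y assume "x < n" "y < n" "x \<noteq> v" "y \<noteq> v"
    moreover have "{x, y} \<notin> ?st" using \<open>x \<noteq> v\<close> \<open>y \<noteq> v\<close> by (auto simp: doubleton_eq_iff)
    ultimately show "({x, y} \<in> G0) = (c x \<noteq> c y)" unfolding G0_def in_ediff by (simp add: cmp_graph_pair)
  qed
  have card_st: "real (card ?st) \<le> real n"
  proof -
    have "card ?st \<le> card Y" by (rule card_image_le[OF finY])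
    also have "\<dots> \<le> card {0..<n}" using Y by (intro card_mono) auto
    finally show ?thesis by simp
  qed
  have ind0: "ind n ?H \<le> ind n G0 + \<rho> * real n ^ k"
  proof -
    have "ind n ?H \<le> ind n G0 + real (card ?st) * (K1 / real n)"
      using ind_edit[OF graph_on_cmp_graph[of n c] G0 n] unfolding ed N2 .
    also have "real (card ?st) * (K1 / real n) \<le> real n * (K1 / real n)"
      using card_st K1 by (intro mult_right_mono) auto
    also have "\<dots> = 1 * K1" using n by simp
    also have "\<dots> \<le> (\<rho> * real n) * K1" using \<rho>(1) K1 by (intro mult_right_mono) auto
    also have "\<dots> = \<rho> * real n ^ k" using K1(2) by (simp add: mult_ac)
    finally show ?thesis by simp
  qed
  have degx: "deg n G0 x \<le> deg n ?H x + \<rho> * K1" if x: "x \<in> U" for x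
  proof -
    have "x \<noteq> v" "x \<notin> Y" using x UY unfolding U_def class_nonnbrs_def by auto
    then have e: "{e \<in> ?st. x \<in> e} = {}" by auto
    have "deg n G0 x \<le> deg n ?H x + real (card ?st) * (K1 / real n ^ 2)"
      using deg_edit[OF G0 graph_on_cmp_graph[of n c] n, of x]
      unfolding ediff_commute[of G0 ?H] ed e card.empty of_nat_0 mult_zero_left N3 by simp
    also have "real (card ?st) * (K1 / real n ^ 2) \<le> real n * (K1 / real n ^ 2)"
      using card_st K1 by (intro mult_right_mono) auto
    also have "\<dots> = 1 * (K1 / real n)" using n by (simp add: power2_eq_square)
    also have "\<dots> \<le> (\<rho> * real n) * (K1 / real n)" using \<rho>(1) K1 by (intro mult_right_mono) auto
    also have "\<dots> = \<rho> * K1" using n by simp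
    finally show ?thesis by simp
  qed
  have degv: "real (card Y) * \<delta> \<le> deg n G0 v - deg n ?H v + 8 * \<tau> ^ 2 * K1"
  proof -
    have "(\<Sum>y\<in>Y. ind n (ediff ?H {{v, y}}) - ind n ?H) = (\<Sum>y\<in>Y. \<delta>)"
      unfolding \<delta>_def
    proof (rule sum.cong[OF refl])
      fix y assume y: "y \<in> Y"
      have "ind n (ediff ?H {{v, y}}) = ind n (ediff ?H {{v, y0}})"
        by (rule ind_flip_same_class) (use y Y y0 in auto)
      then show "ind n (ediff ?H {{v, y}}) - ind n ?H = ind n (ediff ?H {{v, y0}}) - ind n ?H" by simp
    qed
    then have 1: "real (card Y) * \<delta> \<le> deg n G0 v - deg n ?H v + 2 * real (card Y) ^ 2 * (K1 / real n ^ 2)"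
      using star_deg[OF v Y(1), of ?H] unfolding G0_def N3 by simp
    have "real (card Y) ^ 2 \<le> (2 * \<tau> * real n) ^ 2" using cardY by (intro power_mono) auto
    then have "2 * real (card Y) ^ 2 * (K1 / real n ^ 2) \<le> 2 * (2 * \<tau> * real n) ^ 2 * (K1 / real n ^ 2)"
      using K1 by (intro mult_right_mono mult_left_mono) auto
    also have "\<dots> = 8 * \<tau> ^ 2 * K1" using n by (simp add: power_mult_distrib)
    finally show ?thesis using 1 by linarith
  qed
  define M where "M = real (card Y) * (c3 / 8 * (K1 / real n)) + 8 * \<tau> ^ 2 * K1 + 2 * \<rho> * K1"
  have M: "M \<ge> 0" unfolding M_def using K1 \<tau> \<rho>pos by (intro add_nonneg_nonneg mult_nonneg_nonneg) auto
  have "(\<Sum>x\<in>U. - M) \<le> (\<Sum>x\<in>U. deg n G0 v - deg n G0 x)"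
  proof (rule sum_mono)
    fix x assume x: "x \<in> U"
    have "x < n" using x unfolding U_def class_nonnbrs_def by simp
    then have "deg n ?H x - deg n ?H v \<le> \<rho> * K1" using dd v unfolding K1_def by blast
    moreover have "real (card Y) * \<delta> \<ge> real (card Y) * (- (c3 / 8 * (K1 / real n)))"
      using \<delta> by (intro mult_left_mono) auto
    ultimately show "- M \<le> deg n G0 v - deg n G0 x" using degx[OF x] degv unfolding M_def by simp
  qed
  moreover have "(\<Sum>x\<in>U. - M) \<ge> - (real n * M)"
  proof -
    have "U \<subseteq> {0..<n}" unfolding U_def class_nonnbrs_def by auto
    then have "real (card U) \<le> real n" using card_mono[of "{0..<n}" U] by simp
    then show ?thesis using M by (simp add: mult_right_mono)
  qed
  moreover have "real n * M = c3 / 8 * (real (card Y) * K1) + 8 * \<tau> ^ 2 * real n ^ k + 2 * \<rho> * real n ^ k"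
    unfolding M_def K1(2)[symmetric] using n by (simp add: algebra_simps)
  moreover have "ind n G0 + (\<Sum>x\<in>U. deg n G0 v - deg n G0 x) + real (card (extra1 n G0 U v)) + real (card (extra2 n G0 U v)) \<le> maxind n"
    unfolding U_def by (rule vertex_merge[OF att v])
  moreover have "real (card Y) * (c3 * (real n ^ k / real n)) = c3 * (real (card Y) * K1)" unfolding K1_def by simp
  ultimately have "c3 * (real (card Y) * K1) \<le> c3 / 8 * (real (card Y) * K1) + 8 * \<tau> ^ 2 * real n ^ k + 4 * \<rho> * real n ^ k"
    using extras near ind0 by linarith
  then have 1: "7 / 8 * c3 * (real (card Y) * K1) \<le> (8 * \<tau> ^ 2 + 4 * \<rho>) * real n ^ k" by (simp add: algebra_simps)
  have "real (card Y) * K1 \<ge> \<tau> * real n * K1" using cardY K1 by (intro mult_right_mono) auto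
  then have "real (card Y) * K1 \<ge> \<tau> * real n ^ k" unfolding K1(2)[symmetric] by (simp add: mult_ac)
  then have "7 / 8 * c3 * (real (card Y) * K1) \<ge> 7 / 8 * c3 * (\<tau> * real n ^ k)" using \<tau> by (intro mult_left_mono) auto
  then have "(7 / 8 * c3 * \<tau>) * real n ^ k \<le> (8 * \<tau> ^ 2 + 4 * \<rho>) * real n ^ k" using 1 by (simp add: mult_ac)
  \<comment> \<open>The right-hand side is below (1/4 + 1/2) c3 \<tau>.\<close>
  then have "7 / 8 * c3 * \<tau> \<le> 8 * \<tau> ^ 2 + 4 * \<rho>" using n by simp
  also have "8 * \<tau> ^ 2 = c3 * \<tau> / 4" unfolding \<tau>(1) by (simp add: power2_eq_square)
  finally show False using \<rho>(2) mult_pos_pos[OF \<tau>(2) \<tau>pos] by linarith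
qed

lemma ind_flip_pair:
  assumes "u \<noteq> w"
  shows "ind n (ediff G {{u, w}}) - ind n G =
    real (card {S \<in> copies n (ediff G {{u, w}}). {u, w} \<subseteq> S}) - real (card {S \<in> copies n G. {u, w} \<subseteq> S})"
proof -
  have split: "ind n X = real (card {S \<in> copies n X. {u, w} \<subseteq> S}) + real (card {S \<in> copies n X. \<not> {u, w} \<subseteq> S})" for X
  proof -
    let ?A = "{S \<in> copies n X. {u, w} \<subseteq> S}" and ?B = "{S \<in> copies n X. \<not> {u, w} \<subseteq> S}"
    have "copies n X = ?A \<union> ?B" "?A \<inter> ?B = {}" by blast+
    then have "card (copies n X) = card ?A + card ?B" using card_Un_disjoint[of ?A ?B] by simp
    then show ?thesis unfolding ind_def by simp
  qed
  have "copy (ediff G {{u, w}}) S \<longleftrightarrow> copy G S" if "\<not> {u, w} \<subseteq> S" for S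
  proof (rule copy_cong)
    fix x y assume "x \<in> S" "y \<in> S"
    then have "{x, y} \<noteq> {u, w}" using that by (auto simp: doubleton_eq_iff)
    then show "({x, y} \<in> ediff G {{u, w}}) = ({x, y} \<in> G)" unfolding in_ediff by simp
  qed
  then have "{S \<in> copies n (ediff G {{u, w}}). \<not> {u, w} \<subseteq> S} = {S \<in> copies n G. \<not> {u, w} \<subseteq> S}"
    unfolding copies_def by blast
  then show ?thesis unfolding split by simp
qed

text \<open>The graphs disagree at the pair, so flipping it in either one produces agreement there
  with the other. Copies through the pair are compared crosswise; each comparison costs 3 \<eta> n ^
  (k - 2), namely \<eta> for the wrong pairs at \<open>u\<close>, at \<open>w\<close> and
  elsewhere.\<close>

lemma flip_contradiction:
  assumes G: "graph_on n G" and n: "n > 0" and uw: "u \<noteq> w" "u < n" "w < n"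
    and bad: "{u, w} \<in> ediff G (cmp_graph n c)"
    and degs: "\<And>v. v < n \<Longrightarrow> real (edge_deg (ediff G (cmp_graph n c)) v) \<le> \<eta> * real n"
    and flip: "ind n (ediff G {{u, w}}) \<le> ind n G + \<mu> * (real n ^ k / real n ^ 2)"
    and loss: "ind n (ediff (cmp_graph n c) {{u, w}}) - ind n (cmp_graph n c) \<le> - (\<kappa> * (real n ^ k / real n ^ 2))"
  shows "\<kappa> \<le> 6 * \<eta> + \<mu>"
proof -
  let ?H = "cmp_graph n c" let ?D = "ediff G ?H" and ?G' = "ediff G {{u, w}}" and ?H' = "ediff ?H {{u, w}}"
  let ?p = "\<lambda>X. real (card {S \<in> copies n X. {u, w} \<subseteq> S})"
  define N2 where "N2 = real n ^ k / real n ^ 2"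
  have N2: "N2 > 0" unfolding N2_def using n by simp
  have N34: "real n ^ k / real n ^ 3 = N2 / real n" "real n ^ k / real n ^ 4 = N2 / real n ^ 2"
    unfolding N2_def using n by (simp_all add: power2_eq_square power3_eq_cube power4_eq_xxxx)
  have e: "graph_on n {{u, w}}" using uw unfolding graph_on_def by auto
  have G': "graph_on n ?G'" and H': "graph_on n ?H'" using G e graph_on_cmp_graph graph_on_ediff by blast+
  note D = ediff_edges[OF G graph_on_cmp_graph[of n c]]
  have cardD: "real (card ?D) \<le> \<eta> * real n ^ 2"
  proof -
    have "2 * real (card ?D) = real (\<Sum>v<n. edge_deg ?D v)" using sum_edge_deg[OF D] by simp
    also have "\<dots> = (\<Sum>v<n. real (edge_deg ?D v))" by simp
    also have "\<dots> \<le> (\<Sum>v<n. \<eta> * real n)" using degs by (intro sum_mono) auto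
    finally have "2 * real (card ?D) \<le> \<eta> * real n ^ 2" by (simp add: power2_eq_square mult_ac)
    then show ?thesis by linarith
  qed
  have err: "?p X \<le> ?p X' + 3 * \<eta> * N2" if X: "graph_on n X" "graph_on n X'" and sub: "ediff X X' = ?D - {{u, w}}" for X X'
  proof -
    have le: "real (card {e \<in> ediff X X'. v \<in> e}) \<le> \<eta> * real n" if "v < n" for v
    proof -
      have "card {e \<in> ediff X X'. v \<in> e} \<le> edge_deg ?D v"
        unfolding edge_deg_def sub using D(2) by (intro card_mono) auto
      then show ?thesis using degs[OF that] by linarith
    qed
    have "card (ediff X X') \<le> card ?D" unfolding sub using D(2) by (intro card_mono) auto
    then have cle: "real (card (ediff X X')) \<le> \<eta> * real n ^ 2" using cardD by linarith
    have ni: "{u, w} \<notin> ediff X X'" unfolding sub by simp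
    have "?p X \<le> ?p X' + (real (card {e \<in> ediff X X'. u \<in> e}) + real (card {e \<in> ediff X X'. w \<in> e})) * (N2 / real n)
      + real (card (ediff X X')) * (N2 / real n ^ 2)"
      using pair_edit[OF X n uw(1) ni] unfolding N34 .
    also have "\<dots> \<le> ?p X' + (\<eta> * real n + \<eta> * real n) * (N2 / real n) + \<eta> * real n ^ 2 * (N2 / real n ^ 2)"
      using le[OF uw(2)] le[OF uw(3)] cle N2 by (intro add_mono mult_right_mono) auto
    also have "\<dots> = ?p X' + 3 * \<eta> * N2" using n by (simp add: field_simps)
    finally show ?thesis .
  qed
  have "?p ?H \<le> ?p ?G' + 3 * \<eta> * N2"
    by (rule err[OF graph_on_cmp_graph G']) (use bad in \<open>auto simp: ediff_def\<close>)
  moreover have "?p G \<le> ?p ?H' + 3 * \<eta> * N2"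
    by (rule err[OF G H']) (use bad in \<open>auto simp: ediff_def\<close>)
  moreover have "?p ?G' - ?p G \<le> \<mu> * N2" using flip ind_flip_pair[OF uw(1), of n G] unfolding N2_def by linarith
  moreover have "?p ?H' - ?p ?H \<le> - (\<kappa> * N2)" using loss ind_flip_pair[OF uw(1), of n ?H] unfolding N2_def by linarith
  ultimately have "\<kappa> * N2 \<le> (6 * \<eta> + \<mu>) * N2" by (simp add: algebra_simps)
  then show ?thesis using N2 by simp
qed

text \<open>When every part of the pattern has at least two vertices, an edge inside a class of a complete
  multipartite graph lies in no copy.\<close>

lemma inner_edge_loss:
  assumes big: "\<forall>i<r. a i \<ge> 2" and uw: "u \<noteq> w" "u < n" "w < n" "c u = c w"
    and \<phi>: "inj_on \<phi> {0..<r}" "\<phi> i1 = c u" and i1: "i1 < r"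
    and y: "y \<ge> real k" "real (card ({x. x < n \<and> c x = c u} - {u, w})) \<ge> y"
      "\<And>j. j < r \<Longrightarrow> j \<noteq> i1 \<Longrightarrow> real (card {x. x < n \<and> c x = \<phi> j}) \<ge> y"
  shows "ind n (ediff (cmp_graph n c) {{u, w}}) - ind n (cmp_graph n c) \<le> - ((y / real k) ^ (k - 2))"
proof -
  let ?H = "cmp_graph n c" let ?H' = "ediff ?H {{u, w}}"
  define B where "B j = {x. x < n \<and> c x = \<phi> j}" for j
  \<comment> \<open>Index \<open>r\<close> carries the pair \<open>{u, w}\<close>, both of whose
    vertices are to be taken.\<close>
  define A where "A j = (if j = i1 then B i1 - {u, w} else if j = r then {u, w} else B j)" for j
  define b where "b j = (if j = i1 then a i1 - 2 else if j = r then 2 else a j)" for j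
  define cl where "cl j = (if j = r then i1 else j)" for j
  let ?J = "{0..r}"
  have ai1: "a i1 \<ge> 2" using big i1 by blast
  have "{S \<in> copies n ?H'. {u, w} \<subseteq> S} = {}"
  proof (rule ccontr)
    assume "\<not> ?thesis"
    then obtain S where S: "S \<in> copies n ?H'" "u \<in> S" "w \<in> S" by blast
    note SD = copiesD[OF S(1)]
    have uwH: "{u, w} \<in> ?H'" unfolding in_ediff using uw by (simp add: cmp_graph_pair)
    \<comment> \<open>A second vertex \<open>x\<close> in the part of \<open>u\<close> lies in the
      same class and would have to be joined to \<open>w\<close> as \<open>u\<close> is, but
      \<open>{u, w}\<close> is the only inner edge.\<close>
    obtain x where x: "x \<in> S" "x \<in> nonnbrs n ?H' u" using copy_has_nonnbr[OF _ _ S(2) big] SD by blast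
    then have xu: "x < n" "x \<noteq> u" "{u, x} \<notin> ?H'" unfolding nonnbrs_def by auto
    then have xw: "x \<noteq> w" using uwH by auto
    have "{u, x} \<noteq> {u, w}" using xw by (auto simp: doubleton_eq_iff)
    then have "c x = c u" using xu uw(2) unfolding in_ediff by (simp add: cmp_graph_pair)
    moreover have "{x, w} \<noteq> {u, w}" using xu(2) by (auto simp: doubleton_eq_iff)
    ultimately have "{x, w} \<notin> ?H'" unfolding in_ediff using uw by (simp add: cmp_graph_pair)
    moreover have "{u, w} \<in> ?H' \<longleftrightarrow> {x, w} \<in> ?H'"
      using copy_twins[of ?H' S u x w] SD S x(1) xu xw uw(1) by blast
    ultimately show False using uwH by blast
  qed
  then have p0: "real (card {S \<in> copies n ?H'. {u, w} \<subseteq> S}) = 0" by (simp only: card.empty)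
  have uwB: "{u, w} \<subseteq> B i1" unfolding B_def using uw \<phi>(2) by auto
  have AB: "A j \<subseteq> B (cl j)" if "j \<le> r" for j
    using that uwB i1 unfolding A_def cl_def by auto
  have cl: "cl j < r" if "j \<le> r" for j using that i1 unfolding cl_def by auto
  have Bcol: "x < n \<and> c x = \<phi> j" if "x \<in> B j" for x j using that unfolding B_def by auto
  have \<phi>eq: "\<phi> (cl j) = \<phi> (cl l) \<longleftrightarrow> cl j = cl l" if "j \<le> r" "l \<le> r" for j l
    using inj_on_eq_iff[OF \<phi>(1)] cl[OF that(1)] cl[OF that(2)] by simp
  have disj: "disjoint_family_on A ?J"
    unfolding disjoint_family_on_def
  proof (intro ballI impI)
    fix j l assume jl: "j \<in> ?J" "l \<in> ?J" "j \<noteq> l"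
    show "A j \<inter> A l = {}"
    proof (cases "cl j = cl l")
      case True
      then have "j = i1 \<and> l = r \<or> j = r \<and> l = i1" using jl i1 unfolding cl_def by (auto split: if_splits)
      then show ?thesis unfolding A_def using i1 by auto
    next
      case False
      then have "\<phi> (cl j) \<noteq> \<phi> (cl l)" using \<phi>eq jl by simp
      moreover have "A j \<subseteq> B (cl j)" "A l \<subseteq> B (cl l)" using AB jl by auto
      ultimately show ?thesis using Bcol by (metis disjoint_iff subsetD)
    qed
  qed
  have A_adj: "{x, y} \<in> ?H \<longleftrightarrow> cl j \<noteq> cl l" if "j \<in> ?J" "l \<in> ?J" "x \<in> A j" "y \<in> A l" "x \<noteq> y" for j l x y
  proof -
    have "x \<in> B (cl j)" "y \<in> B (cl l)" using AB that by auto
    then show ?thesis using Bcol[of x "cl j"] Bcol[of y "cl l"] \<phi>eq that(1,2) by (simp add: cmp_graph_pair)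
  qed
  have b_sum: "(\<Sum>j\<in>{j\<in>?J. cl j = i'}. b j) = a i'" if "i' < r" for i'
  proof (cases "i' = i1")
    case True
    have "{j\<in>?J. cl j = i'} = {i1, r}" using True i1 unfolding cl_def by auto
    then show ?thesis using True i1 ai1 unfolding b_def by simp
  next
    case False
    have "{j\<in>?J. cl j = i'} = {i'}" using False that i1 unfolding cl_def by auto
    then show ?thesis using False that unfolding b_def by simp
  qed
  define F where "F = {S. S \<subseteq> (\<Union>j\<in>?J. A j) \<and> (\<forall>j\<in>?J. card (S \<inter> A j) = b j)}"
  have An: "A j \<subseteq> {0..<n}" if "j \<in> ?J" for j
  proof -
    have "B (cl j) \<subseteq> {0..<n}" unfolding B_def by auto
    then show ?thesis using AB[of j] that by auto
  qed
  have clr: "\<And>j. j \<in> ?J \<Longrightarrow> cl j < r" using cl by simp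
  have Fc: "F \<subseteq> copies n ?H" "card F = (\<Prod>j\<in>?J. card (A j) choose b j)"
    unfolding F_def by (rule pieces_family[OF _ disj An clr b_sum A_adj]; simp)+
  have "F \<subseteq> {S \<in> copies n ?H. {u, w} \<subseteq> S}"
  proof
    fix S assume S: "S \<in> F"
    then have "card (S \<inter> A r) = b r" unfolding F_def by simp
    then have "card (S \<inter> {u, w}) = 2" using i1 unfolding A_def b_def by simp
    then have "S \<inter> {u, w} = {u, w}" using uw(1) by (intro card_subset_eq) auto
    then show "S \<in> {S \<in> copies n ?H. {u, w} \<subseteq> S}" using S Fc(1) by blast
  qed
  then have "card F \<le> card {S \<in> copies n ?H. {u, w} \<subseteq> S}" by (intro card_mono) auto
  moreover have "real (card F) \<ge> (y / real k) ^ (k - 2)"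
  proof -
    have "{0..r} = insert r {0..<r}" by auto
    then have "(\<Prod>j\<in>?J. card (A j) choose b j) = (card (A r) choose b r) * (\<Prod>j\<in>{0..<r}. card (A j) choose b j)"
      by simp
    also have "card (A r) choose b r = 1" unfolding A_def b_def using i1 uw(1) by (simp add: numeral_2_eq_2)
    finally have 1: "real (card F) = real (\<Prod>j\<in>{0..<r}. card (A j) choose b j)"
      unfolding Fc(2) by simp
    have "(\<Sum>j\<in>{0..<r}. b j) = b i1 + (\<Sum>j\<in>{0..<r} - {i1}. b j)"
      using i1 by (intro sum.remove) auto
    also have "(\<Sum>j\<in>{0..<r} - {i1}. b j) = (\<Sum>j\<in>{0..<r} - {i1}. a j)"
      unfolding b_def by (intro sum.cong) auto
    finally have "(\<Sum>j\<in>{0..<r}. b j) = k - 2"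
      using sum_a_split[OF i1] ai1 unfolding b_def by simp
    moreover have "(y / real k) ^ (\<Sum>j\<in>{0..<r}. b j) \<le> real (\<Prod>j\<in>{0..<r}. card (A j) choose b j)"
    proof (rule prod_choose_lower)
      show "real (card (A j)) \<ge> y" if "j \<in> {0..<r}" for j
        using y \<phi>(2) that unfolding A_def B_def by auto
      show "b j \<le> k" if "j \<in> {0..<r}" for j
        using a_le_k[of j] that k_pos unfolding b_def by auto
    qed (use y k_pos in auto)
    ultimately show ?thesis unfolding 1 by simp
  qed
  ultimately have "real (card {S \<in> copies n ?H. {u, w} \<subseteq> S}) \<ge> (y / real k) ^ (k - 2)" by linarith
  then show ?thesis unfolding ind_flip_pair[OF uw(1)] p0 by simp
qed

end

section \<open>Perfect stability\<close>

context multipartite_pattern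
begin

text \<open>A wrong pair is shown to be costly in the coloured graph, which
  \<open>flip_contradiction\<close> then excludes. Between classes the star feeds
  \<open>extra1\<close>. Inside a class it feeds \<open>extra2\<close>, linearly only if the second
  part has one vertex: with \<open>a i2 \<ge> 2\<close> the gain would be of order \<tau> ^
  \<open>a i2\<close>, no better than the error. In that case \<open>inner_edge_loss\<close>
  replaces the star.\<close>

lemma phase2:
  fixes \<nu> \<mu> \<eta> :: real
  assumes cl: "close n \<mu> G c0"
    and edit: "\<And>G'. graph_on n G' \<Longrightarrow> ind n G' \<le> ind n G + \<mu> * (real n ^ k / real n ^ 2) * real (card (ediff G G'))"
    and i12: "i1 < r" "i2 < r" "i1 \<noteq> i2" "a i1 \<ge> 2" and i2: "a i2 = 1 \<or> (\<forall>i<r. a i \<ge> 2)"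
    and B: "finite B" "r \<le> card B" "\<And>v. v < n \<Longrightarrow> c v \<in> B"
      "\<And>j. j \<in> B \<Longrightarrow> real (card {x. x < n \<and> c x = j}) \<ge> \<nu> / 4 * real n"
    and degs: "\<And>v. v < n \<Longrightarrow> real (edge_deg (ediff G (cmp_graph n c)) v) \<le> \<eta> * real n"
    and \<nu>: "0 < \<nu>" "\<nu> \<le> 1" and \<eta>: "\<eta> > 0"
  defines "\<theta> \<equiv> \<nu> / 16" defines "c3 \<equiv> (\<theta> / real k) ^ (k - 1)" defines "\<tau> \<equiv> c3 / 32"
  defines "\<rho> \<equiv> 4 * (\<mu> + \<eta>)"
  assumes n: "\<theta> * real n \<ge> real k" "\<tau> * real n \<ge> 1" "\<rho> * real n \<ge> 1"
    and small: "8 * \<rho> < c3 * \<tau>" "6 * \<eta> + \<mu> < c3 / 8"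
  shows "ediff G (cmp_graph n c) = {}"
proof (rule ccontr)
  assume "\<not> ?thesis"
  let ?H = "cmp_graph n c" let ?D = "ediff G ?H"
  define K1 where "K1 = real n ^ k / real n"
  have G: "graph_on n G" and n0: "n > 0" and \<mu>: "0 < \<mu>"
    and near: "maxind n \<le> ind n G + \<mu> * real n ^ k"
    and ddG: "\<And>u v. u < n \<Longrightarrow> v < n \<Longrightarrow> deg n G v - deg n G u \<le> 2 * \<mu> * K1"
    using cl unfolding close_def K1_def by auto
  have K1: "K1 > 0" "K1 * real n = real n ^ k" unfolding K1_def using n0 by simp_all
  have N2: "real n ^ k / real n ^ 2 = K1 / real n" and N3: "real n ^ k / real n ^ 3 = K1 / real n ^ 2"
    unfolding K1_def using n0 by (simp_all add: power2_eq_square power3_eq_cube)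
  note D = ediff_edges[OF G graph_on_cmp_graph[of n c]]
  obtain e where e: "e \<in> ?D" using \<open>?D \<noteq> {}\<close> by blast
  then obtain u w where uw: "e = {u, w}" "u \<noteq> w" using D(1) by (meson card_2_iff)
  have lt: "u < n" "w < n" using D(1)[OF e] uw by auto
  define y where "y = \<theta> * real n"
  have yk: "y \<ge> real k" "y \<ge> 3" unfolding y_def using n(1) k_ge_3 by linarith+
  have \<theta>: "0 < \<theta>" "\<theta> \<le> 1" unfolding \<theta>_def using \<nu> by auto
  have k3: "real k \<ge> 3" using k_ge_3 by simp
  have \<theta>k: "0 < \<theta> / real k" "\<theta> / real k \<le> \<theta>" "\<theta> / real k \<le> 1"
    using \<theta> k3 frac_le[of \<theta> \<theta> 1 "real k"] by auto
  have c3pos: "c3 > 0" unfolding c3_def using \<theta>k by simp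
  have "c3 \<le> (\<theta> / real k) ^ 1" unfolding c3_def using \<theta>k k_ge_3 by (intro power_decreasing) auto
  then have c3\<theta>: "c3 \<le> \<theta>" using \<theta>k by simp
  \<comment> \<open>The size of the star: between \<tau> n and 2 \<tau> n, and at most
    \<open>y\<close>, so that enough of its class remains.\<close>
  define m where "m = nat \<lceil>\<tau> * real n\<rceil>"
  have m: "real m \<ge> \<tau> * real n" "real m \<le> 2 * \<tau> * real n" unfolding m_def using n(2) by linarith+
  have my: "real m \<le> y"
  proof -
    have "2 * \<tau> \<le> \<theta>" unfolding \<tau>_def using c3\<theta> c3pos by simp
    then have "2 * \<tau> * real n \<le> \<theta> * real n" by (intro mult_right_mono) auto
    then show ?thesis using m(2) unfolding y_def by linarith
  qed
  have size: "real (card {x. x < n \<and> c x = j}) \<ge> 4 * y" if "j \<in> B" for j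
    using B(4)[OF that] unfolding y_def \<theta>_def by simp
  have ypow: "(y / real k) ^ (k - 1) = c3 * K1"
  proof -
    have "y / real k = \<theta> / real k * real n" unfolding y_def by simp
    then have "(y / real k) ^ (k - 1) = c3 * real n ^ (k - 1)" unfolding c3_def by (simp only: power_mult_distrib)
    moreover have "real n ^ k = real n * real n ^ (k - 1)" using k_pos by (simp add: power_eq_if)
    ultimately show ?thesis unfolding K1_def using n0 by simp
  qed
  have cardD: "real (card ?D) \<le> \<eta> * real n ^ 2"
  proof -
    have "2 * real (card ?D) = real (\<Sum>v<n. edge_deg ?D v)" using sum_edge_deg[OF D] by simp
    also have "\<dots> = (\<Sum>v<n. real (edge_deg ?D v))" by simp
    also have "\<dots> \<le> (\<Sum>v<n. \<eta> * real n)" using degs by (intro sum_mono) auto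
    finally have "2 * real (card ?D) \<le> \<eta> * real n ^ 2" by (simp add: power2_eq_square mult_ac)
    then show ?thesis by linarith
  qed
  have nearH: "maxind n \<le> ind n ?H + \<rho> * real n ^ k"
  proof -
    have "real (card ?D) * (K1 / real n) \<le> \<eta> * real n ^ 2 * (K1 / real n)"
      using cardD K1 by (intro mult_right_mono) auto
    also have "\<dots> = \<eta> * real n ^ k" unfolding K1(2)[symmetric] using n0 by (simp add: power2_eq_square)
    finally have "ind n G \<le> ind n ?H + \<eta> * real n ^ k"
      using ind_edit[OF G graph_on_cmp_graph[of n c] n0] unfolding N2 by linarith
    moreover have "\<mu> * real n ^ k + \<eta> * real n ^ k \<le> \<rho> * real n ^ k"
      unfolding \<rho>_def distrib_right[symmetric] using \<mu> \<eta> by (intro mult_right_mono) auto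
    ultimately show ?thesis using near by linarith
  qed
  have ddH: "deg n ?H x - deg n ?H x' \<le> \<rho> * (real n ^ k / real n)" if x: "x < n" "x' < n" for x x'
  proof -
    have b: "real (edge_deg ?D z) * (K1 / real n) + real (card ?D) * (K1 / real n ^ 2) \<le> 2 * \<eta> * K1" if z: "z < n" for z
    proof -
      have "real (edge_deg ?D z) * (K1 / real n) \<le> \<eta> * real n * (K1 / real n)"
        using degs[OF z] K1 by (intro mult_right_mono) auto
      moreover have "real (card ?D) * (K1 / real n ^ 2) \<le> \<eta> * real n ^ 2 * (K1 / real n ^ 2)"
        using cardD K1 by (intro mult_right_mono) auto
      moreover have "\<eta> * real n * (K1 / real n) = \<eta> * K1" "\<eta> * real n ^ 2 * (K1 / real n ^ 2) = \<eta> * K1"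
        using n0 by simp_all
      ultimately show ?thesis by linarith
    qed
    have "deg n ?H x \<le> deg n G x + real (edge_deg ?D x) * (K1 / real n) + real (card ?D) * (K1 / real n ^ 2)"
      using deg_edit[OF graph_on_cmp_graph[of n c] G n0, of x] unfolding edge_deg_def ediff_commute[of ?H G] N2 N3 .
    moreover have "deg n G x' \<le> deg n ?H x' + real (edge_deg ?D x') * (K1 / real n) + real (card ?D) * (K1 / real n ^ 2)"
      using deg_edit[OF G graph_on_cmp_graph[of n c] n0, of x'] unfolding edge_deg_def N2 N3 .
    ultimately have "deg n ?H x - deg n ?H x' \<le> 2 * \<mu> * K1 + 4 * \<eta> * K1"
      using b[OF x(1)] b[OF x(2)] ddG[OF x(2,1)] by linarith
    also have "\<dots> \<le> \<rho> * K1"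
      using \<mu> K1 mult_pos_pos[OF \<mu> K1(1)] unfolding \<rho>_def by (simp add: algebra_simps)
    finally show ?thesis unfolding K1_def .
  qed
  have flip: "ind n (ediff G {{u, w}}) \<le> ind n G + \<mu> * (real n ^ k / real n ^ 2)"
  proof -
    have "graph_on n {{u, w}}" using uw lt unfolding graph_on_def by auto
    then have "graph_on n (ediff G {{u, w}})" by (rule graph_on_ediff[OF G])
    moreover have "ediff G (ediff G {{u, w}}) = {{u, w}}" unfolding ediff_def by blast
    ultimately show ?thesis using edit[of "ediff G {{u, w}}"] by simp
  qed
  have goal: False if "ind n (ediff ?H {{u, w}}) - ind n ?H \<le> - (c3 / 8 * (real n ^ k / real n ^ 2))"
    using flip_contradiction[OF G n0 uw(2) lt e[unfolded uw(1)] degs flip that] small(2) by simp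
  have att: "attached_to n c u (ediff ?H ((\<lambda>y. {u, y}) ` Y))" if "Y \<subseteq> {0..<n} - {u}" for Y
    unfolding attached_to_def
  proof (intro conjI graph_on_ediff graph_on_cmp_graph graph_on_star lt(1) that allI impI)
    fix x y assume "x < n" "y < n" "x \<noteq> u" "y \<noteq> u"
    moreover have "{x, y} \<notin> (\<lambda>y. {u, y}) ` Y" using \<open>x \<noteq> u\<close> \<open>y \<noteq> u\<close> by (auto simp: doubleton_eq_iff)
    ultimately show "({x, y} \<in> ediff ?H ((\<lambda>y. {u, y}) ` Y)) = (c x \<noteq> c y)"
      unfolding in_ediff by (simp add: cmp_graph_pair)
  qed
  have star_iff: "{u, x} \<in> ediff ?H ((\<lambda>y. {u, y}) ` Y) \<longleftrightarrow> (c u \<noteq> c x) \<noteq> (x \<in> Y)" if "x < n" for x Y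
  proof -
    have "{u, x} \<in> (\<lambda>y. {u, y}) ` Y \<longleftrightarrow> x \<in> Y" by (auto simp: doubleton_eq_iff)
    then show ?thesis unfolding in_ediff cmp_graph_pair using that lt by blast
  qed
  have remove: "real (card (X - Z)) \<ge> real (card X) - real (card Z)" if "finite Z" for X Z :: "nat set"
    using diff_card_le_card_Diff[OF that, of X] by linarith
  have card_minus_u: "real (card ({x. x < n \<and> c x = j} - {u})) \<ge> 4 * y - 1" if "j \<in> B" for j
    using remove[of "{u}" "{x. x < n \<and> c x = j}"] size[OF that] by simp
  show False
  proof (cases "c u = c w")
    case False
    obtain \<phi> where \<phi>: "inj_on \<phi> {0..<r}" "\<phi> ` {0..<r} \<subseteq> B" "\<phi> i1 = c u" "\<phi> i2 = c w"
      using inj_on_with_two_values[OF B(1,2) B(3)[OF lt(1)] B(3)[OF lt(2)] False i12(1-3)] by blast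
    have "real m \<le> real (card {x. x < n \<and> c x = c w})" using size[OF B(3)[OF lt(2)]] my yk by linarith
    then have "m \<le> card {x. x < n \<and> c x = c w}" by (simp only: of_nat_le_iff)
    then obtain Y where Y: "Y \<subseteq> {x. x < n \<and> c x = c w}" "card Y = m"
      by (meson obtain_subset_with_card_n)
    have finY: "finite Y" using Y(1) finite_subset by fastforce
    have Yu: "Y \<subseteq> {0..<n} - {u}" using Y(1) False by auto
    let ?G0 = "ediff ?H ((\<lambda>y. {u, y}) ` Y)"
    let ?U = "class_nonnbrs n c ?G0 u (c u)"
    have U: "?U = {x. x < n \<and> c x = c u} - {u}"
      unfolding class_nonnbrs_def using star_iff[of _ Y] Y(1) False by auto
    \<comment> \<open>The flips turn \<open>Y\<close> into non-neighbours of \<open>u\<close> in a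
      second class.\<close>
    have "real (card Y) * (y / real k) ^ (k - 1) \<le> real (card (extra1 n ?G0 ?U u))"
    proof (rule extra1_lower[OF att[OF Yu] \<phi>(1,3) i12 _ yk(1)])
      show "Y \<subseteq> class_nonnbrs n c ?G0 u (\<phi> i2)"
        unfolding class_nonnbrs_def \<phi>(4) using star_iff[of _ Y] Y(1) False by auto
      show "y \<le> real (card ?U)" unfolding U using card_minus_u[OF B(3)[OF lt(1)]] yk by linarith
      have "{x. x < n \<and> x \<noteq> u \<and> c x = c w} = {x. x < n \<and> c x = c w}" using False by auto
      then show "y \<le> real (card ({x. x < n \<and> x \<noteq> u \<and> c x = \<phi> i2} - Y))"
        unfolding \<phi>(4) using remove[OF finY, of "{x. x < n \<and> c x = c w}"] size[OF B(3)[OF lt(2)]] Y(2) my yk by simp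
      fix l assume l: "l < r"
      have "{x. x < n \<and> x \<noteq> u \<and> c x = \<phi> l} = {x. x < n \<and> c x = \<phi> l} - {u}" by auto
      moreover have "\<phi> l \<in> B" using \<phi>(2) l by auto
      ultimately show "y \<le> real (card {x. x < n \<and> x \<noteq> u \<and> c x = \<phi> l})"
        using card_minus_u[of "\<phi> l"] yk by simp
    qed
    then have ext: "real (card Y) * (c3 * (real n ^ k / real n)) \<le>
        real (card (extra1 n ?G0 ?U u)) + real (card (extra2 n ?G0 ?U u))"
      unfolding ypow K1_def by simp
    have "ind n (ediff ?H {{u, w}}) - ind n ?H \<le> - (c3 / 8 * (real n ^ k / real n ^ 2))"
    proof (rule star_loss[OF lt(1) Yu _ lt(2) _ nearH ddH n(3) small(1) _ c3pos _ _ _ ext])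
      show "?U \<inter> Y = {}" unfolding U using Y(1) False by auto
    qed (use Y uw m \<tau>_def in auto)
    then show False by (rule goal)
  next
    case True
    have "card B \<ge> 2" using B(2) r2 by simp
    then have "\<not> B \<subseteq> {c u}" using card_mono[of "{c u}" B] by auto
    then obtain j where j: "j \<in> B" "c u \<noteq> j" by blast
    obtain \<phi> where \<phi>: "inj_on \<phi> {0..<r}" "\<phi> ` {0..<r} \<subseteq> B" "\<phi> i1 = c u" "\<phi> i2 = j"
      using inj_on_with_two_values[OF B(1,2) B(3)[OF lt(1)] j i12(1-3)] by blast
    show False
    proof (cases "\<forall>i<r. a i \<ge> 2")
      case True
      have "ind n (ediff ?H {{u, w}}) - ind n ?H \<le> - ((y / real k) ^ (k - 2))"
      proof (rule inner_edge_loss[OF True uw(2) lt \<open>c u = c w\<close> \<phi>(1,3) i12(1) yk(1)])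
        show "y \<le> real (card ({x. x < n \<and> c x = c u} - {u, w}))"
          using remove[of "{u, w}" "{x. x < n \<and> c x = c u}"] size[OF B(3)[OF lt(1)]] uw(2) yk by simp
        fix l assume "l < r"
        then have "\<phi> l \<in> B" using \<phi>(2) by auto
        then show "y \<le> real (card {x. x < n \<and> c x = \<phi> l})" using size[of "\<phi> l"] yk by linarith
      qed
      moreover have "c3 / 8 * (real n ^ k / real n ^ 2) \<le> (y / real k) ^ (k - 2)"
      proof -
        have "c3 \<le> (\<theta> / real k) ^ (k - 2)" unfolding c3_def using \<theta>k by (intro power_decreasing) auto
        then have "c3 / 8 \<le> (\<theta> / real k) ^ (k - 2)" using c3pos by simp
        then have "c3 / 8 * real n ^ (k - 2) \<le> (\<theta> / real k) ^ (k - 2) * real n ^ (k - 2)"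
          by (intro mult_right_mono) auto
        also have "\<dots> = (\<theta> / real k * real n) ^ (k - 2)" by (rule power_mult_distrib[symmetric])
        also have "\<theta> / real k * real n = y / real k" unfolding y_def by simp
        finally have "c3 / 8 * real n ^ (k - 2) \<le> (y / real k) ^ (k - 2)" .
        moreover have "real n ^ k / real n ^ 2 = real n ^ (k - 2)" using n0 k_ge_3 by (simp add: power_diff)
        ultimately show ?thesis by simp
      qed
      ultimately have "ind n (ediff ?H {{u, w}}) - ind n ?H \<le> - (c3 / 8 * (real n ^ k / real n ^ 2))" by linarith
      then show False by (rule goal)
    next
      case False
      then have ai2: "a i2 = 1" using i2 by blast
      have "real m \<le> real (card ({x. x < n \<and> c x = c u} - {u}))"
        using card_minus_u[OF B(3)[OF lt(1)]] my yk by linarith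
      then have "m \<le> card ({x. x < n \<and> c x = c u} - {u})" by (simp only: of_nat_le_iff)
      then obtain Y where Y: "Y \<subseteq> {x. x < n \<and> c x = c u} - {u}" "card Y = m"
        by (meson obtain_subset_with_card_n)
      have finY: "finite Y" using Y(1) finite_subset by fastforce
      have Yu: "Y \<subseteq> {0..<n} - {u}" using Y(1) by auto
      let ?G0 = "ediff ?H ((\<lambda>y. {u, y}) ` Y)"
      let ?U = "class_nonnbrs n c ?G0 u (c u)"
      have U: "?U = {x. x < n \<and> c x = c u} - {u} - Y"
        unfolding class_nonnbrs_def using star_iff[of _ Y] by auto
      \<comment> \<open>The flips turn \<open>Y\<close> into neighbours of \<open>u\<close> inside
        its class, and \<open>a i2 = 1\<close> makes the binomial coefficient equal to the size of
        the star.\<close>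
      have "real (card Y choose a i2) * (y / real k) ^ (k - a i2) \<le> real (card (extra2 n ?G0 ?U u))"
      proof (rule extra2_lower[OF att[OF Yu] lt(1) \<phi>(1,3) i12 _ yk(1)])
        show "Y \<subseteq> class_nbrs n c ?G0 u (c u)"
          unfolding class_nbrs_def using star_iff[of _ Y] Y(1) by auto
        show "y \<le> real (card ?U)"
          unfolding U using remove[OF finY, of "{x. x < n \<and> c x = c u} - {u}"]
            card_minus_u[OF B(3)[OF lt(1)]] Y(2) my yk by simp
        fix l assume l: "l < r" "l \<noteq> i1" "l \<noteq> i2"
        have ne: "\<phi> l \<noteq> c u" using inj_on_eq_iff[OF \<phi>(1), of l i1] l i12 \<phi>(3) by auto
        have "class_nbrs n c ?G0 u (\<phi> l) = {x. x < n \<and> c x = \<phi> l} - {u}"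
          unfolding class_nbrs_def using star_iff[of _ Y] Y(1) ne by auto
        moreover have "\<phi> l \<in> B" using \<phi>(2) l by auto
        ultimately show "y \<le> real (card (class_nbrs n c ?G0 u (\<phi> l)))"
          using card_minus_u[of "\<phi> l"] yk by simp
      qed
      then have ext: "real (card Y) * (c3 * (real n ^ k / real n)) \<le>
          real (card (extra1 n ?G0 ?U u)) + real (card (extra2 n ?G0 ?U u))"
        unfolding ai2 choose_one ypow K1_def by simp
      have "ind n (ediff ?H {{u, w}}) - ind n ?H \<le> - (c3 / 8 * (real n ^ k / real n ^ 2))"
      proof (rule star_loss[OF lt(1) Yu _ lt(2) _ nearH ddH n(3) small(1) _ c3pos _ _ _ ext])
        show "?U \<inter> Y = {}" unfolding U by blast
      qed (use Y uw m \<tau>_def \<open>c u = c w\<close> in auto)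
      then show False by (rule goal)
    qed
  qed
qed

text \<open>The constants descend from \<open>\<nu>\<close> through \<open>c3\<close>,
  \<open>\<tau>\<close>, \<open>\<eta>\<close> and \<open>h\<close> to \<open>\<mu>\<close>, which
  also serves as the weight of the penalty; its truncation is \<mu> ^ 2 / 4, matching the square in
  \<open>close\<close>.\<close>

lemma stable_point_complete_multipartite:
  assumes hyp: "(\<forall>i<r. a i \<ge> 2) \<or> (\<forall>i<r. a i \<le> 2)"
  shows "\<exists>c \<epsilon> n1. 0 < c \<and> 0 < \<epsilon> \<and> \<epsilon> \<le> 1 \<and> (\<forall>n\<ge>n1. \<forall>G. stable_point n c \<epsilon> G \<longrightarrow> cmp_dist n G = 0)"
proof -
  obtain \<nu> \<mu>0 n2 where \<nu>: "0 < \<nu>" "\<nu> \<le> 1" and \<mu>0: "\<mu>0 > 0"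
    and all: "\<forall>n\<ge>n2. \<forall>\<mu>\<le>\<mu>0. \<forall>G c. close n \<mu> G c \<longrightarrow> (\<forall>v<n. real (card (nonnbrs n G v)) \<ge> \<nu> * real n)"
    using many_nonnbrs[OF hyp] by (elim exE conjE) (rule that)
  have nn: "real (card (nonnbrs n G v)) \<ge> \<nu> * real n"
    if "n \<ge> n2" "\<mu> \<le> \<mu>0" "close n \<mu> G c" "v < n" for n \<mu> G c v
    by (rule all[rule_format, OF that])
  obtain \<pi> n3 where \<pi>: "\<pi> > 0" and low: "\<And>n. n \<ge> n3 \<Longrightarrow> maxind n \<ge> \<pi> * real n ^ k"
    using maxind_lower by blast
  obtain i1 where i1: "i1 < r" "a i1 \<ge> 2" using part2 a_def by auto
  obtain i2 where i2: "i2 < r" "i1 \<noteq> i2" "a i2 = 1 \<or> (\<forall>i<r. a i \<ge> 2)"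
  proof (cases "\<forall>i<r. a i \<ge> 2")
    case True
    have "\<not> {0..<r} \<subseteq> {i1}" using card_mono[of "{i1}" "{0..<r}"] r2 by auto
    then obtain i where "i \<in> {0..<r}" "i \<notin> {i1}" by blast
    then show ?thesis using that[of i] True by auto
  next
    case False
    then obtain i where i: "i < r" "\<not> a i \<ge> 2" by blast
    have "a i = 1" using i a_pos[OF i(1)] by linarith
    moreover have "i1 \<noteq> i" using i1(2) i(2) by blast
    ultimately show ?thesis using that[of i] i(1) by blast
  qed
  define \<theta> where "\<theta> = \<nu> / 16"
  define c3 where "c3 = (\<theta> / real k) ^ (k - 1)"
  define \<tau> where "\<tau> = c3 / 32"
  \<comment> \<open>With \<open>\<mu> \<le> \<eta>\<close> the requirement
    \<open>8 * \<rho> < c3 * \<tau>\<close> of \<open>phase2\<close> follows from 64 \<eta> < c3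
    \<tau>.\<close>
  define \<eta> where "\<eta> = c3 * \<tau> / 100"
  \<comment> \<open>The first bound turns the estimate 4 h / \<nu> of \<open>phase1_aux\<close> into
    at most \<eta>; the second is its hypothesis on \<open>h\<close>.\<close>
  define h where "h = min (\<eta> * \<nu> / 4) (\<nu> ^ 2 / 16)"
  define \<mu> where "\<mu> = min (min \<mu>0 (h / 4)) (min (min (\<pi> / 4) \<eta>) (min ((h / (2 * real k)) ^ k / 7) 1))"
  have k3: "real k \<ge> 3" using k_ge_3 by simp
  have \<theta>: "\<theta> > 0" "\<theta> / real k \<le> 1" unfolding \<theta>_def using \<nu> k3 by (auto simp: field_simps)
  have c3: "c3 > 0" "c3 \<le> 1" unfolding c3_def using \<theta> k3 by (auto intro!: power_le_one)
  have \<tau>: "\<tau> > 0" "\<tau> \<le> 1" unfolding \<tau>_def using c3 by auto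
  have \<eta>: "\<eta> > 0" unfolding \<eta>_def using c3 \<tau> by simp
  have h: "h > 0" unfolding h_def using \<eta> \<nu> by simp
  have hk: "(h / (2 * real k)) ^ k > 0" using h k3 by simp
  have \<mu>: "\<mu> > 0" unfolding \<mu>_def using \<mu>0 h \<pi> \<eta> hk by simp
  have \<mu>_le: "\<mu> \<le> \<mu>0" "\<mu> \<le> h / 4" "\<mu> \<le> \<pi> / 4" "\<mu> \<le> \<eta>" "\<mu> \<le> (h / (2 * real k)) ^ k / 7" "\<mu> \<le> 1"
    unfolding \<mu>_def by linarith+
  define N where "N = Max {real n2, real n3, real k / \<theta>, 1 / \<tau>, 1 / \<mu>, 2 * real k / h, 4 / \<mu> ^ 2}"
  have "cmp_dist n G = 0" if n: "n \<ge> nat \<lceil>N\<rceil>" and st: "stable_point n \<mu> (\<mu> ^ 2 / 4) G" for n G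
  proof -
    have nN: "real n \<ge> N" using n by linarith
    have "z \<le> N" if "z \<in> {real n2, real n3, real k / \<theta>, 1 / \<tau>, 1 / \<mu>, 2 * real k / h, 4 / \<mu> ^ 2}" for z
      unfolding N_def by (rule Max_ge) (use that in auto)
    then have "z \<le> real n" if "z \<in> {real n2, real n3, real k / \<theta>, 1 / \<tau>, 1 / \<mu>, 2 * real k / h, 4 / \<mu> ^ 2}" for z
      using nN that by fastforce
    then have big: "real n2 \<le> real n" "real n3 \<le> real n" "real k / \<theta> \<le> real n" "1 / \<tau> \<le> real n"
      "1 / \<mu> \<le> real n" "2 * real k / h \<le> real n" "4 / \<mu> ^ 2 \<le> real n" by blast+
    obtain c where cl: "close n \<mu> G c"
      using stable_point_close[OF st \<mu> \<mu>_le(6) \<mu> _ _ big(7)] by auto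
    have nns: "real (card (nonnbrs n G v)) \<ge> \<nu> * real n" if "v < n" for v
      using nn[OF _ \<mu>_le(1) cl that] big(1) by simp
    have "\<exists>c2 B. finite B \<and> r \<le> card B \<and> (\<forall>v<n. c2 v \<in> B) \<and>
       (\<forall>j\<in>B. real (card {w. w < n \<and> c2 w = j}) \<ge> \<nu> / 4 * real n) \<and>
       (\<forall>v<n. real (edge_deg (ediff G (cmp_graph n c2)) v) \<le> 4 / \<nu> * h * real n)"
    proof (rule phase1_aux[OF cl i1(1) i2(1,2) i1(2) \<nu> nns])
      show "\<pi> * real n ^ k \<le> maxind n" using low big(2) by simp
      show "3 * \<mu> < \<pi>" using \<mu>_le(3) \<pi> by simp
      show "0 < h" "h \<le> \<nu> ^ 2 / 16" "\<mu> \<le> h / 4" using h \<mu>_le(2) unfolding h_def by auto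
      show "6 * \<mu> < (h / (2 * real k)) ^ k" using \<mu>_le(5) hk by linarith
      show "real k \<le> h / 2 * real n" using big(6) h by (simp add: field_simps)
    qed
    then obtain c2 B where B: "finite B" "r \<le> card B" "\<forall>v<n. c2 v \<in> B"
       "\<forall>j\<in>B. real (card {w. w < n \<and> c2 w = j}) \<ge> \<nu> / 4 * real n"
       and degs: "\<forall>v<n. real (edge_deg (ediff G (cmp_graph n c2)) v) \<le> 4 / \<nu> * h * real n" by blast
    have "4 / \<nu> * h \<le> 4 / \<nu> * (\<eta> * \<nu> / 4)" unfolding h_def using \<nu> by (intro mult_left_mono) auto
    then have hle: "4 / \<nu> * h \<le> \<eta>" using \<nu> by simp
    have "ediff G (cmp_graph n c2) = {}"
    proof (rule phase2[OF cl _ i1(1) i2(1,2) i1(2) i2(3) B(1,2)])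
      show "ind n G' \<le> ind n G + \<mu> * (real n ^ k / real n ^ 2) * real (card (ediff G G'))" if "graph_on n G'" for G'
        using st that unfolding stable_point_def by blast
      show "real (edge_deg (ediff G (cmp_graph n c2)) v) \<le> \<eta> * real n" if "v < n" for v
        using degs that mult_right_mono[OF hle, of "real n"] by fastforce
      show "0 < \<nu>" "\<nu> \<le> 1" "0 < \<eta>" using \<nu> \<eta> by auto
      show "real k \<le> \<nu> / 16 * real n" using big(3) \<theta>(1) unfolding \<theta>_def by (simp add: field_simps)
      show "1 \<le> (\<nu> / 16 / real k) ^ (k - 1) / 32 * real n"
        using big(4) \<tau>(1) unfolding \<theta>_def[symmetric] c3_def[symmetric] \<tau>_def[symmetric] by (simp add: field_simps)
      have "1 \<le> \<mu> * real n" using big(5) \<mu> by (simp add: field_simps)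
      moreover have "0 \<le> \<mu> * real n" "0 \<le> \<eta> * real n" using \<mu> \<eta> by auto
      ultimately show "1 \<le> 4 * (\<mu> + \<eta>) * real n" by (simp add: algebra_simps)
      have \<eta>c: "64 * \<eta> < c3 * \<tau>" unfolding \<eta>_def using mult_pos_pos[OF c3(1) \<tau>(1)] by linarith
      then show "8 * (4 * (\<mu> + \<eta>)) < (\<nu> / 16 / real k) ^ (k - 1) * ((\<nu> / 16 / real k) ^ (k - 1) / 32)"
        using \<mu>_le(4) unfolding \<theta>_def[symmetric] c3_def[symmetric] \<tau>_def[symmetric] by simp
      have "c3 * \<tau> \<le> c3 * 1" using c3 \<tau> by (intro mult_left_mono) auto
      then show "6 * \<eta> + \<mu> < (\<nu> / 16 / real k) ^ (k - 1) / 8"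
        using \<mu>_le(4) \<eta>c \<eta> unfolding \<theta>_def[symmetric] c3_def[symmetric] by simp
    qed (use B in auto)
    then show ?thesis using cmp_dist_le[of n G c2] by simp
  qed
  moreover have "\<mu> ^ 2 / 4 \<le> 1" using \<mu> \<mu>_le(6) power_le_one[of \<mu> 2] by simp
  moreover have "0 < \<mu> ^ 2 / 4" using \<mu> by simp
  ultimately show ?thesis using \<mu>
    by (intro exI[of _ \<mu>] exI[of _ "\<mu> ^ 2 / 4"] exI[of _ "nat \<lceil>N\<rceil>"]) blast
qed

lemma perfect_stability:
  assumes hyp: "(\<forall>i<r. a i \<ge> 2) \<or> (\<forall>i<r. a i \<le> 2)"
  shows "\<exists>C::real. C > 0 \<and> (\<forall>n G. real n \<ge> C \<longrightarrow> graph_on n G \<longrightarrow>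
    real (cmp_dist n G) \<le> C * ((maxind n - ind n G) / real (n choose k)) * real (n choose 2))"
proof -
  obtain c \<epsilon> n1 where c: "0 < c" and \<epsilon>: "0 < \<epsilon>" "\<epsilon> \<le> 1"
    and st: "\<And>n G. n \<ge> n1 \<Longrightarrow> stable_point n c \<epsilon> G \<Longrightarrow> cmp_dist n G = 0"
    using stable_point_complete_multipartite[OF hyp] by blast
  \<comment> \<open>In the first summand, \<epsilon> pays for the truncation and 4 for
    \<open>n choose 2 \<ge> n ^ 2 / 4\<close>. The other two make \<open>n\<close> exceed
    \<open>n1\<close> and \<open>k\<close>.\<close>
  define C where "C = 4 / (c * \<epsilon>) + real n1 + real k"
  have C: "C > 0" unfolding C_def using c \<epsilon> k_pos by (simp add: add_pos_nonneg)
  have "real (cmp_dist n G) \<le> C * ((maxind n - ind n G) / real (n choose k)) * real (n choose 2)"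
    if n: "real n \<ge> C" and G: "graph_on n G" for n G
  proof -
    have "4 / (c * \<epsilon>) \<ge> 0" using c \<epsilon> by simp
    then have nn: "n \<ge> n1" "n \<ge> k" "C \<ge> 4 / (c * \<epsilon>)" using n unfolding C_def by linarith+
    have n3: "n \<ge> 3" using nn(2) k_ge_3 by simp
    then have npos: "n > 0" by simp
    define d where "d = real (cmp_dist n G)"
    define N2 where "N2 = real n ^ k / real n ^ 2"
    define def where "def = maxind n - ind n G"
    have N2: "N2 > 0" unfolding N2_def using npos by simp
    have "ind n G + c * N2 * min d (\<epsilon> * real n ^ 2) \<le> maxind n"
      using penalized_bound[OF npos c \<epsilon>(1) st[OF nn(1)] G] unfolding penalized_def d_def N2_def .
    \<comment> \<open>Comparison with the edgeless graph bounds every distance by n ^ 2, so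
      truncation loses at most the factor \<epsilon>.\<close>
    moreover have "\<epsilon> * d \<le> min d (\<epsilon> * real n ^ 2)"
    proof -
      have "cmp_dist n G \<le> card (ediff G (cmp_graph n (\<lambda>_. 0)))" by (rule cmp_dist_le)
      also have "ediff G (cmp_graph n (\<lambda>_. 0)) = G" unfolding ediff_def cmp_graph_def by simp
      also have "card G \<le> card {e. e \<subseteq> {0..<n} \<and> card e = 2}"
        using G unfolding graph_on_def by (intro card_mono finite_subset[of "{e. e \<subseteq> {0..<n} \<and> card e = 2}" "Pow {0..<n}"]) auto
      also have "\<dots> = n choose 2" by (simp add: n_subsets)
      also have "\<dots> \<le> n ^ 2" using n3 by (intro binomial_le_pow) simp
      finally have "d \<le> real n ^ 2" unfolding d_def by (simp flip: of_nat_power)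
      then have "\<epsilon> * d \<le> \<epsilon> * real n ^ 2" using \<epsilon> by (intro mult_left_mono) auto
      moreover have "\<epsilon> * d \<le> d" using \<epsilon> unfolding d_def by (simp add: mult_left_le_one_le)
      ultimately show ?thesis by simp
    qed
    then have "c * N2 * (\<epsilon> * d) \<le> c * N2 * min d (\<epsilon> * real n ^ 2)" using c N2 by (intro mult_left_mono) auto
    ultimately have "c * N2 * (\<epsilon> * d) \<le> def" unfolding def_def by linarith
    then have 1: "d \<le> 4 / (c * \<epsilon>) * (def / (4 * N2))" using c \<epsilon> N2 by (simp add: field_simps)
    have def0: "def \<ge> 0" unfolding def_def using ind_le_maxind[OF G] by simp
    have "def / (4 * N2) \<le> def / real (n choose k) * real (n choose 2)"
    proof -
      have "n choose k \<le> n ^ k" using nn(2) by (intro binomial_le_pow)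
      then have up: "real (n choose k) \<le> real n ^ k" by (simp flip: of_nat_power)
      have pos: "real (n choose k) > 0" using nn(2) by simp
      have lo: "real (n choose 2) \<ge> real n ^ 2 / 4"
        unfolding real_choose_2 using n3 by (simp add: power2_eq_square field_simps)
      have "def / (4 * N2) = def / real n ^ k * (real n ^ 2 / 4)" unfolding N2_def using npos by simp
      also have "\<dots> \<le> def / real (n choose k) * real (n choose 2)"
        using up pos lo def0 npos by (intro mult_mono divide_left_mono mult_pos_pos) auto
      finally show ?thesis .
    qed
    then have "4 / (c * \<epsilon>) * (def / (4 * N2)) \<le> C * (def / real (n choose k) * real (n choose 2))"
      using nn(3) C def0 N2 by (intro mult_mono) auto
    then show ?thesis using 1 unfolding d_def def_def by (simp add: mult.assoc)
  qed
  then show ?thesis using C by blast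
qed

end

section \<open>From labelled distance and part sizes to the stated form\<close>

lemma edit_dist_le:
  "edit_dist n G H \<le> card (ediff G H)"
proof -
  have "card (ediff G H) = card ((G - ((`) id) ` H) \<union> (((`) id) ` H - G))"
    unfolding ediff_def by (simp add: image_id)
  moreover have "bij_betw id {0..<n} {0..<n}" by simp
  ultimately have "card (ediff G H) \<in> {card ((G - ((`) \<pi>) ` H) \<union> (((`) \<pi>) ` H - G)) | \<pi>. bij_betw \<pi> {0..<n} {0..<n}}"
    by blast
  then show ?thesis unfolding edit_dist_def by (rule cInf_lower) simp
qed

text \<open>If the smallest part has one vertex, the binomial coefficient is below 1, hence 0, and
  the largest part has at most two vertices.\<close>

lemma almost_balanced_parts:
  assumes "r \<ge> 2" and onto: "p ` {0..<k} = {0..<r}" and bal: "almost_balanced k p r"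
  shows "\<exists>i<r. part_size k p i \<ge> 2"
    and "(\<forall>i<r. part_size k p i \<ge> 2) \<or> (\<forall>i<r. part_size k p i \<le> 2)"
proof -
  let ?S = "part_size k p ` {0..<r}"
  have S: "finite ?S" "?S \<noteq> {}" using assms(1) by auto
  have mx: "Max ?S \<ge> 2" and ch: "(Max ?S - Min ?S) choose 2 < Min ?S"
    using bal unfolding almost_balanced_def Let_def by auto
  have "Max ?S \<in> ?S" using S by (rule Max_in)
  then obtain i where "i < r" "part_size k p i = Max ?S" by (metis atLeastLessThan_iff imageE)
  then show "\<exists>i<r. part_size k p i \<ge> 2" using mx by auto
  have le: "Min ?S \<le> part_size k p i" "part_size k p i \<le> Max ?S" if "i < r" for i using S that by auto
  show "(\<forall>i<r. part_size k p i \<ge> 2) \<or> (\<forall>i<r. part_size k p i \<le> 2)"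
  proof (cases "Min ?S \<ge> 2")
    case True
    then show ?thesis using le(1) by (meson le_trans)
  next
    case False
    then have "Min ?S = 1" using ch by linarith
    then have "(Max ?S - 1) choose 2 = 0" using ch by simp
    then have "Max ?S - 1 < 2" by (simp add: binomial_eq_0_iff)
    then have "Max ?S \<le> 2" by simp
    then show ?thesis using le(2) by (meson le_trans)
  qed
qed

theorem theorem1p5:
  fixes k r :: nat and p :: "nat \<Rightarrow> nat"
  assumes "r \<ge> 2"
    and "p ` {0..<k} = {0..<r}"
    and "almost_balanced k p r"
  shows "\<exists>C::real. C > 0 \<and>
           (\<forall>n G. real n \<ge> C \<longrightarrow> graph_on n G \<longrightarrow>
              (\<exists>H. complete_multipartite n H \<and>
                 real (edit_dist n G H) \<le>
                   C * ((real (inducibility (cmp_graph k p) k n)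
                         - real (ind_count (cmp_graph k p) k G n))
                        / real (n choose k)) * real (n choose 2)))"
proof -
  interpret multipartite_pattern k r p
    using assms almost_balanced_parts(1)[OF assms] by unfold_locales auto
  have "(\<forall>i<r. a i \<ge> 2) \<or> (\<forall>i<r. a i \<le> 2)"
    using almost_balanced_parts(2)[OF assms] unfolding a_def .
  then obtain C where C: "C > 0"
    "\<And>n G. real n \<ge> C \<Longrightarrow> graph_on n G \<Longrightarrow>
      real (cmp_dist n G) \<le> C * ((maxind n - ind n G) / real (n choose k)) * real (n choose 2)"
    using perfect_stability by blast
  have "\<exists>H. complete_multipartite n H \<and> real (edit_dist n G H) \<le>
      C * ((real (inducibility (cmp_graph k p) k n) - real (ind_count (cmp_graph k p) k G n))
        / real (n choose k)) * real (n choose 2)" if "real n \<ge> C" "graph_on n G" for n G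
  proof -
    obtain c where c: "card (ediff G (cmp_graph n c)) = cmp_dist n G" using cmp_dist_attained by blast
    have "real (edit_dist n G (cmp_graph n c)) \<le> real (cmp_dist n G)"
      using edit_dist_le[of n G "cmp_graph n c"] unfolding c by simp
    also have "\<dots> \<le> C * ((maxind n - ind n G) / real (n choose k)) * real (n choose 2)" by (rule C(2)[OF that])
    finally show ?thesis unfolding maxind_def ind_count_eq complete_multipartite_def by blast
  qed
  then show ?thesis using C(1) by blast
qed

end
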